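(* There is a universal constant $C>0$ such that for every $n\geq 1$ and every centrally symmetric convex polytope $P\subset\mathbb{R}^n$ with non-empty interior: (1) if $P$ has $2m$ facets then $L_P\le C\sqrt{\log(1+m)}$; (2) if $P$ has $2m$ vertices then $L_P\le C\log(1+m)$.
   Context: A centrally symmetric convex body $K\subset\mathbb{R}^n$ ($K=-K$) is in isotropic position if $\int_K\langle x,\theta\rangle^2dx$ is the same for all $\theta\in S^{n-1}$. Every such body has an invertible linear image of volume 1 in isotropic position, unique up to rotation; the isotropic constant $L_K$ is the number with $\int_{K'}\langle x,\theta\rangle^2dx=L_K^2$ for all $\theta\in S^{n-1}$, where $K'$ is such an image of $K$. *)

theory Defs
  imports "HOL-Analysis.Analysis" "HOL-Library.Function_Algebras"
begin

text \<open>
  The constant of the theorem is chosen before the dimension, so the dimension cannot be a type.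
  Following \<^const>\<open>Euclidean_space\<close>, the points of the \<open>n\<close>-dimensional space are the functions
  \<open>nat \<Rightarrow> real\<close> vanishing at all indices \<open>\<ge> n\<close>. The pointwise vector space structure makes the
  library notions \<^const>\<open>linear\<close>, \<^const>\<open>polytope\<close>, \<^const>\<open>face_of\<close>, \<^const>\<open>extreme_point_of\<close>
  available for such points.
\<close>

instantiation "fun" :: (type, real_vector) real_vector
begin

definition scaleR_fun :: "real \<Rightarrow> ('a \<Rightarrow> 'b) \<Rightarrow> 'a \<Rightarrow> 'b" where
  "scaleR_fun c f = (\<lambda>x. c *\<^sub>R f x)"

instance
  by standard (simp_all add: scaleR_fun_def fun_eq_iff scaleR_add_right scaleR_add_left)

end

abbreviation Rn :: "nat \<Rightarrow> (nat \<Rightarrow> real) set" where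
  "Rn n \<equiv> topspace (Euclidean_space n)"

definition inner_Rn :: "nat \<Rightarrow> (nat \<Rightarrow> real) \<Rightarrow> (nat \<Rightarrow> real) \<Rightarrow> real" where
  "inner_Rn n x y = (\<Sum>i<n. x i * y i)"

definition sphere_Rn :: "nat \<Rightarrow> (nat \<Rightarrow> real) set" where
  "sphere_Rn n = {\<theta> \<in> Rn n. inner_Rn n \<theta> \<theta> = 1}"

text \<open>
  Product Lebesgue measure lives on functions that are \<^const>\<open>undefined\<close> outside \<open>{..<n}\<close>;
  it is transported to functions that are zero there.
\<close>

definition lborel_Rn :: "nat \<Rightarrow> (nat \<Rightarrow> real) measure" where
  "lborel_Rn n = distr (\<Pi>\<^sub>M i\<in>{..<n}. lborel) borel (\<lambda>x i. if i < n then x i else 0)"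

definition second_moment :: "nat \<Rightarrow> (nat \<Rightarrow> real) set \<Rightarrow> (nat \<Rightarrow> real) \<Rightarrow> real" where
  "second_moment n K \<theta> = (LINT x:K|lborel_Rn n. (inner_Rn n x \<theta>)\<^sup>2)"

definition isotropic_position :: "nat \<Rightarrow> (nat \<Rightarrow> real) set \<Rightarrow> bool" where
  "isotropic_position n K \<longleftrightarrow> (\<exists>c. \<forall>\<theta>\<in>sphere_Rn n. second_moment n K \<theta> = c)"

definition isotropic_image :: "nat \<Rightarrow> (nat \<Rightarrow> real) set \<Rightarrow> (nat \<Rightarrow> real) set \<Rightarrow> bool" where
  "isotropic_image n K K' \<longleftrightarrow>
     (\<exists>T. linear T \<and> bij_betw T (Rn n) (Rn n) \<and> K' = T ` K) \<and>
     measure (lborel_Rn n) K' = 1 \<and> isotropic_position n K'"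

definition isotropic_constant :: "nat \<Rightarrow> (nat \<Rightarrow> real) set \<Rightarrow> real" where
  "isotropic_constant n K =
     (THE L. L \<ge> 0 \<and>
        (\<exists>K'. isotropic_image n K K' \<and> (\<forall>\<theta>\<in>sphere_Rn n. second_moment n K' \<theta> = L\<^sup>2)))"

text \<open>
  The library's \<open>aff_dim\<close> and \<open>facet_of\<close> are restricted to \<open>euclidean_space\<close> types; the
  following are their defining conditions, the facet being taken of a full-dimensional polytope
  in \<open>Rn n\<close>.
\<close>

definition has_aff_dim :: "'a::real_vector set \<Rightarrow> int \<Rightarrow> bool" where
  "has_aff_dim V d \<longleftrightarrow>
     (\<exists>B. finite B \<and> affine hull B = affine hull V \<and> \<not> affine_dependent B \<and> int (card B) = d + 1)"

definition facets :: "nat \<Rightarrow> (nat \<Rightarrow> real) set \<Rightarrow> (nat \<Rightarrow> real) set set" where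
  "facets n P = {F. F face_of P \<and> F \<noteq> {} \<and> has_aff_dim F (int n - 1)}"

definition vertices :: "(nat \<Rightarrow> real) set \<Rightarrow> (nat \<Rightarrow> real) set" where
  "vertices P = {v. v extreme_point_of P}"

definition symmetric_polytope :: "nat \<Rightarrow> (nat \<Rightarrow> real) set \<Rightarrow> bool" where
  "symmetric_polytope n P \<longleftrightarrow>
     polytope P \<and> P \<subseteq> Rn n \<and> P = uminus ` P \<and> Euclidean_space n interior_of P \<noteq> {}"

end

theory Submission
  imports Defs "HOL-Probability.Distributions"
begin

text \<open>
  Replace the polytope by its image \<open>K\<close> of volume 1 in isotropic position. In both parts a Gaussian
  vector with covariance \<open>\<sigma>\<^sup>2\<close> times the identity is shown to lie in \<open>K\<close> with probability at least \<open>1/2\<close>.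
  As \<open>K\<close> has volume 1 and the Gaussian density is at most \<open>(2 \<pi> \<sigma>\<^sup>2)\<^sup>-\<^sup>n\<^sup>/\<^sup>2\<close>, this forces \<open>\<sigma> \<le> 1\<close>.

  Facets: \<open>K\<close> is the intersection of the slabs \<open>\<bar>\<langle>w, x\<rangle>\<bar> \<le> 1\<close>, and
  \<open>L\<^sup>2 \<bar>w\<bar>\<^sup>2 = \<integral>\<^bsub>K\<^esub> \<langle>w, x\<rangle>\<^sup>2 dx \<le> 1\<close>. Hence every slab has half-width at least \<open>L\<close>, and a union bound over
  the slabs allows \<open>\<sigma>\<close> of order \<open>L / sqrt (log m)\<close>.

  Vertices: writing the points of \<open>K\<close> as convex combinations of the vertices turns
  \<open>L\<^sup>2 z = \<integral>\<^bsub>K\<^esub> \<langle>x, z\<rangle> x dx\<close> into \<open>L\<^sup>2 z = \<Sum> \<langle>u v, z\<rangle> v\<close>, summed over the vertices \<open>v\<close>. Since linear functionals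
  on a convex body have exponential tails (Prekopa--Leindler), \<open>\<Sum> \<bar>u v\<bar>\<close> is of order at most
  \<open>L log m\<close>; as \<open>z \<in> K\<close> once \<open>\<Sum> \<bar>\<langle>u v, z\<rangle>\<bar> \<le> L\<^sup>2\<close>, this allows \<open>\<sigma>\<close> of order \<open>L / log m\<close>.
\<close>

section \<open>Lebesgue measure on \<open>Rn n\<close>\<close>

text \<open>\<open>isotropic_constant\<close> is a definite description, so the bounds have content
  only once its number \<open>L\<close> is known to exist and to be unique. For existence, the
  covariance form of the polytope is orthonormalised. For uniqueness it is enough to recover the
  volume of the ball of radius \<open>L\<close>; that isotropic images agree up to rotation is never
  proved. The dimension is a number, so points are sequences, and a linear map may behave wildly off
  \<open>Rn n\<close>; it is therefore composed with a projection before it is integrated. Jacobians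
  stay unspecified positive factors, which the normalisation of the volume eliminates. Both bounds
  are free of the dimension because it enters only through the power \<open>n\<close> in the density
  bound, and for a base below 1/2 a larger power only helps. The extra logarithm for vertices comes
  from the weights: under exponential tails a weight of mass p can have a first moment
  \<open>u v\<close> of length about L p log (1/p), and over 2m weights of total mass 1 this adds up
  to order L log m. A Gaussian vector sees a vector only through its Euclidean length, so no further
  factor is lost.\<close>

definition proj_Rn :: "nat \<Rightarrow> (nat \<Rightarrow> real) \<Rightarrow> nat \<Rightarrow> real" where
  "proj_Rn n x = (\<lambda>i. if i < n then x i else 0)"

lemma Rn_iff: "x \<in> Rn n \<longleftrightarrow> (\<forall>i\<ge>n. x i = 0)"
  by (simp add: topspace_Euclidean_space)

lemma proj_Rn_in [simp]: "proj_Rn n x \<in> Rn n"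
  by (simp add: Rn_iff proj_Rn_def)

lemma proj_Rn_id: "x \<in> Rn n \<Longrightarrow> proj_Rn n x = x"
  by (force simp: Rn_iff proj_Rn_def fun_eq_iff)

lemma borel_measurable_coord [measurable]: "(\<lambda>x::nat \<Rightarrow> real. x i) \<in> borel_measurable borel"
  by (rule measurable_product_then_coordinatewise) simp

lemma borel_measurable_inner_Rn [measurable]:
  "(\<lambda>x. inner_Rn n x y) \<in> borel_measurable borel" "(\<lambda>x. inner_Rn n y x) \<in> borel_measurable borel"
  unfolding inner_Rn_def by measurable

lemma borel_measurable_proj_Rn [measurable]: "proj_Rn n \<in> borel \<rightarrow>\<^sub>M borel"
  unfolding proj_Rn_def by (rule measurable_coordinatewise_then_product) measurable

lemma measurable_PiM_proj_Rn [measurable]: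
  "proj_Rn n \<in> (\<Pi>\<^sub>M i\<in>{..<n}. lborel) \<rightarrow>\<^sub>M borel"
  unfolding proj_Rn_def
proof (rule measurable_coordinatewise_then_product)
  fix i
  show "(\<lambda>x. if i < n then x i else 0) \<in> borel_measurable (\<Pi>\<^sub>M i\<in>{..<n}. lborel :: real measure)"
    using measurable_component_singleton[of i "{..<n}" "\<lambda>_. lborel :: real measure"]
    by (cases "i < n") simp_all
qed

lemma lborel_Rn_eq: "lborel_Rn n = distr (\<Pi>\<^sub>M i\<in>{..<n}. lborel) borel (proj_Rn n)"
  unfolding lborel_Rn_def proj_Rn_def by simp

lemma sets_lborel_Rn [simp, measurable_cong]: "sets (lborel_Rn n) = sets borel"
  by (simp add: lborel_Rn_def)

lemma space_lborel_Rn [simp]: "space (lborel_Rn n) = UNIV"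
  by (simp add: lborel_Rn_def)

lemma product_sigma_finite_lborel: "product_sigma_finite (\<lambda>_::nat. lborel :: real measure)"
  by standard

lemma nn_integral_lborel_Rn:
  assumes [measurable]: "f \<in> borel_measurable borel"
  shows "(\<integral>\<^sup>+x. f x \<partial>lborel_Rn n) = (\<integral>\<^sup>+x. f (proj_Rn n x) \<partial>(\<Pi>\<^sub>M i\<in>{..<n}. lborel))"
  unfolding lborel_Rn_eq by (subst nn_integral_distr) simp_all

lemma emeasure_lborel_Rn:
  assumes [measurable]: "A \<in> sets borel"
  shows "emeasure (lborel_Rn n) A
    = emeasure (\<Pi>\<^sub>M i\<in>{..<n}. lborel) {x \<in> space (\<Pi>\<^sub>M i\<in>{..<n}. lborel). proj_Rn n x \<in> A}"
  unfolding lborel_Rn_eq by (subst emeasure_distr) (simp_all add: vimage_def Int_def conj_commute)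

lemma Rn_borel [measurable]: "Rn n \<in> sets borel"
proof -
  have "Rn n = {x \<in> space borel. \<forall>i. i \<ge> n \<longrightarrow> x i = 0}" by (auto simp: Rn_iff)
  also have "\<dots> \<in> sets borel" by measurable
  finally show ?thesis .
qed

lemma AE_Rn: "AE x in lborel_Rn n. x \<in> Rn n"
  unfolding lborel_Rn_eq by (subst AE_distr_iff) auto

lemma nn_integral_lborel_Rn_cong:
  "(\<And>x. x \<in> Rn n \<Longrightarrow> f x = g x) \<Longrightarrow> (\<integral>\<^sup>+x. f x \<partial>lborel_Rn n) = (\<integral>\<^sup>+x. g x \<partial>lborel_Rn n)"
  using AE_Rn[of n] by (intro nn_integral_cong_AE) auto

lemma nn_integral_lborel_Rn_mono:
  "(\<And>x. x \<in> Rn n \<Longrightarrow> f x \<le> g x) \<Longrightarrow> (\<integral>\<^sup>+x. f x \<partial>lborel_Rn n) \<le> (\<integral>\<^sup>+x. g x \<partial>lborel_Rn n)"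
  using AE_Rn[of n] by (intro nn_integral_mono_AE) auto

lemma nn_integral_lborel_Rn_prod:
  assumes [measurable]: "\<And>i. f i \<in> borel_measurable borel"
  shows "(\<integral>\<^sup>+x. (\<Prod>i<n. f i (x i)) \<partial>lborel_Rn n) = (\<Prod>i<n. \<integral>\<^sup>+t. f i t \<partial>lborel)"
proof -
  interpret product_sigma_finite "\<lambda>_::nat. lborel :: real measure"
    by (rule product_sigma_finite_lborel)
  have "(\<integral>\<^sup>+x. (\<Prod>i<n. f i (x i)) \<partial>lborel_Rn n)
    = (\<integral>\<^sup>+x. (\<Prod>i<n. f i (proj_Rn n x i)) \<partial>(\<Pi>\<^sub>M i\<in>{..<n}. lborel))"
    by (rule nn_integral_lborel_Rn) measurable
  also have "\<dots> = (\<integral>\<^sup>+x. (\<Prod>i<n. f i (x i)) \<partial>(\<Pi>\<^sub>M i\<in>{..<n}. lborel))"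
    by (simp add: proj_Rn_def)
  also have "\<dots> = (\<Prod>i<n. \<integral>\<^sup>+t. f i t \<partial>lborel)"
    by (rule product_nn_integral_prod) simp_all
  finally show ?thesis .
qed

definition box_Rn :: "nat \<Rightarrow> real \<Rightarrow> (nat \<Rightarrow> real) set" where
  "box_Rn n r = {x \<in> Rn n. \<forall>i<n. \<bar>x i\<bar> \<le> r}"

lemma box_Rn_iff: "x \<in> box_Rn n r \<longleftrightarrow> (\<forall>i\<ge>n. x i = 0) \<and> (\<forall>i<n. \<bar>x i\<bar> \<le> r)"
  unfolding box_Rn_def Rn_iff by simp

lemma box_Rn_borel [measurable]: "box_Rn n r \<in> sets borel"
proof -
  have "box_Rn n r = {x \<in> space borel. x \<in> Rn n \<and> (\<forall>i. i < n \<longrightarrow> \<bar>x i\<bar> \<le> r)}"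
    by (auto simp: box_Rn_def)
  also have "\<dots> \<in> sets borel" by measurable
  finally show ?thesis .
qed

lemma emeasure_box_Rn:
  assumes "r \<ge> 0"
  shows "emeasure (lborel_Rn n) (box_Rn n r) = ennreal ((2 * r) ^ n)"
proof -
  interpret product_sigma_finite "\<lambda>_::nat. lborel :: real measure"
    by (rule product_sigma_finite_lborel)
  have "emeasure (lborel_Rn n) (box_Rn n r)
    = emeasure (\<Pi>\<^sub>M i\<in>{..<n}. lborel) (\<Pi>\<^sub>E i\<in>{..<n}. {-r..r})"
  proof -
    have "proj_Rn n x \<in> box_Rn n r \<longleftrightarrow> (\<forall>i<n. x i \<in> {-r..r})" for x
      by (simp add: box_Rn_iff proj_Rn_def abs_le_iff minus_le_iff conj_commute)
    then have "{x \<in> space (\<Pi>\<^sub>M i\<in>{..<n}. lborel). proj_Rn n x \<in> box_Rn n r} = (\<Pi>\<^sub>E i\<in>{..<n}. {-r..r})"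
      unfolding space_PiM by (simp add: set_eq_iff PiE_iff Ball_def) blast
    then show ?thesis by (subst emeasure_lborel_Rn) simp_all
  qed
  also have "\<dots> = (\<Prod>i<n. ennreal (2 * r))"
    using assms by (subst emeasure_PiM) simp_all
  also have "\<dots> = ennreal ((2 * r) ^ n)"
    unfolding prod_constant card_lessThan using assms by (intro ennreal_power) simp
  finally show ?thesis .
qed

text \<open>The boxes exhaust only \<open>Rn n\<close>; its complement among all sequences is null
  and completes the countable cover.\<close>

lemma sigma_finite_lborel_Rn: "sigma_finite_measure (lborel_Rn n)"
proof
  have "emeasure (lborel_Rn n) (- Rn n) = 0"
    using AE_Rn[of n] by (subst (asm) AE_iff_measurable[where N="- Rn n"]) auto
  moreover have "(\<Union>k::nat. box_Rn n (real k)) \<union> - Rn n = UNIV"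
  proof -
    have "\<exists>k::nat. x \<in> box_Rn n (real k)" if "x \<in> Rn n" for x
    proof -
      obtain k :: nat where "(\<Sum>i<n. \<bar>x i\<bar>) \<le> real k"
        using real_arch_simple by blast
      moreover have "\<bar>x i\<bar> \<le> (\<Sum>i<n. \<bar>x i\<bar>)" if "i < n" for i
        by (rule member_le_sum) (use that in auto)
      ultimately have "\<bar>x i\<bar> \<le> real k" if "i < n" for i
        using that order_trans by blast
      then show ?thesis using \<open>x \<in> Rn n\<close> unfolding box_Rn_iff Rn_iff by blast
    qed
    then show ?thesis by auto
  qed
  moreover have "countable (insert (- Rn n) (range (\<lambda>k::nat. box_Rn n (real k))))"
    by (rule countable_insert) (rule countable_image, simp)
  moreover have "emeasure (lborel_Rn n) (box_Rn n (real k)) \<noteq> \<infinity>" for k :: nat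
    by (simp add: emeasure_box_Rn)
  moreover have "insert (- Rn n) (range (\<lambda>k::nat. box_Rn n (real k))) \<subseteq> sets (lborel_Rn n)"
    by auto
  ultimately show "\<exists>A. countable A \<and> A \<subseteq> sets (lborel_Rn n) \<and> \<Union> A = space (lborel_Rn n) \<and>
    (\<forall>a\<in>A. emeasure (lborel_Rn n) a \<noteq> \<infinity>)"
    by (intro exI[of _ "insert (- Rn n) (range (\<lambda>k::nat. box_Rn n (real k)))"])
      (simp only: space_lborel_Rn Union_insert Un_commute ball_simps simp_thms infinity_ennreal_def, simp)
qed

text \<open>A product measure is determined on rectangles, and on a rectangle the map splits into
  one-dimensional affine changes of variable, each with factor \<open>\<bar>s\<bar>\<close>.\<close>

lemma PiM_lborel_affine:
  fixes a :: "nat \<Rightarrow> real"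
  assumes I: "finite I" and s: "s \<noteq> 0"
  shows "density (distr (\<Pi>\<^sub>M i\<in>I. lborel) (\<Pi>\<^sub>M i\<in>I. lborel) (\<lambda>x. \<lambda>i\<in>I. a i + s * x i))
    (\<lambda>_. ennreal (\<bar>s\<bar> ^ card I)) = (\<Pi>\<^sub>M i\<in>I. lborel)" (is "density (distr ?P ?P ?g) _ = _")
proof -
  interpret product_sigma_finite "\<lambda>_::nat. lborel :: real measure"
    by (rule product_sigma_finite_lborel)
  have g[measurable]: "?g \<in> ?P \<rightarrow>\<^sub>M ?P" by measurable
  show ?thesis
  proof (rule PiM_eqI[OF I])
    fix A :: "nat \<Rightarrow> real set" assume A: "\<And>i. i \<in> I \<Longrightarrow> A i \<in> sets lborel"
    have PA[measurable]: "Pi\<^sub>E I A \<in> sets ?P" using A I by (intro sets_PiM_I_finite) auto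
    have pre: "{x. a i + s * x \<in> A i} \<in> sets borel" if "i \<in> I" for i
    proof -
      have [measurable]: "A i \<in> sets borel" using A[OF that] by simp
      show ?thesis by measurable
    qed
    have one: "ennreal \<bar>s\<bar> * emeasure lborel {x. a i + s * x \<in> A i} = emeasure lborel (A i)" if "i \<in> I" for i
    proof -
      have [measurable]: "A i \<in> sets borel" using A[OF that] by simp
      have "emeasure lborel (A i) = (\<integral>\<^sup>+x. indicator (A i) x \<partial>lborel)" by simp
      also have "\<dots> = ennreal \<bar>s\<bar> * (\<integral>\<^sup>+x. indicator (A i) (a i + s * x) \<partial>lborel)"
        by (rule nn_integral_real_affine) (use s in auto)
      also have "(\<integral>\<^sup>+x. indicator (A i) (a i + s * x) \<partial>lborel) = (\<integral>\<^sup>+x. indicator {x. a i + s * x \<in> A i} x \<partial>lborel)"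
        by (intro nn_integral_cong) (auto simp: indicator_def)
      finally show ?thesis using pre[OF that] by simp
    qed
    have "emeasure (density (distr ?P ?P ?g) (\<lambda>_. ennreal (\<bar>s\<bar> ^ card I))) (Pi\<^sub>E I A)
      = ennreal (\<bar>s\<bar> ^ card I) * emeasure ?P (?g -` Pi\<^sub>E I A \<inter> space ?P)"
      by (simp add: emeasure_density_const emeasure_distr)
    also have "?g -` Pi\<^sub>E I A \<inter> space ?P = (\<Pi>\<^sub>E i\<in>I. {x. a i + s * x \<in> A i})"
      by (auto simp: space_PiM PiE_iff)
    also have "emeasure ?P \<dots> = (\<Prod>i\<in>I. emeasure lborel {x. a i + s * x \<in> A i})"
      using pre by (intro emeasure_PiM I) auto
    also have "ennreal (\<bar>s\<bar> ^ card I) * \<dots> = (\<Prod>i\<in>I. ennreal \<bar>s\<bar>) * \<dots>"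
      by (simp add: ennreal_power)
    also have "(\<Prod>i\<in>I. ennreal \<bar>s\<bar>) * (\<Prod>i\<in>I. emeasure lborel {x. a i + s * x \<in> A i})
      = (\<Prod>i\<in>I. emeasure lborel (A i))"
      by (subst prod.distrib[symmetric]) (auto intro!: prod.cong simp: one)
    finally show "emeasure (density (distr ?P ?P ?g) (\<lambda>_. ennreal (\<bar>s\<bar> ^ card I))) (Pi\<^sub>E I A)
      = (\<Prod>i\<in>I. emeasure lborel (A i))" .
  qed simp
qed

text \<open>Translations (\<open>s = 1\<close>), dilations and the reflection
  (\<open>s = -1\<close>) are all instances; these are the only maps of \<open>Rn n\<close> whose
  Jacobian is given explicitly.\<close>

lemma nn_integral_lborel_Rn_affine:
  assumes [measurable]: "f \<in> borel_measurable borel" and s: "s \<noteq> 0" and a: "a \<in> Rn n"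
  shows "(\<integral>\<^sup>+x. f x \<partial>lborel_Rn n) = ennreal (\<bar>s\<bar> ^ n) * (\<integral>\<^sup>+x. f (a + s *\<^sub>R x) \<partial>lborel_Rn n)"
proof -
  let ?P = "\<Pi>\<^sub>M i\<in>{..<n}. lborel :: real measure"
  let ?g = "\<lambda>x. \<lambda>i\<in>{..<n}. a i + s * x i"
  have m1: "(\<lambda>x::nat \<Rightarrow> real. a + s *\<^sub>R x) \<in> borel \<rightarrow>\<^sub>M borel"
    by (rule measurable_coordinatewise_then_product) (simp add: scaleR_fun_def)
  note [measurable] = measurable_compose[OF m1 assms(1)]
  have [measurable]: "?g \<in> ?P \<rightarrow>\<^sub>M ?P" by measurable
  have "(\<integral>\<^sup>+x. f x \<partial>lborel_Rn n) = (\<integral>\<^sup>+x. f (proj_Rn n x) \<partial>?P)"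
    by (rule nn_integral_lborel_Rn) measurable
  also have "\<dots> = (\<integral>\<^sup>+x. f (proj_Rn n x) \<partial>density (distr ?P ?P ?g) (\<lambda>_. ennreal (\<bar>s\<bar> ^ card {..<n})))"
    by (subst PiM_lborel_affine[OF _ s]) auto
  also have "\<dots> = ennreal (\<bar>s\<bar> ^ n) * (\<integral>\<^sup>+x. f (proj_Rn n (?g x)) \<partial>?P)"
    by (subst nn_integral_density) (simp_all add: nn_integral_distr nn_integral_cmult)
  also have "(\<integral>\<^sup>+x. f (proj_Rn n (?g x)) \<partial>?P) = (\<integral>\<^sup>+x. f (a + s *\<^sub>R proj_Rn n x) \<partial>?P)"
    using a by (intro nn_integral_cong arg_cong[where f=f])
      (auto simp: proj_Rn_def fun_eq_iff scaleR_fun_def Rn_iff)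
  also have "\<dots> = (\<integral>\<^sup>+x. f (a + s *\<^sub>R x) \<partial>lborel_Rn n)"
    by (subst nn_integral_lborel_Rn) simp_all
  finally show ?thesis .
qed

section \<open>Linear maps of \<open>Rn n\<close>\<close>

lemma sum_fun_apply: "(\<Sum>i\<in>A. f i) x = (\<Sum>i\<in>A. f i x :: 'a::comm_monoid_add)"
  by (induction A rule: infinite_finite_induct) auto

lemma scaleR_fun_apply [simp]: "(c *\<^sub>R f) x = c *\<^sub>R f x"
  by (simp add: scaleR_fun_def)

definition unit_Rn :: "nat \<Rightarrow> nat \<Rightarrow> real" where
  "unit_Rn i = (\<lambda>j. if j = i then 1 else 0)"

lemma unit_Rn_in [simp]: "i < n \<Longrightarrow> unit_Rn i \<in> Rn n"
  by (auto simp: Rn_iff unit_Rn_def)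

lemma proj_Rn_eq_sum: "proj_Rn n x = (\<Sum>i<n. x i *\<^sub>R unit_Rn i)"
  by (auto simp: fun_eq_iff sum_fun_apply proj_Rn_def unit_Rn_def if_distrib cong: if_cong)

lemma Rn_eq_sum: "x \<in> Rn n \<Longrightarrow> x = (\<Sum>i<n. x i *\<^sub>R unit_Rn i)"
  using proj_Rn_id proj_Rn_eq_sum by metis

lemma Rn_0 [simp]: "0 \<in> Rn n"
  and Rn_add [intro]: "x \<in> Rn n \<Longrightarrow> y \<in> Rn n \<Longrightarrow> x + y \<in> Rn n"
  and Rn_scaleR [intro]: "x \<in> Rn n \<Longrightarrow> c *\<^sub>R x \<in> Rn n"
  and Rn_uminus [intro]: "x \<in> Rn n \<Longrightarrow> - x \<in> Rn n"
  and Rn_diff [intro]: "x \<in> Rn n \<Longrightarrow> y \<in> Rn n \<Longrightarrow> x - y \<in> Rn n"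
  by (auto simp: Rn_iff)

lemma Rn_sum: "(\<And>i. i \<in> A \<Longrightarrow> f i \<in> Rn n) \<Longrightarrow> (\<Sum>i\<in>A. f i) \<in> Rn n"
  by (auto simp: Rn_iff sum_fun_apply)

lemma subspace_Rn: "subspace (Rn n)"
  by (auto simp: subspace_def)

lemma inner_Rn_commute: "inner_Rn n x y = inner_Rn n y x"
  by (simp add: inner_Rn_def mult.commute)

lemma inner_Rn_simps [simp]:
  "inner_Rn n (x + y) z = inner_Rn n x z + inner_Rn n y z"
  "inner_Rn n z (x + y) = inner_Rn n z x + inner_Rn n z y"
  "inner_Rn n (x - y) z = inner_Rn n x z - inner_Rn n y z"
  "inner_Rn n z (x - y) = inner_Rn n z x - inner_Rn n z y"
  "inner_Rn n (c *\<^sub>R x) z = c * inner_Rn n x z"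
  "inner_Rn n z (c *\<^sub>R x) = c * inner_Rn n z x"
  "inner_Rn n (- x) z = - inner_Rn n x z"
  "inner_Rn n z (- x) = - inner_Rn n z x"
  "inner_Rn n 0 z = 0" "inner_Rn n z 0 = 0"
  by (simp_all add: inner_Rn_def algebra_simps sum.distrib sum_subtractf sum_distrib_left sum_negf)

lemma inner_Rn_sum:
  "inner_Rn n (\<Sum>i\<in>A. f i) z = (\<Sum>i\<in>A. inner_Rn n (f i) z)"
  "inner_Rn n z (\<Sum>i\<in>A. f i) = (\<Sum>i\<in>A. inner_Rn n z (f i))"
  by (induction A rule: infinite_finite_induct) auto

lemma inner_Rn_unit [simp]:
  "i < n \<Longrightarrow> inner_Rn n x (unit_Rn i) = x i" "i < n \<Longrightarrow> inner_Rn n (unit_Rn i) x = x i"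
  by (simp_all add: inner_Rn_def unit_Rn_def if_distrib[where f="\<lambda>t. _ * t"] if_distrib[where f="\<lambda>t. t * _"] cong: if_cong)

lemma inner_Rn_nonneg [simp]: "inner_Rn n x x \<ge> 0"
  by (simp add: inner_Rn_def sum_nonneg)

lemma inner_Rn_eq_0: "x \<in> Rn n \<Longrightarrow> inner_Rn n x x = 0 \<longleftrightarrow> x = 0"
  by (auto simp: inner_Rn_def sum_nonneg_eq_0_iff Rn_iff fun_eq_iff not_less) (metis lessThan_iff not_less)

lemma inner_Rn_pos: "x \<in> Rn n \<Longrightarrow> x \<noteq> 0 \<Longrightarrow> inner_Rn n x x > 0"
  using inner_Rn_eq_0[of x n] inner_Rn_nonneg[of n x] by linarith

lemma linear_proj_Rn: "linear T \<Longrightarrow> T (proj_Rn n x) = (\<Sum>i<n. x i *\<^sub>R T (unit_Rn i))"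
  by (simp add: proj_Rn_eq_sum linear_sum linear_cmul o_def)

lemma linear_Rn_eq_sum: "linear T \<Longrightarrow> x \<in> Rn n \<Longrightarrow> T x = (\<Sum>i<n. x i *\<^sub>R T (unit_Rn i))"
  by (metis linear_proj_Rn proj_Rn_id)

text \<open>A linear map on all real sequences can be discontinuous. After the projection it is a
  finite sum of coordinates times fixed vectors.\<close>

lemma continuous_on_linear_proj_Rn:
  fixes T :: "(nat \<Rightarrow> real) \<Rightarrow> nat \<Rightarrow> real"
  assumes "linear T"
  shows "continuous_on A (\<lambda>x. T (proj_Rn n x))"
  unfolding linear_proj_Rn[OF assms]
  by (rule continuous_on_coordinatewise_then_product)
     (auto simp: sum_fun_apply intro!: continuous_intros continuous_on_product_then_coordinatewise[OF continuous_on_id])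

lemma borel_measurable_linear_proj_Rn:
  fixes T :: "(nat \<Rightarrow> real) \<Rightarrow> nat \<Rightarrow> real"
  shows "linear T \<Longrightarrow> (\<lambda>x. T (proj_Rn n x)) \<in> borel \<rightarrow>\<^sub>M borel"
  by (rule borel_measurable_continuous_onI) (rule continuous_on_linear_proj_Rn)

text \<open>The inverse has to be linear on the whole type and not only on \<open>Rn n\<close>, so
  it is rebuilt from preimages \<open>d i\<close> of the unit vectors.\<close>

lemma linear_inverse_Rn:
  fixes T :: "(nat \<Rightarrow> real) \<Rightarrow> nat \<Rightarrow> real"
  assumes T: "linear T" and bij: "bij_betw T (Rn n) (Rn n)"
  obtains S where "linear S" "\<And>x. x \<in> Rn n \<Longrightarrow> S x \<in> Rn n"
    "\<And>x. x \<in> Rn n \<Longrightarrow> T (S x) = x" "\<And>x. x \<in> Rn n \<Longrightarrow> S (T x) = x"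
proof -
  have "\<forall>i\<in>{..<n}. \<exists>y. y \<in> Rn n \<and> T y = unit_Rn i"
  proof
    fix i assume "i \<in> {..<n}"
    then have "unit_Rn i \<in> T ` Rn n" using bij_betw_imp_surj_on[OF bij] unit_Rn_in by auto
    then show "\<exists>y. y \<in> Rn n \<and> T y = unit_Rn i" unfolding image_iff by metis
  qed
  then have "\<exists>d. \<forall>i\<in>{..<n}. d i \<in> Rn n \<and> T (d i) = unit_Rn i"
    by (rule bchoice)
  then obtain d where d: "\<And>i. i < n \<Longrightarrow> d i \<in> Rn n" "\<And>i. i < n \<Longrightarrow> T (d i) = unit_Rn i"
    by blast
  define S where "S x = (\<Sum>i<n. x i *\<^sub>R d i)" for x
  have lin: "linear S"
    by (rule linearI) (simp_all add: S_def scaleR_add_left sum.distrib scaleR_sum_right)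
  have S: "S x \<in> Rn n" for x unfolding S_def by (intro Rn_sum Rn_scaleR) (use d in auto)
  have TS: "T (S x) = x" if "x \<in> Rn n" for x
  proof -
    have "T (S x) = (\<Sum>i<n. x i *\<^sub>R unit_Rn i)"
      unfolding S_def by (simp add: linear_sum[OF T] linear_cmul[OF T] d)
    then show ?thesis using Rn_eq_sum[OF that] by simp
  qed
  have ST: "S (T x) = x" if "x \<in> Rn n" for x
  proof -
    have "T x \<in> Rn n" using bij that bij_betw_apply by fastforce
    then show ?thesis using bij TS[of "T x"] S that unfolding bij_betw_def inj_on_def by blast
  qed
  show ?thesis by (rule that[OF lin S TS ST])
qed

text \<open>The transpose, read off from the images of the unit vectors.\<close>

lemma linear_adjoint_Rn:
  fixes T :: "(nat \<Rightarrow> real) \<Rightarrow> nat \<Rightarrow> real"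
  assumes "linear T"
  obtains \<phi> where "\<phi> \<in> Rn n" "\<And>y. y \<in> Rn n \<Longrightarrow> inner_Rn n (T y) \<theta> = inner_Rn n y \<phi>"
proof
  let ?\<phi> = "\<lambda>i. if i < n then inner_Rn n (T (unit_Rn i)) \<theta> else 0"
  show "?\<phi> \<in> Rn n" by (simp add: Rn_iff)
  show "inner_Rn n (T y) \<theta> = inner_Rn n y ?\<phi>" if "y \<in> Rn n" for y
    by (subst linear_Rn_eq_sum[OF assms that]) (simp add: inner_Rn_sum inner_Rn_def[of n y])
qed

text \<open>An operator bound for the maximum norm. The sum of the absolute matrix entries is a
  crude constant; the added 1 keeps it positive.\<close>

lemma linear_box_Rn:
  fixes T :: "(nat \<Rightarrow> real) \<Rightarrow> nat \<Rightarrow> real"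
  assumes T: "linear T" and TR: "\<And>x. x \<in> Rn n \<Longrightarrow> T x \<in> Rn n"
  obtains D where "D > 0" "\<And>r x. x \<in> box_Rn n r \<Longrightarrow> T x \<in> box_Rn n (D * r)"
proof
  let ?D = "1 + (\<Sum>j<n. \<Sum>i<n. \<bar>T (unit_Rn i) j\<bar>)"
  show "?D > 0" by (intro add_pos_nonneg sum_nonneg) auto
  show "T x \<in> box_Rn n (?D * r)" if x: "x \<in> box_Rn n r" for r x
  proof -
    have "x \<in> Rn n" using x by (simp add: box_Rn_def)
    have "\<bar>T x j\<bar> \<le> ?D * r" if "j < n" for j
    proof -
      have r: "0 \<le> r" using x that unfolding box_Rn_iff by (meson abs_ge_zero order_trans)
      have "\<bar>T x j\<bar> = \<bar>\<Sum>i<n. x i * T (unit_Rn i) j\<bar>"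
        by (subst linear_Rn_eq_sum[OF T \<open>x \<in> Rn n\<close>]) (simp add: sum_fun_apply)
      also have "\<dots> \<le> (\<Sum>i<n. r * \<bar>T (unit_Rn i) j\<bar>)"
        using x by (intro order_trans[OF sum_abs] sum_mono) (auto simp: abs_mult box_Rn_iff intro: mult_right_mono)
      also have "\<dots> = (\<Sum>i<n. \<bar>T (unit_Rn i) j\<bar>) * r" by (simp add: sum_distrib_left mult.commute)
      also have "(\<Sum>i<n. \<bar>T (unit_Rn i) j\<bar>) \<le> (\<Sum>j<n. \<Sum>i<n. \<bar>T (unit_Rn i) j\<bar>)"
        by (rule member_le_sum[of j "{..<n}" "\<lambda>j. \<Sum>i<n. \<bar>T (unit_Rn i) j\<bar>"]) (use that in \<open>auto intro: sum_nonneg\<close>)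
      finally show ?thesis using r by (smt (verit) mult_right_mono)
    qed
    then show ?thesis using TR[OF \<open>x \<in> Rn n\<close>] by (simp add: box_Rn_def)
  qed
qed

text \<open>Uniqueness of Haar measure: the image of Lebesgue measure under \<open>T\<close> is translation invariant,
  and integrating \<open>f (T x + y) * g y\<close> in both orders compares it with Lebesgue measure.\<close>

lemma nn_integral_linear_Rn:
  fixes T :: "(nat \<Rightarrow> real) \<Rightarrow> nat \<Rightarrow> real"
  assumes T: "linear T" and bij: "bij_betw T (Rn n) (Rn n)"
  obtains c where "c > 0"
    "\<And>f. f \<in> borel_measurable borel \<Longrightarrow>
      (\<integral>\<^sup>+x. f (T (proj_Rn n x)) \<partial>lborel_Rn n) = ennreal c * (\<integral>\<^sup>+x. f x \<partial>lborel_Rn n)"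
proof -
  obtain Ti where Ti: "linear Ti" "\<And>x. x \<in> Rn n \<Longrightarrow> Ti x \<in> Rn n"
    "\<And>x. x \<in> Rn n \<Longrightarrow> T (Ti x) = x" "\<And>x. x \<in> Rn n \<Longrightarrow> Ti (T x) = x"
    using linear_inverse_Rn[OF T bij] by blast
  have TR: "T x \<in> Rn n" if "x \<in> Rn n" for x
    using bij that bij_betw_apply by fastforce
  define S where "S x = T (proj_Rn n x)" for x
  have S_m[measurable]: "S \<in> borel \<rightarrow>\<^sub>M borel"
    unfolding S_def using borel_measurable_linear_proj_Rn[OF T] by simp
  have SR: "S x \<in> Rn n" for x using TR by (simp add: S_def)
  have S_add: "S (b + x) = T b + S x" if "b \<in> Rn n" for b x
  proof -
    have "proj_Rn n (b + x) = b + proj_Rn n x"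
      using that by (auto simp: proj_Rn_def Rn_iff fun_eq_iff)
    then show ?thesis by (simp add: S_def linear_add[OF T])
  qed
  let ?M = "lborel_Rn n"
  interpret M: sigma_finite_measure ?M by (rule sigma_finite_lborel_Rn)
  interpret MM: pair_sigma_finite ?M ?M by unfold_locales
  \<comment> \<open>Any even test function with finite positive integral would serve; for this cube
    the integral is explicitly \<open>2 ^ n\<close>.\<close>
  define g :: "(nat \<Rightarrow> real) \<Rightarrow> ennreal" where "g = indicator (box_Rn n 1)"
  have g_m[measurable]: "g \<in> borel_measurable borel" by (simp add: g_def)
  have g_even: "g (- x) = g x" for x by (simp add: g_def indicator_def box_Rn_iff)
  have g1: "(\<integral>\<^sup>+x. g x \<partial>?M) = ennreal (2 ^ n)"
    by (simp add: g_def emeasure_box_Rn)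
  define J where "J = (\<integral>\<^sup>+x. g (S x) \<partial>?M)"
  have main: "(\<integral>\<^sup>+x. f (S x) \<partial>?M) * ennreal (2 ^ n) = (\<integral>\<^sup>+x. f x \<partial>?M) * J"
    if f[measurable]: "f \<in> borel_measurable borel" for f
  proof -
    have plus_m: "(\<lambda>p. S (fst p) + snd p) \<in> borel \<Otimes>\<^sub>M borel \<rightarrow>\<^sub>M borel"
      "(\<lambda>p. snd p - S (fst p)) \<in> borel \<Otimes>\<^sub>M borel \<rightarrow>\<^sub>M borel"
      by (rule measurable_coordinatewise_then_product; simp)+
    have MM_eq: "borel_measurable (?M \<Otimes>\<^sub>M ?M) = borel_measurable (borel \<Otimes>\<^sub>M borel)"
      by (intro measurable_cong_sets sets_pair_measure_cong) simp_all
    have pair_m: "(\<lambda>(x, y). f (S x + y) * g y) \<in> borel_measurable (?M \<Otimes>\<^sub>M ?M)"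
      "(\<lambda>(x, y). f y * g (y - S x)) \<in> borel_measurable (?M \<Otimes>\<^sub>M ?M)"
      unfolding split_beta MM_eq
      by - (intro borel_measurable_times_ennreal measurable_compose[OF plus_m(1) f] measurable_compose[OF plus_m(2) g_m]
        measurable_compose[OF measurable_snd f] measurable_compose[OF measurable_snd g_m])+
    have diff_m: "(\<lambda>x. y - S x) \<in> borel \<rightarrow>\<^sub>M borel" "(\<lambda>x. x - S y) \<in> borel \<rightarrow>\<^sub>M borel"
      for y :: "nat \<Rightarrow> real"
      by (rule measurable_coordinatewise_then_product; simp)+
    note [measurable] = measurable_compose[OF diff_m(1) g_m] measurable_compose[OF diff_m(2) g_m]
    have "(\<integral>\<^sup>+x. f (S x) \<partial>?M) * ennreal (2 ^ n) = (\<integral>\<^sup>+y. (\<integral>\<^sup>+x. f (S x) \<partial>?M) * g y \<partial>?M)"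
      by (subst nn_integral_cmult) (simp_all add: g1)
    \<comment> \<open>Adding \<open>Ti y\<close> to \<open>x\<close> shifts \<open>S x\<close> by
      exactly \<open>y\<close>, and Lebesgue measure is invariant under this translation.\<close>
    also have "\<dots> = (\<integral>\<^sup>+y. (\<integral>\<^sup>+x. f (S x + y) * g y \<partial>?M) \<partial>?M)"
    proof (rule nn_integral_lborel_Rn_cong)
      fix y assume y: "y \<in> Rn n"
      have "(\<integral>\<^sup>+x. f (S x) \<partial>?M) = (\<integral>\<^sup>+x. f (S (Ti y + 1 *\<^sub>R x)) \<partial>?M)"
        by (subst nn_integral_lborel_Rn_affine[of "\<lambda>x. f (S x)" 1 "Ti y"]) (use Ti(2) y in auto)
      also have "\<dots> = (\<integral>\<^sup>+x. f (S x + y) \<partial>?M)"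
        using S_add[OF Ti(2)[OF y]] Ti(3)[OF y] by (simp add: add.commute)
      finally have *: "(\<integral>\<^sup>+x. f (S x) \<partial>?M) = (\<integral>\<^sup>+x. f (S x + y) \<partial>?M)" .
      have "(\<lambda>x. f (S x + y)) \<in> borel_measurable borel"
      proof -
        have "(\<lambda>x. S x + y) \<in> borel \<rightarrow>\<^sub>M borel"
          by (rule measurable_coordinatewise_then_product) simp
        then show ?thesis using measurable_compose f by blast
      qed
      then show "(\<integral>\<^sup>+x. f (S x) \<partial>?M) * g y = (\<integral>\<^sup>+x. f (S x + y) * g y \<partial>?M)"
        by (subst nn_integral_multc) (simp_all add: *)
    qed
    also have "\<dots> = (\<integral>\<^sup>+x. (\<integral>\<^sup>+y. f (S x + y) * g y \<partial>?M) \<partial>?M)"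
      by (rule MM.Fubini'[OF pair_m(1)])
    also have "\<dots> = (\<integral>\<^sup>+x. (\<integral>\<^sup>+y. f y * g (y - S x) \<partial>?M) \<partial>?M)"
    proof (rule nn_integral_lborel_Rn_cong)
      fix x
      show "(\<integral>\<^sup>+y. f (S x + y) * g y \<partial>?M) = (\<integral>\<^sup>+y. f y * g (y - S x) \<partial>?M)"
        by (subst nn_integral_lborel_Rn_affine[of "\<lambda>y. f y * g (y - S x)" 1 "S x"]) (use SR in auto)
    qed
    also have "\<dots> = (\<integral>\<^sup>+y. (\<integral>\<^sup>+x. f y * g (y - S x) \<partial>?M) \<partial>?M)"
      by (rule MM.Fubini'[OF pair_m(2), symmetric])
    \<comment> \<open>The same translation turns \<open>y - S x\<close> into \<open>- S x\<close>;
      evenness of \<open>g\<close> removes the sign.\<close>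
    also have "\<dots> = (\<integral>\<^sup>+y. f y * J \<partial>?M)"
    proof (rule nn_integral_lborel_Rn_cong)
      fix y assume y: "y \<in> Rn n"
      have "(\<integral>\<^sup>+x. g (y - S x) \<partial>?M) = (\<integral>\<^sup>+x. g (y - S (Ti y + 1 *\<^sub>R x)) \<partial>?M)"
        by (subst nn_integral_lborel_Rn_affine[of "\<lambda>x. g (y - S x)" 1 "Ti y"]) (use Ti(2) y in auto)
      also have "\<dots> = J"
        unfolding J_def using S_add[OF Ti(2)[OF y]] Ti(3)[OF y] g_even by simp
      finally have *: "(\<integral>\<^sup>+x. g (y - S x) \<partial>?M) = J" .
      show "(\<integral>\<^sup>+x. f y * g (y - S x) \<partial>?M) = f y * J"
        by (subst nn_integral_cmult) (simp_all add: *)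
    qed
    also have "\<dots> = (\<integral>\<^sup>+x. f x \<partial>?M) * J"
      by (rule nn_integral_multc) simp
    finally show ?thesis .
  qed
  \<comment> \<open>\<open>J\<close> is the volume of the preimage of a cube under \<open>T\<close>.
    The bounds for \<open>T\<close> and its inverse catch it between two cubes, so it is finite and
    positive.\<close>
  obtain D where D: "D > 0" "\<And>r x. x \<in> box_Rn n r \<Longrightarrow> Ti x \<in> box_Rn n (D * r)"
    using linear_box_Rn[OF Ti(1,2)] by blast
  obtain D' where D': "D' > 0" "\<And>r x. x \<in> box_Rn n r \<Longrightarrow> T x \<in> box_Rn n (D' * r)"
    using linear_box_Rn[OF T TR] by blast
  have "J \<le> (\<integral>\<^sup>+x. indicator (box_Rn n D) x \<partial>?M)"
    unfolding J_def
  proof (rule nn_integral_lborel_Rn_mono)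
    fix x assume x: "x \<in> Rn n"
    have "x \<in> box_Rn n D" if "T x \<in> box_Rn n 1" using D(2)[OF that] Ti(4)[OF x] by simp
    then show "g (S x) \<le> indicator (box_Rn n D) x"
      using x by (auto simp: g_def S_def proj_Rn_id indicator_def)
  qed
  also have "\<dots> = ennreal ((2 * D) ^ n)" using D(1) by (simp add: emeasure_box_Rn)
  finally have "J < \<infinity>" using ennreal_less_top le_less_trans unfolding infinity_ennreal_def by blast
  have "ennreal ((2 * (1 / D')) ^ n) = (\<integral>\<^sup>+x. indicator (box_Rn n (1 / D')) x \<partial>?M)"
    using D'(1) by (subst nn_integral_indicator) (auto simp: emeasure_box_Rn)
  also have "\<dots> \<le> J"
    unfolding J_def
  proof (rule nn_integral_lborel_Rn_mono)
    fix x assume x: "x \<in> Rn n"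
    have "T x \<in> box_Rn n 1" if "x \<in> box_Rn n (1 / D')" using D'(2)[OF that] D'(1) by simp
    then show "indicator (box_Rn n (1 / D')) x \<le> g (S x)"
      using x by (auto simp: g_def S_def proj_Rn_id indicator_def)
  qed
  finally have "ennreal ((2 * (1 / D')) ^ n) \<le> J" .
  moreover have "0 < ennreal ((2 * (1 / D')) ^ n)" using D'(1) unfolding ennreal_less_zero_iff by simp
  ultimately have "J > 0" by (rule less_le_trans[rotated])
  \<comment> \<open>In classical terms this is \<open>1 / \<bar>det T\<bar>\<close>.\<close>
  define c where "c = enn2real J / 2 ^ n"
  have "J = ennreal (c * 2 ^ n)" using \<open>J < \<infinity>\<close> by (simp add: c_def)
  then have J: "J = ennreal c * ennreal (2 ^ n)"
    by (subst ennreal_mult''[symmetric]) auto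
  have "c > 0" using \<open>J > 0\<close> \<open>J < \<infinity>\<close> by (simp add: c_def enn2real_positive_iff)
  show thesis
  proof (rule that[OF \<open>c > 0\<close>])
    fix f :: "(nat \<Rightarrow> real) \<Rightarrow> ennreal" assume f: "f \<in> borel_measurable borel"
    have "(\<integral>\<^sup>+x. f (S x) \<partial>?M) * ennreal (2 ^ n) = (ennreal c * (\<integral>\<^sup>+x. f x \<partial>?M)) * ennreal (2 ^ n)"
      unfolding main[OF f] J by (simp only: ac_simps)
    moreover have "a = b" if "a * ennreal (2 ^ n) = b * ennreal (2 ^ n)" for a b
    proof -
      have "ennreal (2 ^ n) \<noteq> 0" by (simp add: not_le)
      then have "x = x * ennreal (2 ^ n) / ennreal (2 ^ n)" for x
        using mult_divide_eq_ennreal[of "ennreal (2 ^ n)" x] by simp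
      then show ?thesis using that by metis
    qed
    ultimately show "(\<integral>\<^sup>+x. f (T (proj_Rn n x)) \<partial>?M) = ennreal c * (\<integral>\<^sup>+x. f x \<partial>?M)"
      unfolding S_def by blast
  qed
qed

section \<open>Gaussian weights\<close>

definition gauss_Rn :: "nat \<Rightarrow> real \<Rightarrow> (nat \<Rightarrow> real) \<Rightarrow> real" where
  "gauss_Rn n \<sigma> x = (\<Prod>i<n. normal_density 0 \<sigma> (x i))"

lemma gauss_Rn_nonneg [simp]: "gauss_Rn n \<sigma> x \<ge> 0"
  by (simp add: gauss_Rn_def prod_nonneg)

lemma borel_measurable_gauss_Rn [measurable]: "gauss_Rn n \<sigma> \<in> borel_measurable borel"
  unfolding gauss_Rn_def[abs_def] by measurable

text \<open>Completing the square: the exponential factor moves the mean and keeps the variance,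
  which reduces exponential moments to total mass 1.\<close>

lemma exp_mult_normal_density:
  assumes "\<sigma> > 0"
  shows "exp (u * t) * normal_density 0 \<sigma> t = exp (\<sigma>\<^sup>2 * u\<^sup>2 / 2) * normal_density (\<sigma>\<^sup>2 * u) \<sigma> t"
proof -
  have "u * t + - t\<^sup>2 / (2 * \<sigma>\<^sup>2) = \<sigma>\<^sup>2 * u\<^sup>2 / 2 + - (t - \<sigma>\<^sup>2 * u)\<^sup>2 / (2 * \<sigma>\<^sup>2)"
    using assms by (simp add: field_simps power2_eq_square)
  then show ?thesis
    unfolding normal_density_def by (simp add: mult.left_commute exp_add[symmetric])
qed

lemma nn_integral_normal_density:
  assumes "\<sigma> > 0"
  shows "(\<integral>\<^sup>+t. ennreal (normal_density \<mu> \<sigma> t) \<partial>lborel) = 1"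
proof -
  interpret prob_space "density lborel (normal_density \<mu> \<sigma>)"
    using assms by (rule prob_space_normal_density)
  show ?thesis using emeasure_space_1 by (simp add: emeasure_density)
qed

text \<open>The moment generating function factors over the coordinates. Both Gaussian estimates
  rest on it: Chernoff bounds for the slabs and first absolute moments for the vertices.\<close>

lemma nn_integral_gauss_exp:
  assumes "\<sigma> > 0"
  shows "(\<integral>\<^sup>+x. ennreal (exp (inner_Rn n u x) * gauss_Rn n \<sigma> x) \<partial>lborel_Rn n)
    = ennreal (exp (\<sigma>\<^sup>2 * inner_Rn n u u / 2))"
proof -
  have "(\<integral>\<^sup>+x. ennreal (exp (inner_Rn n u x) * gauss_Rn n \<sigma> x) \<partial>lborel_Rn n)
    = (\<integral>\<^sup>+x. (\<Prod>i<n. ennreal (exp (u i * x i) * normal_density 0 \<sigma> (x i))) \<partial>lborel_Rn n)"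
    by (simp add: inner_Rn_def gauss_Rn_def exp_sum prod.distrib[symmetric] prod_ennreal)
  also have "\<dots> = (\<Prod>i<n. \<integral>\<^sup>+t. ennreal (exp (u i * t) * normal_density 0 \<sigma> t) \<partial>lborel)"
    by (rule nn_integral_lborel_Rn_prod) measurable
  also have "\<dots> = (\<Prod>i<n. ennreal (exp (\<sigma>\<^sup>2 * (u i)\<^sup>2 / 2)))"
  proof (rule prod.cong[OF refl])
    fix i
    have "(\<integral>\<^sup>+t. ennreal (exp (u i * t) * normal_density 0 \<sigma> t) \<partial>lborel)
      = (\<integral>\<^sup>+t. ennreal (exp (\<sigma>\<^sup>2 * (u i)\<^sup>2 / 2)) * ennreal (normal_density (\<sigma>\<^sup>2 * u i) \<sigma> t) \<partial>lborel)"
      unfolding exp_mult_normal_density[OF assms] by (simp add: ennreal_mult)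
    also have "\<dots> = ennreal (exp (\<sigma>\<^sup>2 * (u i)\<^sup>2 / 2))"
      by (subst nn_integral_cmult) (simp_all add: nn_integral_normal_density[OF assms])
    finally show "(\<integral>\<^sup>+t. ennreal (exp (u i * t) * normal_density 0 \<sigma> t) \<partial>lborel)
      = ennreal (exp (\<sigma>\<^sup>2 * (u i)\<^sup>2 / 2))" .
  qed
  also have "\<dots> = ennreal (exp (\<Sum>i<n. \<sigma>\<^sup>2 * (u i)\<^sup>2 / 2))"
    by (simp add: prod_ennreal exp_sum)
  also have "(\<Sum>i<n. \<sigma>\<^sup>2 * (u i)\<^sup>2 / 2) = \<sigma>\<^sup>2 * inner_Rn n u u / 2"
    by (simp add: inner_Rn_def sum_distrib_left sum_divide_distrib power2_eq_square)
  finally show ?thesis .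
qed

lemma nn_integral_gauss: "\<sigma> > 0 \<Longrightarrow> (\<integral>\<^sup>+x. ennreal (gauss_Rn n \<sigma> x) \<partial>lborel_Rn n) = 1"
  using nn_integral_gauss_exp[of \<sigma> n 0] by simp

text \<open>The inequality \<open>\<bar>y\<bar> \<le> exp y + exp (- y)\<close>, applied at the
  scale \<open>s\<close> of the standard deviation, leaves two exponential moments
  \<open>exp (1/2) \<le> 2\<close>; hence the non-optimal factor 4.\<close>

lemma nn_integral_gauss_abs:
  assumes "\<sigma> > 0"
  shows "(\<integral>\<^sup>+x. ennreal (\<bar>inner_Rn n u x\<bar> * gauss_Rn n \<sigma> x) \<partial>lborel_Rn n)
    \<le> ennreal (4 * \<sigma> * sqrt (inner_Rn n u u))"
proof (cases "inner_Rn n u u = 0")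
  case True
  then have "\<forall>i<n. u i = 0" by (simp add: inner_Rn_def sum_nonneg_eq_0_iff)
  then have "inner_Rn n u x = 0" for x by (simp add: inner_Rn_def)
  then show ?thesis by simp
next
  case False
  define s where "s = \<sigma> * sqrt (inner_Rn n u u)"
  have s: "s > 0" using assms False inner_Rn_nonneg[of n u] by (simp add: s_def less_le)
  have s2: "s\<^sup>2 = \<sigma>\<^sup>2 * inner_Rn n u u" by (simp add: s_def power_mult_distrib)
  have int: "(\<integral>\<^sup>+x. ennreal (exp (inner_Rn n (c *\<^sub>R u) x) * gauss_Rn n \<sigma> x) \<partial>lborel_Rn n)
    = ennreal (exp (1 / 2))" if "c = 1 / s \<or> c = - (1 / s)" for c
  proof -
    have "\<sigma>\<^sup>2 * inner_Rn n (c *\<^sub>R u) (c *\<^sub>R u) = c\<^sup>2 * s\<^sup>2" unfolding s2 by (simp add: power2_eq_square)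
    also have "\<dots> = 1" using s that by (auto simp: power2_eq_square)
    finally show ?thesis unfolding nn_integral_gauss_exp[OF assms] by simp
  qed
  have "\<bar>inner_Rn n u x\<bar> * gauss_Rn n \<sigma> x \<le> s * (exp (inner_Rn n ((1 / s) *\<^sub>R u) x) * gauss_Rn n \<sigma> x
     + exp (inner_Rn n ((- (1 / s)) *\<^sub>R u) x) * gauss_Rn n \<sigma> x)" for x
  proof -
    have "\<bar>y\<bar> \<le> exp y + exp (- y)" for y :: real
      using exp_ge_add_one_self[of y] exp_ge_add_one_self[of "- y"] exp_gt_zero[of y] exp_gt_zero[of "-y"] by linarith
    from this[of "inner_Rn n u x / s"]
    have "\<bar>inner_Rn n u x\<bar> \<le> s * (exp (inner_Rn n u x / s) + exp (- (inner_Rn n u x / s)))"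
      using s by (simp add: field_simps)
    from mult_right_mono[OF this gauss_Rn_nonneg] show ?thesis by (simp add: algebra_simps)
  qed
  then have "(\<integral>\<^sup>+x. ennreal (\<bar>inner_Rn n u x\<bar> * gauss_Rn n \<sigma> x) \<partial>lborel_Rn n)
    \<le> (\<integral>\<^sup>+x. ennreal s * (ennreal (exp (inner_Rn n ((1 / s) *\<^sub>R u) x) * gauss_Rn n \<sigma> x)
       + ennreal (exp (inner_Rn n ((- (1 / s)) *\<^sub>R u) x) * gauss_Rn n \<sigma> x)) \<partial>lborel_Rn n)"
    using s by (intro nn_integral_mono)
      (simp del: inner_Rn_simps add: ennreal_mult[symmetric] ennreal_plus[symmetric] ennreal_leI del: ennreal_plus)
  also have "\<dots> = ennreal s * (ennreal (exp (1/2)) + ennreal (exp (1/2)))"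
    by (subst nn_integral_cmult, measurable, subst nn_integral_add, measurable) (simp only: int simp_thms)
  also have "\<dots> = ennreal (s * (exp (1/2) + exp (1/2)))"
    unfolding ennreal_plus[OF exp_ge_zero exp_ge_zero, symmetric]
    by (rule ennreal_mult[symmetric]) (use s in auto)
  also have "\<dots> \<le> ennreal (4 * s)"
    using s exp_half_le2 by (intro ennreal_leI) simp
  finally show ?thesis by (simp add: s_def mult.assoc)
qed

lemma gauss_Rn_le:
  assumes "\<sigma> > 0"
  shows "gauss_Rn n \<sigma> x \<le> (1 / sqrt (2 * pi * \<sigma>\<^sup>2)) ^ n"
proof -
  have "gauss_Rn n \<sigma> x \<le> (\<Prod>i<n. 1 / sqrt (2 * pi * \<sigma>\<^sup>2))"
    unfolding gauss_Rn_def
    unfolding normal_density_def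
    by (intro prod_mono conjI mult_left_le) (auto intro: mult_nonneg_nonneg)
  then show ?thesis by simp
qed

text \<open>\<open>K\<close> carries half of the Gaussian mass, but at most \<open>(2 \<pi> \<sigma>\<^sup>2)\<^sup>-\<^sup>n\<^sup>/\<^sup>2\<close> times its volume.\<close>

lemma gauss_sigma_le_1:
  assumes \<sigma>: "\<sigma> > 0" and n: "n \<ge> 1" and K[measurable]: "K \<in> sets borel"
    and vol: "emeasure (lborel_Rn n) K \<le> 1"
    and [measurable]: "\<Phi> \<in> borel_measurable borel"
    and \<Phi>: "\<And>x. x \<in> Rn n \<Longrightarrow> x \<notin> K \<Longrightarrow> 1 \<le> \<Phi> x"
    and half: "(\<integral>\<^sup>+x. \<Phi> x * ennreal (gauss_Rn n \<sigma> x) \<partial>lborel_Rn n) \<le> ennreal (1 / 2)"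
  shows "\<sigma> \<le> 1"
proof (rule ccontr)
  assume "\<not> \<sigma> \<le> 1"
  then have "1 < \<sigma>\<^sup>2" by (simp add: one_less_power)
  let ?q = "1 / sqrt (2 * pi * \<sigma>\<^sup>2)"
  \<comment> \<open>This is where the threshold 1 for \<open>\<sigma>\<close> comes from:
    \<open>\<sigma> > 1\<close> and \<open>pi > 3\<close> push the density bound per coordinate
    below 1/2, so \<open>K\<close> carries less than half of the mass.\<close>
  have "4 < 2 * pi * \<sigma>\<^sup>2" using pi_gt3 \<open>1 < \<sigma>\<^sup>2\<close> mult_strict_mono[of 4 "2 * pi" 1 "\<sigma>\<^sup>2"] by simp
  then have "2 < sqrt (2 * pi * \<sigma>\<^sup>2)" using real_less_rsqrt[of 2] by simp
  then have "inverse (sqrt (2 * pi * \<sigma>\<^sup>2)) < inverse 2" by (rule less_imp_inverse_less) simp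
  then have q: "0 \<le> ?q" "?q < 1 / 2" by (simp_all add: inverse_eq_divide)
  have "1 = (\<integral>\<^sup>+x. ennreal (gauss_Rn n \<sigma> x) \<partial>lborel_Rn n)" using nn_integral_gauss[OF \<sigma>] by simp
  also have "\<dots> \<le> (\<integral>\<^sup>+x. ennreal (?q ^ n) * indicator K x + \<Phi> x * ennreal (gauss_Rn n \<sigma> x) \<partial>lborel_Rn n)"
  proof (rule nn_integral_lborel_Rn_mono)
    fix x assume x: "x \<in> Rn n"
    show "ennreal (gauss_Rn n \<sigma> x) \<le> ennreal (?q ^ n) * indicator K x + \<Phi> x * ennreal (gauss_Rn n \<sigma> x)"
    proof (cases "x \<in> K")
      case True
      then show ?thesis using ennreal_leI[OF gauss_Rn_le[OF \<sigma>, of n x]] by (simp add: add_increasing2)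
    next
      case False
      then show ?thesis using mult_right_mono[OF \<Phi>[OF x False], of "ennreal (gauss_Rn n \<sigma> x)"] by simp
    qed
  qed
  also have "\<dots> = ennreal (?q ^ n) * emeasure (lborel_Rn n) K + (\<integral>\<^sup>+x. \<Phi> x * ennreal (gauss_Rn n \<sigma> x) \<partial>lborel_Rn n)"
    by (subst nn_integral_add) (simp_all add: nn_integral_cmult)
  also have "\<dots> \<le> ennreal (?q ^ n) * 1 + ennreal (1 / 2)"
    by (intro add_mono mult_left_mono vol half) auto
  also have "\<dots> = ennreal (?q ^ n + 1 / 2)"
    using q by simp
  finally have "1 \<le> ?q ^ n + 1 / 2" unfolding ennreal_ge_1 .
  moreover have "?q ^ n \<le> ?q ^ 1" using n q by (intro power_decreasing) auto
  ultimately show False using q by simp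
qed

section \<open>The Prekopa--Leindler inequality\<close>

text \<open>Averaging the points of \<open>A\<close> up to \<open>a\<close> with \<open>b\<close>,
  and the points of \<open>B\<close> from \<open>b\<close> on with \<open>a\<close>, gives two
  subsets of \<open>C\<close> on opposite sides of \<open>(a + b) / 2\<close>. They share at most
  that null point, so their measures add.\<close>

lemma emeasure_lborel_midpoints_aux:
  assumes [measurable]: "A \<in> sets borel" "B \<in> sets borel" "C \<in> sets borel"
    and a: "a \<in> A" and b: "b \<in> B" and C: "\<And>x y. x \<in> A \<Longrightarrow> y \<in> B \<Longrightarrow> (x + y) / 2 \<in> C"
  shows "emeasure lborel (A \<inter> {..a}) + emeasure lborel (B \<inter> {b..}) \<le> 2 * emeasure lborel (C :: real set)"
proof -
  let ?s = "(a + b) / 2"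
  have 1: "emeasure lborel (A \<inter> {..a}) \<le> 2 * (\<integral>\<^sup>+z. indicator (C \<inter> {..?s}) z \<partial>lborel)"
  proof -
    have "emeasure lborel (A \<inter> {..a}) = (\<integral>\<^sup>+z. indicator (A \<inter> {..a}) z \<partial>lborel)"
      by (subst nn_integral_indicator) auto
    also have "\<dots> = 2 * (\<integral>\<^sup>+z. indicator (A \<inter> {..a}) (- b + 2 * z) \<partial>lborel)"
      by (subst nn_integral_real_affine[where c=2 and t="-b"]) auto
    also have "(\<integral>\<^sup>+z. indicator (A \<inter> {..a}) (- b + 2 * z) \<partial>lborel) \<le> (\<integral>\<^sup>+z. indicator (C \<inter> {..?s}) z \<partial>lborel)"
    proof (rule nn_integral_mono)
      fix z show "(indicator (A \<inter> {..a}) (- b + 2 * z) :: ennreal) \<le> indicator (C \<inter> {..?s}) z"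
        using C[OF _ b, of "- b + 2 * z"] by (auto simp: indicator_def)
    qed
    finally show ?thesis by (simp add: mult_left_mono)
  qed
  have 2: "emeasure lborel (B \<inter> {b..}) \<le> 2 * (\<integral>\<^sup>+z. indicator (C \<inter> {?s..}) z \<partial>lborel)"
  proof -
    have "emeasure lborel (B \<inter> {b..}) = (\<integral>\<^sup>+z. indicator (B \<inter> {b..}) z \<partial>lborel)"
      by (subst nn_integral_indicator) auto
    also have "\<dots> = 2 * (\<integral>\<^sup>+z. indicator (B \<inter> {b..}) (- a + 2 * z) \<partial>lborel)"
      by (subst nn_integral_real_affine[where c=2 and t="-a"]) auto
    also have "(\<integral>\<^sup>+z. indicator (B \<inter> {b..}) (- a + 2 * z) \<partial>lborel) \<le> (\<integral>\<^sup>+z. indicator (C \<inter> {?s..}) z \<partial>lborel)"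
    proof (rule nn_integral_mono)
      fix z show "(indicator (B \<inter> {b..}) (- a + 2 * z) :: ennreal) \<le> indicator (C \<inter> {?s..}) z"
        using C[OF a, of "- a + 2 * z"] by (auto simp: indicator_def)
    qed
    finally show ?thesis by (simp add: mult_left_mono)
  qed
  have "(\<integral>\<^sup>+z. indicator (C \<inter> {..?s}) z \<partial>lborel) + (\<integral>\<^sup>+z. indicator (C \<inter> {?s..}) z \<partial>lborel)
    = (\<integral>\<^sup>+z. indicator (C \<inter> {..?s}) z + indicator (C \<inter> {?s..}) z \<partial>lborel)"
    by (rule nn_integral_add[symmetric]) auto
  also have "\<dots> = (\<integral>\<^sup>+z. indicator C z \<partial>lborel)"
    using AE_lborel_singleton[of ?s] by (intro nn_integral_cong_AE) (auto simp: indicator_def)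
  also have "\<dots> = emeasure lborel C" by simp
  finally have *: "(\<integral>\<^sup>+z. indicator (C \<inter> {..?s}) z \<partial>lborel) + (\<integral>\<^sup>+z. indicator (C \<inter> {?s..}) z \<partial>lborel)
    = emeasure lborel C" .
  show ?thesis using add_mono[OF 1 2] unfolding distrib_left[symmetric] * .
qed

text \<open>A set without a maximum is exhausted by initial segments ending at its own points.
  Taking the supremum in the extended reals includes sets unbounded above; \<open>r\<close> carries
  the measure of the other set, so that both can be exhausted in turn.\<close>

lemma emeasure_lborel_le_initial_segments:
  assumes [measurable]: "A \<in> sets borel" and ne: "A \<noteq> {}"
    and le: "\<And>a. a \<in> A \<Longrightarrow> emeasure lborel (A \<inter> {..a}) + r \<le> q"
  shows "emeasure lborel (A :: real set) + r \<le> q"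
proof (cases "\<exists>a\<in>A. \<forall>x\<in>A. x \<le> a")
  case True
  then obtain a where "a \<in> A" "A \<inter> {..a} = A" by auto
  then show ?thesis using le[of a] by simp
next
  case False
  from Sup_countable_SUP[of "ereal ` A"] ne obtain f :: "nat \<Rightarrow> ereal"
    where f: "incseq f" "range f \<subseteq> ereal ` A" "Sup (ereal ` A) = (SUP i. f i)" by auto
  have "\<forall>k. \<exists>y. y \<in> A \<and> f k = ereal y" using f(2) by auto
  then obtain a where a: "\<And>k. a k \<in> A" "\<And>k. f k = ereal (a k)" by metis
  have inc: "incseq (\<lambda>k. A \<inter> {..a k})"
    using f(1) unfolding incseq_def a(2) by (force intro: order_trans)
  have "\<exists>k. x \<le> a k" if x: "x \<in> A" for x
  proof (rule ccontr)
    assume "\<not> (\<exists>k. x \<le> a k)"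
    then have "(SUP i. f i) \<le> ereal x" by (intro SUP_least) (auto simp: a(2) not_le less_imp_le)
    then have "\<forall>y\<in>A. y \<le> x" unfolding f(3)[symmetric] by (simp add: Sup_le_iff)
    with x False show False by blast
  qed
  then have U: "(\<Union>k. A \<inter> {..a k}) = A" by auto
  have "emeasure lborel A + r = (SUP k. emeasure lborel (A \<inter> {..a k})) + r"
    using SUP_emeasure_incseq[of "\<lambda>k. A \<inter> {..a k}" lborel] inc unfolding U by (simp add: image_subset_iff)
  also have "\<dots> = (SUP k. emeasure lborel (A \<inter> {..a k}) + r)"
    by (rule ennreal_SUP_add_left[symmetric]) simp
  also have "\<dots> \<le> q" by (intro SUP_least le a)
  finally show ?thesis .
qed

text \<open>The one-dimensional Brunn--Minkowski inequality; \<open>C\<close> stands for \<open>(A + B) / 2\<close>, which need not be Borel.\<close>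

lemma emeasure_lborel_midpoints:
  assumes [measurable]: "A \<in> sets borel" "B \<in> sets borel" "C \<in> sets borel"
    and ne: "A \<noteq> {}" "B \<noteq> {}" and C: "\<And>x y. x \<in> A \<Longrightarrow> y \<in> B \<Longrightarrow> (x + y) / 2 \<in> C"
  shows "emeasure lborel A + emeasure lborel B \<le> 2 * emeasure lborel (C :: real set)"
proof (rule emeasure_lborel_le_initial_segments[OF assms(1) ne(1)])
  fix a assume a: "a \<in> A"
  have refl: "emeasure lborel {x. - x \<in> D} = emeasure lborel D" if [measurable]: "D \<in> sets borel" for D :: "real set"
  proof -
    have "emeasure lborel D = (\<integral>\<^sup>+z. indicator D z \<partial>lborel)" by simp
    also have "\<dots> = (\<integral>\<^sup>+z. indicator D (0 + (-1) * z) \<partial>lborel)"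
      by (subst nn_integral_real_affine[where c="-1" and t=0]) auto
    also have "\<dots> = (\<integral>\<^sup>+z. indicator {x. - x \<in> D} z \<partial>lborel)"
      by (intro nn_integral_cong) (auto simp: indicator_def)
    also have "\<dots> = emeasure lborel {x. - x \<in> D}" by (subst nn_integral_indicator) auto
    finally show ?thesis by simp
  qed
  \<comment> \<open>Final segments of \<open>B\<close> become initial segments after reflection, so
    the same exhaustion applies to the second set.\<close>
  have "emeasure lborel {x. - x \<in> B} + emeasure lborel (A \<inter> {..a}) \<le> 2 * emeasure lborel C"
  proof (rule emeasure_lborel_le_initial_segments)
    show "{x. - x \<in> B} \<in> sets borel" by measurable
    show "{x. - x \<in> B} \<noteq> {}" using ne(2) by (auto intro: exI[of _ "- _"])
    fix b assume b: "b \<in> {x. - x \<in> B}"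
    have "{x. - x \<in> B} \<inter> {..b} = {x. - x \<in> B \<inter> {-b..}}" by auto
    then have "emeasure lborel ({x. - x \<in> B} \<inter> {..b}) = emeasure lborel (B \<inter> {-b..})"
      using refl[of "B \<inter> {-b..}"] by simp
    then show "emeasure lborel ({x. - x \<in> B} \<inter> {..b}) + emeasure lborel (A \<inter> {..a}) \<le> 2 * emeasure lborel C"
      using emeasure_lborel_midpoints_aux[of A B C a "- b"] a b C by (simp add: add.commute)
  qed
  then show "emeasure lborel (A \<inter> {..a}) + emeasure lborel B \<le> 2 * emeasure lborel C"
    by (simp add: refl add.commute)
qed

text \<open>Truncation at \<open>a\<close> confines the levels to \<open>a * t\<close> with
  \<open>0 < t < 1\<close>. The common parameter \<open>t\<close> lets functions with different
  suprema be compared level by level.\<close>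

lemma nn_integral_min_layer_cake:
  fixes f :: "real \<Rightarrow> ennreal"
  assumes [measurable]: "f \<in> borel_measurable borel" and a: "a > 0"
  shows "(\<integral>\<^sup>+x. min (f x) (ennreal a) \<partial>lborel)
    = ennreal a * (\<integral>\<^sup>+t. indicator {0<..<1} t * emeasure lborel {x. ennreal (a * t) < f x} \<partial>lborel)"
proof -
  have pt: "min (f x) (ennreal a) = ennreal a * (\<integral>\<^sup>+t. indicator {0<..<1} t * indicator {x. ennreal (a * t) < f x} x \<partial>lborel)" for x
  proof -
    obtain p where p: "min (f x) (ennreal a) = ennreal p" "0 \<le> p" "p \<le> a"
    proof (cases "f x \<le> ennreal a")
      case True
      then obtain p where "f x = ennreal p" "0 \<le> p" by (metis ennreal_cases ennreal_neq_top neq_top_trans)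
      then show ?thesis using that[of p] True a by (auto simp: min_def)
    next
      case False
      then show ?thesis using that[of a] a by (auto simp: min_def)
    qed
    have "(ennreal (a * t) < f x) \<longleftrightarrow> t < p / a" if "0 < t" "t < 1" for t
    proof -
      have "(ennreal (a * t) < f x) \<longleftrightarrow> ennreal (a * t) < min (f x) (ennreal a)"
        using that a by (simp add: ennreal_less_iff)
      also have "\<dots> \<longleftrightarrow> t < p / a" using that a p(2) unfolding p(1) by (simp add: ennreal_less_iff field_simps)
      finally show ?thesis .
    qed
    moreover have "p / a \<le> 1" using p(3) a by simp
    ultimately have "(indicator {0<..<1} t * indicator {x. ennreal (a * t) < f x} x :: ennreal) = indicator {0<..<p/a} t" for t
      by (smt (verit, ccfv_threshold) greaterThanLessThan_iff indicator_simps mem_Collect_eq mult.commute mult.right_neutral mult_zero_left)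
    then have "(\<integral>\<^sup>+t. indicator {0<..<1} t * indicator {x. ennreal (a * t) < f x} x \<partial>lborel) = ennreal (p / a)"
      using a p(2) by (simp add: nn_integral_indicator)
    then show ?thesis using a p by (simp add: ennreal_mult[symmetric])
  qed
  have m: "(\<lambda>(x, t). indicator {0<..<1} t * indicator {x. ennreal (a * t) < f x} x :: ennreal) \<in> borel_measurable (lborel \<Otimes>\<^sub>M lborel)"
    unfolding split_beta by measurable
  have "(\<integral>\<^sup>+x. min (f x) (ennreal a) \<partial>lborel)
    = ennreal a * (\<integral>\<^sup>+x. (\<integral>\<^sup>+t. indicator {0<..<1} t * indicator {x. ennreal (a * t) < f x} x \<partial>lborel) \<partial>lborel)"
    unfolding pt by (rule nn_integral_cmult) (use m in measurable)
  also have "(\<integral>\<^sup>+x. (\<integral>\<^sup>+t. indicator {0<..<1} t * indicator {x. ennreal (a * t) < f x} x \<partial>lborel) \<partial>lborel)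
    = (\<integral>\<^sup>+t. (\<integral>\<^sup>+x. indicator {0<..<1} t * indicator {x. ennreal (a * t) < f x} x \<partial>lborel) \<partial>lborel)"
    by (rule lborel_pair.Fubini'[OF m, symmetric])
  also have "\<dots> = (\<integral>\<^sup>+t. indicator {0<..<1} t * emeasure lborel {x. ennreal (a * t) < f x} \<partial>lborel)"
    by (intro nn_integral_cong) (subst nn_integral_cmult, auto)
  finally show ?thesis .
qed

text \<open>The arithmetic-geometric mean inequality turns the additive Brunn-Minkowski bound into a
  bound for a product.\<close>

lemma ennreal_four_mult_le_power2: "4 * (P * Q) \<le> ((P + Q)\<^sup>2 :: ennreal)"
proof (cases "P = top \<or> Q = top")
  case True
  then have "(P + Q)\<^sup>2 = top" by (auto simp: power2_eq_square)
  then show ?thesis by simp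
next
  case False
  then obtain p q where pq: "P = ennreal p" "0 \<le> p" "Q = ennreal q" "0 \<le> q"
    by (metis ennreal_cases)
  have "4 * (p * q) \<le> (p + q)\<^sup>2" using zero_le_power2[of "p - q"] by (simp add: power2_eq_square algebra_simps)
  then have "ennreal (4 * (p * q)) \<le> ennreal ((p + q)\<^sup>2)" by (rule ennreal_leI)
  then show ?thesis using pq by (simp add: ennreal_mult ennreal_power[symmetric])
qed

text \<open>Brunn-Minkowski is applied to superlevel sets, which must be nonempty. Scaling the
  levels by the finite suprema \<open>a\<close> and \<open>b\<close> ensures this for every
  \<open>t < 1\<close>.\<close>

lemma prekopa_leindler_bounded:
  fixes f g h :: "real \<Rightarrow> ennreal"
  assumes [measurable]: "f \<in> borel_measurable borel" "g \<in> borel_measurable borel" "h \<in> borel_measurable borel"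
    and fin: "(SUP x. f x) < top" "(SUP x. g x) < top"
    and le: "\<And>x y. f x * g y \<le> (h ((x + y) / 2))\<^sup>2"
  shows "(\<integral>\<^sup>+x. f x \<partial>lborel) * (\<integral>\<^sup>+x. g x \<partial>lborel) \<le> (\<integral>\<^sup>+x. h x \<partial>lborel)\<^sup>2"
proof (cases "(SUP x. f x) = 0 \<or> (SUP x. g x) = 0")
  case True
  then have "(\<forall>x. f x = 0) \<or> (\<forall>x. g x = 0)"
    by (metis SUP_upper UNIV_I le_zero_eq)
  then show ?thesis by auto
next
  case False
  obtain a where a: "(SUP x. f x) = ennreal a" "0 < a"
    using fin(1) False by (cases "SUP x. f x") (auto simp: less_le)
  obtain b where b: "(SUP x. g x) = ennreal b" "0 < b"
    using fin(2) False by (cases "SUP x. g x") (auto simp: less_le)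
  \<comment> \<open>The geometric mean is the level that the hypothesis produces:
    \<open>f x > a * t\<close> and \<open>g y > b * t\<close> force \<open>h > c * t\<close> at the
    midpoint.\<close>
  define c where "c = sqrt (a * b)"
  have c: "c > 0" "c * c = a * b" using a b by (auto simp: c_def)
  let ?I = "\<lambda>f a. \<integral>\<^sup>+t. indicator {0<..<1} t * emeasure lborel {x. ennreal (a * t) < f x} \<partial>lborel"
  have f_int: "(\<integral>\<^sup>+x. f x \<partial>lborel) = ennreal a * ?I f a"
    using SUP_upper[of _ UNIV f] a nn_integral_min_layer_cake[of f a] by (simp add: min_absorb1)
  have g_int: "(\<integral>\<^sup>+x. g x \<partial>lborel) = ennreal b * ?I g b"
    using SUP_upper[of _ UNIV g] b nn_integral_min_layer_cake[of g b] by (simp add: min_absorb1)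
  \<comment> \<open>Only an inequality, because \<open>h\<close> may exceed \<open>c\<close> and its
    layers above \<open>c\<close> are dropped.\<close>
  have h_int: "ennreal c * ?I h c \<le> (\<integral>\<^sup>+x. h x \<partial>lborel)"
    using nn_integral_min_layer_cake[of h c] c(1) by (auto intro!: nn_integral_mono simp: simp flip: nn_integral_min_layer_cake)
  have [measurable]: "(\<lambda>t. emeasure lborel {x. ennreal (s * t) < k x}) \<in> borel_measurable borel"
    if [measurable]: "k \<in> borel_measurable borel" for k :: "real \<Rightarrow> ennreal" and s
  proof -
    have "(\<lambda>t. emeasure lborel (Pair t -` {p. ennreal (s * fst p) < k (snd p)})) \<in> borel_measurable lborel"
    proof (rule lborel.measurable_emeasure_Pair)
      have "{p \<in> space (lborel \<Otimes>\<^sub>M lborel). ennreal (s * fst p) < k (snd p)} \<in> sets (lborel \<Otimes>\<^sub>M lborel)"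
        by measurable
      then show "{p. ennreal (s * fst p) < k (snd p)} \<in> sets (lborel \<Otimes>\<^sub>M lborel)"
        by (simp add: space_pair_measure)
    qed
    then show ?thesis by (simp add: vimage_def)
  qed
  have "?I f a + ?I g b = (\<integral>\<^sup>+t. indicator {0<..<1} t * emeasure lborel {x. ennreal (a * t) < f x}
      + indicator {0<..<1} t * emeasure lborel {x. ennreal (b * t) < g x} \<partial>lborel)"
    by (rule nn_integral_add[symmetric]) measurable
  also have "\<dots> \<le> (\<integral>\<^sup>+t. 2 * (indicator {0<..<1} t * emeasure lborel {x. ennreal (c * t) < h x}) \<partial>lborel)"
  proof (rule nn_integral_mono)
    fix t :: real
    show "indicator {0<..<1} t * emeasure lborel {x. ennreal (a * t) < f x}
      + indicator {0<..<1} t * emeasure lborel {x. ennreal (b * t) < g x}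
      \<le> 2 * (indicator {0<..<1} t * emeasure lborel {x. ennreal (c * t) < h x})"
    proof (cases "0 < t \<and> t < 1")
      case True
      have "emeasure lborel {x. ennreal (a * t) < f x} + emeasure lborel {x. ennreal (b * t) < g x}
        \<le> 2 * emeasure lborel {x. ennreal (c * t) < h x}"
      proof (rule emeasure_lborel_midpoints)
        have "ennreal (a * t) < (SUP x. f x)" "ennreal (b * t) < (SUP x. g x)"
          using True a b by (simp_all add: ennreal_less_iff)
        then show "{x. ennreal (a * t) < f x} \<noteq> {}" "{x. ennreal (b * t) < g x} \<noteq> {}"
          unfolding less_SUP_iff by auto
        fix x y assume "x \<in> {x. ennreal (a * t) < f x}" "y \<in> {x. ennreal (b * t) < g x}"
        then have "ennreal (a * t) < f x" "ennreal (b * t) < g y" by auto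
        then have "ennreal (a * t) * ennreal (b * t) < f x * ennreal (b * t)"
          using True b by (intro ennreal_mult_strict_right_mono) auto
        also have "\<dots> \<le> f x * g y" using \<open>ennreal (b * t) < g y\<close> by (intro mult_left_mono) auto
        also have "\<dots> \<le> (h ((x + y) / 2))\<^sup>2" by (rule le)
        also have "ennreal (a * t) * ennreal (b * t) = (ennreal (c * t))\<^sup>2"
        proof -
          have "a * t * (b * t) = c * t * (c * t)" using c(2) by (simp add: algebra_simps)
          then show ?thesis using a b c True by (simp add: power2_eq_square ennreal_mult[symmetric])
        qed
        finally have "ennreal (c * t) < h ((x + y) / 2)"
          using power_mono[of "h ((x + y) / 2)" "ennreal (c * t)" 2] by (metis not_le zero_le)
        then show "(x + y) / 2 \<in> {x. ennreal (c * t) < h x}" by simp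
      qed measurable
      then show ?thesis using True by simp
    qed auto
  qed
  also have "\<dots> = 2 * ?I h c"
    by (rule nn_integral_cmult) measurable
  finally have sum: "?I f a + ?I g b \<le> 2 * ?I h c" .
  have "4 * ((\<integral>\<^sup>+x. f x \<partial>lborel) * (\<integral>\<^sup>+x. g x \<partial>lborel)) = (ennreal a * ennreal b) * (4 * (?I f a * ?I g b))"
    unfolding f_int g_int by (simp only: ac_simps)
  also have "\<dots> \<le> (ennreal a * ennreal b) * (?I f a + ?I g b)\<^sup>2"
    by (intro mult_left_mono ennreal_four_mult_le_power2) simp
  also have "\<dots> \<le> (ennreal a * ennreal b) * (2 * ?I h c)\<^sup>2"
    by (intro mult_left_mono power_mono sum) auto
  also have "ennreal a * ennreal b = ennreal c * ennreal c"
    using a b c by (simp add: ennreal_mult[symmetric])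
  also have "ennreal c * ennreal c * (2 * ?I h c)\<^sup>2 = 4 * (ennreal c * ?I h c)\<^sup>2"
    unfolding power2_eq_square by (simp add: ac_simps)
  also have "\<dots> \<le> 4 * (\<integral>\<^sup>+x. h x \<partial>lborel)\<^sup>2"
    by (intro mult_left_mono power_mono h_int) auto
  finally show ?thesis by (subst (asm) ennreal_mult_le_mult_iff) auto
qed

text \<open>Truncating \<open>f\<close> and \<open>g\<close> at integers preserves the hypothesis
  with the same \<open>h\<close>; monotone convergence in each factor separately removes the
  truncation.\<close>

lemma prekopa_leindler_1:
  fixes f g h :: "real \<Rightarrow> ennreal"
  assumes [measurable]: "f \<in> borel_measurable borel" "g \<in> borel_measurable borel" "h \<in> borel_measurable borel"
    and le: "\<And>x y. f x * g y \<le> (h ((x + y) / 2))\<^sup>2"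
  shows "(\<integral>\<^sup>+x. f x \<partial>lborel) * (\<integral>\<^sup>+x. g x \<partial>lborel) \<le> (\<integral>\<^sup>+x. h x \<partial>lborel)\<^sup>2"
proof -
  have SUP: "(\<integral>\<^sup>+x. k x \<partial>lborel) = (SUP i::nat. \<integral>\<^sup>+x. min (k x) (of_nat i) \<partial>lborel)"
    if [measurable]: "k \<in> borel_measurable borel" for k :: "real \<Rightarrow> ennreal"
  proof -
    have "(SUP i::nat. min y (of_nat i)) = y" for y :: ennreal
      using inf_SUP[of y "of_nat :: nat \<Rightarrow> ennreal" UNIV] by (simp add: ennreal_SUP_of_nat_eq_top inf_min)
    then have "(\<integral>\<^sup>+x. k x \<partial>lborel) = (\<integral>\<^sup>+x. (SUP i::nat. min (k x) (of_nat i)) \<partial>lborel)" by simp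
    also have "\<dots> = (SUP i::nat. \<integral>\<^sup>+x. min (k x) (of_nat i) \<partial>lborel)"
      by (rule nn_integral_monotone_convergence_SUP)
         (auto simp: incseq_def le_fun_def intro: min.coboundedI2 min.mono)
    finally show ?thesis .
  qed
  have "(\<integral>\<^sup>+x. min (f x) (of_nat i) \<partial>lborel) * (\<integral>\<^sup>+x. min (g x) (of_nat j) \<partial>lborel) \<le> (\<integral>\<^sup>+x. h x \<partial>lborel)\<^sup>2" for i j :: nat
  proof (rule prekopa_leindler_bounded)
    have "(SUP x. min (k x) (of_nat i)) \<le> of_nat i" for k :: "real \<Rightarrow> ennreal" and i :: nat
      by (rule SUP_least) simp
    then show "(SUP x. min (f x) (of_nat i)) < top" "(SUP x. min (g x) (of_nat j)) < top"
      by (metis le_less_trans of_nat_less_top)+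
    fix x y
    have "min (f x) (of_nat i) * min (g y) (of_nat j) \<le> f x * g y" by (intro mult_mono) auto
    also have "\<dots> \<le> (h ((x + y) / 2))\<^sup>2" by (rule le)
    finally show "min (f x) (of_nat i) * min (g y) (of_nat j) \<le> (h ((x + y) / 2))\<^sup>2" .
  qed measurable
  then show ?thesis
    unfolding SUP[OF assms(1)] SUP[OF assms(2)]
    unfolding SUP_mult_right_ennreal unfolding SUP_mult_left_ennreal by (intro SUP_least)
qed

section \<open>Slicing: from the line to \<open>Rn n\<close>\<close>

lemma nn_integral_lborel_Rn_Suc:
  assumes [measurable]: "f \<in> borel_measurable borel"
  shows "(\<integral>\<^sup>+x. f x \<partial>lborel_Rn (Suc n)) = (\<integral>\<^sup>+y. (\<integral>\<^sup>+x. f (x(n := y)) \<partial>lborel_Rn n) \<partial>lborel)"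
proof -
  interpret product_sigma_finite "\<lambda>_::nat. lborel :: real measure"
    by (rule product_sigma_finite_lborel)
  have upd: "(\<lambda>x::nat \<Rightarrow> real. f (x(n := y))) \<in> borel_measurable borel" for y
  proof -
    have "(\<lambda>x::nat \<Rightarrow> real. x(n := y)) \<in> borel \<rightarrow>\<^sub>M borel"
      by (rule measurable_coordinatewise_then_product) (simp add: fun_upd_def)
    then show ?thesis by (rule measurable_compose) simp
  qed
  have "(\<integral>\<^sup>+x. f x \<partial>lborel_Rn (Suc n)) = (\<integral>\<^sup>+x. f (proj_Rn (Suc n) x) \<partial>(\<Pi>\<^sub>M i\<in>insert n {..<n}. lborel))"
    by (subst nn_integral_lborel_Rn) (simp_all add: lessThan_Suc)
  also have "\<dots> = (\<integral>\<^sup>+y. (\<integral>\<^sup>+x. f (proj_Rn (Suc n) (x(n := y))) \<partial>(\<Pi>\<^sub>M i\<in>{..<n}. lborel)) \<partial>lborel)"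
  proof (rule product_nn_integral_insert_rev)
    show "(\<lambda>x. f (proj_Rn (Suc n) x)) \<in> borel_measurable (\<Pi>\<^sub>M i\<in>insert n {..<n}. lborel)"
      using measurable_compose[OF measurable_PiM_proj_Rn[of "Suc n"] assms] by (simp add: lessThan_Suc)
  qed auto
  also have "\<dots> = (\<integral>\<^sup>+y. (\<integral>\<^sup>+x. f ((proj_Rn n x)(n := y)) \<partial>(\<Pi>\<^sub>M i\<in>{..<n}. lborel)) \<partial>lborel)"
    by (intro nn_integral_cong arg_cong[where f=f]) (auto simp: proj_Rn_def fun_eq_iff)
  also have "\<dots> = (\<integral>\<^sup>+y. (\<integral>\<^sup>+x. f (x(n := y)) \<partial>lborel_Rn n) \<partial>lborel)"
    using upd by (intro nn_integral_cong nn_integral_lborel_Rn[symmetric])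
  finally show ?thesis .
qed

text \<open>With the last coordinates of the two points frozen, the induction hypothesis for the
  slices is exactly the one-dimensional hypothesis for the integrals over the other
  coordinates.\<close>

theorem prekopa_leindler:
  assumes "f \<in> borel_measurable borel" "g \<in> borel_measurable borel" "h \<in> borel_measurable borel"
    and "\<And>x y. f x * g y \<le> (h ((1 / 2) *\<^sub>R (x + y)))\<^sup>2"
  shows "(\<integral>\<^sup>+x. f x \<partial>lborel_Rn n) * (\<integral>\<^sup>+x. g x \<partial>lborel_Rn n) \<le> (\<integral>\<^sup>+x. h x \<partial>lborel_Rn n)\<^sup>2"
  using assms
proof (induction n arbitrary: f g h)
  case 0
  note [measurable] = 0(1-3)
  interpret product_sigma_finite "\<lambda>_::nat. lborel :: real measure"
    by (rule product_sigma_finite_lborel)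
  \<comment> \<open>In dimension 0 the measure is the unit mass at the zero sequence.\<close>
  have "(\<integral>\<^sup>+x. k x \<partial>lborel_Rn 0) = k 0" if "k \<in> borel_measurable borel" for k
    using that by (subst nn_integral_lborel_Rn)
      (simp_all add: PiM_empty nn_integral_count_space_finite proj_Rn_def zero_fun_def)
  then show ?case using 0(4)[of 0 0] by (simp add: 0 zero_fun_def)
next
  case (Suc n)
  note [measurable] = Suc.prems(1-3)
  interpret M: sigma_finite_measure "lborel_Rn n" by (rule sigma_finite_lborel_Rn)
  have upd: "(\<lambda>p. (snd p)(n := fst p)) \<in> borel \<Otimes>\<^sub>M borel \<rightarrow>\<^sub>M (borel :: (nat \<Rightarrow> real) measure)"
    by (rule measurable_coordinatewise_then_product) (simp add: fun_upd_def)
  have upd1: "(\<lambda>x::nat \<Rightarrow> real. x(n := y)) \<in> borel \<rightarrow>\<^sub>M borel" for y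
    by (rule measurable_coordinatewise_then_product) (simp add: fun_upd_def)
  have m: "(\<lambda>y. \<integral>\<^sup>+x. k (x(n := y)) \<partial>lborel_Rn n) \<in> borel_measurable borel"
    if k: "k \<in> borel_measurable borel" for k :: "(nat \<Rightarrow> real) \<Rightarrow> ennreal"
  proof (rule M.borel_measurable_nn_integral)
    have "borel_measurable (borel \<Otimes>\<^sub>M lborel_Rn n) = borel_measurable (borel \<Otimes>\<^sub>M borel)"
      by (intro measurable_cong_sets sets_pair_measure_cong) simp_all
    then show "(\<lambda>(y, x). k (x(n := y))) \<in> borel_measurable (borel \<Otimes>\<^sub>M lborel_Rn n)"
      unfolding split_beta using measurable_compose[OF upd k] by simp
  qed
  show ?case
    unfolding nn_integral_lborel_Rn_Suc[OF Suc.prems(1)] nn_integral_lborel_Rn_Suc[OF Suc.prems(2)]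
      nn_integral_lborel_Rn_Suc[OF Suc.prems(3)]
  proof (rule prekopa_leindler_1[OF m m m])
    fix y z :: real
    show "(\<integral>\<^sup>+x. f (x(n := y)) \<partial>lborel_Rn n) * (\<integral>\<^sup>+x. g (x(n := z)) \<partial>lborel_Rn n)
      \<le> (\<integral>\<^sup>+x. h (x(n := (y + z) / 2)) \<partial>lborel_Rn n)\<^sup>2"
    proof (rule Suc.IH)
      fix u v :: "nat \<Rightarrow> real"
      have "(1 / 2) *\<^sub>R (u(n := y) + v(n := z)) = ((1 / 2) *\<^sub>R (u + v))(n := (y + z) / 2)"
        by (auto simp: fun_eq_iff)
      then show "f (u(n := y)) * g (v(n := z)) \<le> (h (((1 / 2) *\<^sub>R (u + v))(n := (y + z) / 2)))\<^sup>2"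
        using Suc.prems(4)[of "u(n := y)" "v(n := z)"] by (simp only:)
    qed (intro measurable_compose[OF upd1] Suc.prems)+
  qed (use Suc.prems in auto)
qed

section \<open>Exponential tails of linear functionals\<close>

lemma emeasure_uminus_lborel_Rn:
  assumes [measurable]: "A \<in> sets borel"
  shows "emeasure (lborel_Rn n) {x. - x \<in> A} = emeasure (lborel_Rn n) A"
proof -
  have m: "(\<lambda>x::nat \<Rightarrow> real. - x) \<in> borel \<rightarrow>\<^sub>M borel"
    by (rule measurable_coordinatewise_then_product) simp
  have [measurable]: "{x. - x \<in> A} \<in> sets borel"
    using measurable_sets[OF m assms] by (simp add: vimage_def)
  have "emeasure (lborel_Rn n) A = (\<integral>\<^sup>+x. indicator A x \<partial>lborel_Rn n)" by simp
  also have "\<dots> = (\<integral>\<^sup>+x. indicator A (0 + (-1) *\<^sub>R x) \<partial>lborel_Rn n)"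
    by (subst nn_integral_lborel_Rn_affine[of _ "-1" 0]) auto
  also have "\<dots> = (\<integral>\<^sup>+x. indicator {x. - x \<in> A} x \<partial>lborel_Rn n)"
    by (intro nn_integral_cong) (auto simp: indicator_def)
  finally show ?thesis by simp
qed

text \<open>The midpoint of a point of \<open>K\<close> above level \<open>2 * t\<close> and one
  above level 0 lies in \<open>K\<close> above level \<open>t\<close>, so Prekopa-Leindler applies
  to the three indicators.\<close>

lemma convex_halfspace_log_concave:
  assumes [measurable]: "K \<in> sets borel" and "convex K"
  shows "emeasure (lborel_Rn n) {x\<in>K. 2 * t \<le> inner_Rn n u x} * emeasure (lborel_Rn n) {x\<in>K. 0 \<le> inner_Rn n u x}
    \<le> (emeasure (lborel_Rn n) {x\<in>K. t \<le> inner_Rn n u x})\<^sup>2"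
proof -
  define A where "A s = {x\<in>K. s \<le> inner_Rn n u x}" for s
  have A_m[measurable]: "A s \<in> sets borel" for s
  proof -
    have "A s = {x \<in> space borel. x \<in> K \<and> s \<le> inner_Rn n u x}" by (auto simp: A_def)
    then show ?thesis by simp
  qed
  have "(\<integral>\<^sup>+x. indicator (A (2 * t)) x \<partial>lborel_Rn n) * (\<integral>\<^sup>+x. indicator (A 0) x \<partial>lborel_Rn n)
    \<le> (\<integral>\<^sup>+x. indicator (A t) x \<partial>lborel_Rn n)\<^sup>2"
  proof (rule prekopa_leindler)
    fix x y
    have "(1 / 2) *\<^sub>R (x + y) \<in> A t" if "x \<in> A (2 * t)" "y \<in> A 0"
    proof -
      have "(1 / 2) *\<^sub>R x + (1 / 2) *\<^sub>R y \<in> K"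
        using that by (intro convexD[OF assms(2)]) (auto simp: A_def)
      then show ?thesis using that by (auto simp: A_def scaleR_add_right)
    qed
    then show "(indicator (A (2 * t)) x * indicator (A 0) y :: ennreal) \<le> (indicator (A t) ((1 / 2) *\<^sub>R (x + y)))\<^sup>2"
      by (auto simp: indicator_def)
  qed simp_all
  then show ?thesis by (simp add: A_def)
qed

text \<open>By symmetry at least half of the volume lies above level 0, so log-concavity becomes
  \<open>2 * \<phi> (2 * t) \<le> (2 * \<phi> t)\<^sup>2\<close>: doubling the level squares the
  tail. Chebyshev at \<open>3 * L\<close> starts the recursion with
  \<open>2 / 9 \<le> 1 / 4\<close>.\<close>

lemma symmetric_convex_tail:
  assumes K[measurable]: "K \<in> sets borel" and "convex K" and sym: "\<And>x. x \<in> K \<Longrightarrow> - x \<in> K"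
    and vol: "emeasure (lborel_Rn n) K = 1" and L: "L > 0"
    and var: "(\<integral>\<^sup>+x\<in>K. ennreal ((inner_Rn n u x)\<^sup>2) \<partial>lborel_Rn n) \<le> ennreal (L\<^sup>2)"
  shows "2 * measure (lborel_Rn n) {x\<in>K. 2 ^ k * (3 * L) \<le> inner_Rn n u x} \<le> (1 / 4) ^ (2 ^ k)"
proof -
  let ?M = "lborel_Rn n"
  define A where "A s = {x\<in>K. s \<le> inner_Rn n u x}" for s
  have A_m[measurable]: "A s \<in> sets borel" for s
  proof -
    have "A s = {x \<in> space borel. x \<in> K \<and> s \<le> inner_Rn n u x}" by (auto simp: A_def)
    then show ?thesis by simp
  qed
  define \<phi> where "\<phi> s = measure ?M (A s)" for s
  have A_fin: "emeasure ?M (A s) \<le> 1" for s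
    unfolding vol[symmetric] by (rule emeasure_mono) (auto simp: A_def)
  have em: "emeasure ?M (A s) = ennreal (\<phi> s)" for s
    unfolding \<phi>_def using A_fin[of s] by (intro emeasure_eq_ennreal_measure) (auto simp: top_unique)
  have \<phi>0: "\<phi> s \<ge> 0" for s by (simp add: \<phi>_def)
  have step: "\<phi> (2 * t) * \<phi> 0 \<le> (\<phi> t)\<^sup>2" for t
  proof -
    have "ennreal (\<phi> (2 * t) * \<phi> 0) \<le> ennreal ((\<phi> t)\<^sup>2)"
      using convex_halfspace_log_concave[OF K assms(2), of n t u]
      unfolding A_def[symmetric] em by (simp add: ennreal_mult \<phi>0 ennreal_power)
    then show ?thesis by (simp add: ennreal_le_iff)
  qed
  have half: "1 / 2 \<le> \<phi> 0"
  proof -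
    have sub: "K \<subseteq> A 0 \<union> {x. - x \<in> A 0}" using sym by (auto simp: A_def)
    have m: "{x. - x \<in> A 0} \<in> sets ?M"
    proof -
      have "(\<lambda>x::nat \<Rightarrow> real. - x) \<in> borel \<rightarrow>\<^sub>M borel"
        by (rule measurable_coordinatewise_then_product) simp
      from measurable_sets[OF this A_m[of 0]] show ?thesis by (simp add: vimage_def)
    qed
    have "1 \<le> emeasure ?M (A 0 \<union> {x. - x \<in> A 0})"
      unfolding vol[symmetric] using m by (intro emeasure_mono[OF sub]) simp
    also have "\<dots> \<le> emeasure ?M (A 0) + emeasure ?M {x. - x \<in> A 0}"
      using m by (intro emeasure_subadditive) simp_all
    also have "\<dots> = ennreal (\<phi> 0 + \<phi> 0)"
      unfolding emeasure_uminus_lborel_Rn[OF A_m] em by (simp only: ennreal_plus \<phi>0)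
    finally show ?thesis by (simp add: ennreal_ge_1)
  qed
  have rec: "2 * \<phi> (2 * t) \<le> (2 * \<phi> t)\<^sup>2" for t
    using mult_left_mono[OF half \<phi>0[of "2 * t"]] step[of t] by (simp add: power2_eq_square)
  have "2 * \<phi> (2 ^ k * (3 * L)) \<le> (1 / 4) ^ (2 ^ k)"
  proof (induction k)
    case 0
    have "ennreal (9 * L\<^sup>2 * \<phi> (3 * L)) = (\<integral>\<^sup>+x. ennreal (9 * L\<^sup>2) * indicator (A (3 * L)) x \<partial>?M)"
      by (subst nn_integral_cmult_indicator) (simp_all add: em ennreal_mult \<phi>0)
    also have "\<dots> \<le> (\<integral>\<^sup>+x\<in>K. ennreal ((inner_Rn n u x)\<^sup>2) \<partial>?M)"
    proof (rule nn_integral_mono)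
      fix x
      have "9 * L\<^sup>2 \<le> (inner_Rn n u x)\<^sup>2" if "3 * L \<le> inner_Rn n u x"
        using power_mono[OF that, of 2] L by (simp add: power_mult_distrib)
      then show "ennreal (9 * L\<^sup>2) * indicator (A (3 * L)) x \<le> ennreal ((inner_Rn n u x)\<^sup>2) * indicator K x"
        by (auto simp: A_def indicator_def intro: ennreal_leI)
    qed
    also note var
    finally have "9 * L\<^sup>2 * \<phi> (3 * L) \<le> L\<^sup>2 * 1" by (simp add: ennreal_le_iff)
    then have "L\<^sup>2 * (9 * \<phi> (3 * L)) \<le> L\<^sup>2 * 1" by simp
    then have "9 * \<phi> (3 * L) \<le> 1" using L by (subst (asm) mult_le_cancel_left_pos) auto
    then show ?case by simp
  next
    case (Suc k)
    have "2 * \<phi> (2 ^ Suc k * (3 * L)) = 2 * \<phi> (2 * (2 ^ k * (3 * L)))" by (simp add: mult_ac)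
    also have "\<dots> \<le> (2 * \<phi> (2 ^ k * (3 * L)))\<^sup>2" by (rule rec)
    also have "\<dots> \<le> ((1 / 4) ^ (2 ^ k))\<^sup>2" by (rule power_mono[OF Suc.IH]) (simp add: \<phi>0)
    also have "\<dots> = (1 / 4) ^ (2 ^ Suc k)" by (simp add: power_mult[symmetric] mult.commute)
    finally show ?case .
  qed
  then show ?thesis by (simp add: \<phi>_def A_def)
qed

lemma dyadic_scale:
  fixes z :: real assumes "1 \<le> z"
  obtains k :: nat where "2 ^ k \<le> z" "z \<le> 2 ^ Suc k"
proof -
  obtain m :: nat where "z < 2 ^ m" using real_arch_pow[of 2 z] by auto
  then obtain m where m: "z < 2 ^ m" "\<And>j. j < m \<Longrightarrow> \<not> z < 2 ^ j"
    using exists_least_iff[of "\<lambda>m. z < 2 ^ m"] by auto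
  then obtain k where "m = Suc k" using assms by (cases m) auto
  with m show ?thesis using that[of k] by force
qed

text \<open>Dyadic shells: where the functional lies between \<open>2 ^ k * (3 * L)\<close> and
  twice this value, the integrand is at most \<open>exp (2 ^ k) \<le> 3 ^ (2 ^ k)\<close>, and the
  tail bound \<open>(1 / 4) ^ (2 ^ k)\<close> outweighs it. The scale \<open>6 * L\<close> is what
  keeps the base at \<open>exp 1\<close>, below 4. The core contributes 2 and the shells
  3/2.\<close>

lemma symmetric_convex_exp_moment:
  assumes K[measurable]: "K \<in> sets borel" and conv: "convex K" and sym: "\<And>x. x \<in> K \<Longrightarrow> - x \<in> K"
    and vol: "emeasure (lborel_Rn n) K = 1" and L: "L > 0"
    and var: "(\<integral>\<^sup>+x\<in>K. ennreal ((inner_Rn n u x)\<^sup>2) \<partial>lborel_Rn n) \<le> ennreal (L\<^sup>2)"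
  shows "(\<integral>\<^sup>+x\<in>K. ennreal (exp (inner_Rn n u x / (6 * L))) \<partial>lborel_Rn n) \<le> 4"
proof -
  let ?M = "lborel_Rn n"
  define A where "A s = {x\<in>K. s \<le> inner_Rn n u x}" for s
  have A_m[measurable]: "A s \<in> sets borel" for s
  proof -
    have "A s = {x \<in> space borel. x \<in> K \<and> s \<le> inner_Rn n u x}" by (auto simp: A_def)
    then show ?thesis by simp
  qed
  have A_fin: "emeasure ?M (A s) \<le> 1" for s
    unfolding vol[symmetric] by (rule emeasure_mono) (auto simp: A_def)
  have em: "emeasure ?M (A s) = ennreal (measure ?M (A s))" for s
    using A_fin[of s] by (intro emeasure_eq_ennreal_measure) (auto simp: top_unique)
  define B where "B k = A (2 ^ k * (3 * L))" for k :: nat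
  have B_m[measurable]: "B k \<in> sets borel" for k by (simp add: B_def)
  have pt: "ennreal (exp (inner_Rn n u x / (6 * L))) * indicator K x
    \<le> 2 * indicator K x + (\<Sum>k. ennreal (exp (2 ^ k)) * indicator (B k) x)" for x
  proof (cases "x \<in> K")
    case True
    let ?y = "inner_Rn n u x"
    show ?thesis
    proof (cases "?y \<le> 3 * L")
      case True
      then have "exp (?y / (6 * L)) \<le> exp (1 / 2)" using L by (simp add: field_simps)
      also have "\<dots> \<le> 2" by (rule exp_half_le2)
      finally have "ennreal (exp (?y / (6 * L))) \<le> 2" by (simp add: ennreal_le_iff2 flip: ennreal_numeral)
      then show ?thesis using \<open>x \<in> K\<close> by (simp add: add_increasing2)
    next
      case False
      then have "1 \<le> ?y / (3 * L)" using L by (simp add: field_simps)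
      then obtain k where k: "2 ^ k \<le> ?y / (3 * L)" "?y / (3 * L) \<le> 2 ^ Suc k"
        by (rule dyadic_scale)
      have "x \<in> B k" using k(1) L \<open>x \<in> K\<close> by (simp add: B_def A_def field_simps)
      have "exp (?y / (6 * L)) \<le> exp (2 ^ k)" using k(2) L by (simp add: field_simps)
      then have "ennreal (exp (?y / (6 * L))) * indicator K x \<le> ennreal (exp (2 ^ k)) * indicator (B k) x"
        using \<open>x \<in> K\<close> \<open>x \<in> B k\<close> by (simp add: ennreal_leI)
      also have "\<dots> \<le> (\<Sum>k. ennreal (exp (2 ^ k)) * indicator (B k) x)"
      proof -
        define F :: "nat \<Rightarrow> ennreal" where "F k = ennreal (exp (2 ^ k)) * indicator (B k) x" for k
        have "F k \<le> (\<Sum>k. F k)" using sum_le_suminf[of F "{k}"] by simp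
        then show ?thesis by (simp add: F_def)
      qed
      finally show ?thesis by (rule order_trans) (simp add: add_increasing)
    qed
  qed simp
  have summand: "ennreal (exp (2 ^ k)) * emeasure ?M (B k) \<le> ennreal (1 / 2 * (3 / 4) ^ Suc k)" for k
  proof -
    have "exp (2 ^ k :: real) = exp 1 ^ (2 ^ k)" by (simp flip: exp_of_nat_mult)
    also have "\<dots> \<le> 3 ^ (2 ^ k)" by (rule power_mono[OF exp_le]) simp
    finally have 1: "exp (2 ^ k :: real) \<le> 3 ^ (2 ^ k)" .
    have 2: "measure ?M (B k) \<le> 1 / 2 * (1 / 4) ^ (2 ^ k)"
      using symmetric_convex_tail[OF assms, of k] by (simp add: B_def A_def)
    have "exp (2 ^ k) * measure ?M (B k) \<le> 3 ^ (2 ^ k) * (1 / 2 * (1 / 4) ^ (2 ^ k))"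
      using 1 2 by (intro mult_mono) auto
    also have "\<dots> = 1 / 2 * (3 / 4) ^ (2 ^ k)"
      by (simp add: power_mult_distrib[symmetric])
    \<comment> \<open>\<open>2 ^ k \<ge> Suc k\<close> replaces the double exponential by a
      geometric series.\<close>
    also have "\<dots> \<le> 1 / 2 * (3 / 4) ^ Suc k"
      by (intro mult_left_mono power_decreasing) (auto simp: Suc_le_eq less_exp)
    finally show ?thesis unfolding B_def em by (simp add: ennreal_mult[symmetric] ennreal_leI)
  qed
  have "(\<integral>\<^sup>+x\<in>K. ennreal (exp (inner_Rn n u x / (6 * L))) \<partial>?M)
    \<le> (\<integral>\<^sup>+x. 2 * indicator K x + (\<Sum>k. ennreal (exp (2 ^ k)) * indicator (B k) x) \<partial>?M)"
    by (rule nn_integral_mono) (rule pt)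
  also have "\<dots> = 2 + (\<Sum>k. ennreal (exp (2 ^ k)) * emeasure ?M (B k))"
    using vol by (simp add: nn_integral_add nn_integral_suminf nn_integral_cmult_indicator)
  also have "\<dots> \<le> 2 + (\<Sum>k. ennreal (1 / 2 * (3 / 4) ^ Suc k))"
    by (intro add_left_mono suminf_le summand) auto
  also have "(\<Sum>k. ennreal (1 / 2 * (3 / 4) ^ Suc k)) = ennreal (3 / 2)"
  proof -
    have "(\<lambda>k. (3 / 8) * (3 / 4 :: real) ^ k) sums ((3 / 8) * (1 / (1 - 3 / 4)))"
      by (intro sums_mult geometric_sums) simp
    then have "(\<lambda>k. 1 / 2 * (3 / 4 :: real) ^ Suc k) sums (3 / 2)" by simp
    then show ?thesis by (subst suminf_ennreal_eq) auto
  qed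
  also have "2 + ennreal (3 / 2) = ennreal (2 + 3 / 2)" by (subst ennreal_plus) auto
  also have "\<dots> \<le> ennreal 4" by (rule ennreal_leI) simp
  finally show ?thesis by simp
qed

section \<open>Polytopes in \<open>Rn n\<close>\<close>

lemma convex_hull_coordinate_continuous:
  fixes a :: "nat \<Rightarrow> real"
  shows "continuous_on A (\<lambda>p. (1 - fst p) *\<^sub>R a + fst p *\<^sub>R (snd p :: nat \<Rightarrow> real))"
  by (rule continuous_on_coordinatewise_then_product)
     (auto intro!: continuous_intros continuous_on_product_then_coordinatewise[OF continuous_on_snd[OF continuous_on_id]])

text \<open>Adding a point forms a cone over the previous hull, a continuous image of the product of
  an interval with a compact set. Compactness later supplies nearest points and Borel
  measurability.\<close>

lemma compact_convex_hull_finite: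
  fixes V :: "(nat \<Rightarrow> real) set"
  assumes "finite V"
  shows "compact (convex hull V)"
  using assms
proof (induction V rule: finite_induct)
  case (insert a V)
  have "convex hull (insert a V) = (if V = {} then {a}
    else (\<lambda>p. (1 - fst p) *\<^sub>R a + fst p *\<^sub>R snd p) ` ({0..1} \<times> (convex hull V)))"
    unfolding convex_hull_insert_alt by (auto simp: image_iff) force+
  moreover have "compact ((\<lambda>p. (1 - fst p) *\<^sub>R a + fst p *\<^sub>R snd p) ` ({0..1::real} \<times> (convex hull V)))"
    by (intro compact_continuous_image convex_hull_coordinate_continuous compact_Times insert.IH) simp
  ultimately show ?case by simp
qed simp

lemma convex_box_Rn: "convex (box_Rn n r)"
proof (rule convexI)
  fix x y :: "nat \<Rightarrow> real" and u v :: real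
  assume xy: "x \<in> box_Rn n r" "y \<in> box_Rn n r" and uv: "0 \<le> u" "0 \<le> v" "u + v = 1"
  have "\<bar>u * x i + v * y i\<bar> \<le> r" if "i < n" for i
  proof -
    have "\<bar>x i\<bar> \<le> r" "\<bar>y i\<bar> \<le> r" using xy that by (auto simp: box_Rn_iff)
    then have "u * \<bar>x i\<bar> + v * \<bar>y i\<bar> \<le> u * r + v * r" using uv by (intro add_mono mult_left_mono) auto
    also have "\<dots> = r" using uv by (simp add: distrib_right[symmetric])
    finally show ?thesis using abs_triangle_ineq[of "u * x i" "v * y i"] uv by (simp add: abs_mult)
  qed
  then show "u *\<^sub>R x + v *\<^sub>R y \<in> box_Rn n r" using xy by (simp add: box_Rn_iff)
qed

lemma convex_hull_finite_bounded:
  assumes V: "finite V" "V \<subseteq> Rn n"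
  obtains D where "D > 0" "convex hull V \<subseteq> box_Rn n D"
proof
  let ?D = "1 + (\<Sum>v\<in>V. \<Sum>i<n. \<bar>v i\<bar>)"
  show "?D > 0" by (intro add_pos_nonneg sum_nonneg) auto
  have "V \<subseteq> box_Rn n ?D"
  proof
    fix v assume v: "v \<in> V"
    have "\<bar>v i\<bar> \<le> ?D" if "i < n" for i
    proof -
      have "\<bar>v i\<bar> \<le> (\<Sum>i<n. \<bar>v i\<bar>)" by (rule member_le_sum) (use that in auto)
      also have "\<dots> \<le> (\<Sum>v\<in>V. \<Sum>i<n. \<bar>v i\<bar>)"
        by (rule member_le_sum[OF v]) (use V in \<open>auto intro: sum_nonneg\<close>)
      finally show ?thesis by simp
    qed
    then show "v \<in> box_Rn n ?D" using v V(2) by (auto simp: box_Rn_def)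
  qed
  then show "convex hull V \<subseteq> box_Rn n ?D" by (intro hull_minimal convex_box_Rn)
qed

lemma small_multiple_in_box:
  assumes "w \<in> Rn n" "r > 0"
  obtains c where "c > 0" "c *\<^sub>R w \<in> box_Rn n r"
proof
  let ?s = "1 + (\<Sum>i<n. \<bar>w i\<bar>)"
  have s: "?s > 0" by (intro add_pos_nonneg sum_nonneg) auto
  then show "r / ?s > 0" using assms by simp
  have "\<bar>r / ?s * w i\<bar> \<le> r" if "i < n" for i
  proof -
    have "\<bar>w i\<bar> \<le> (\<Sum>i<n. \<bar>w i\<bar>)" by (rule member_le_sum) (use that in auto)
    then have "r * \<bar>w i\<bar> \<le> r * ?s" using assms by (intro mult_left_mono) auto
    then show ?thesis using s assms by (simp add: abs_mult divide_le_eq)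
  qed
  then show "(r / ?s) *\<^sub>R w \<in> box_Rn n r" using assms by (simp add: box_Rn_iff Rn_iff)
qed

text \<open>A generating subset \<open>W\<close> of least cardinality consists of extreme points: if
  \<open>w\<close> were inside an open segment of the hull, it would be a convex combination of the
  other points of \<open>W\<close> and could be dropped.\<close>

lemma convex_hull_extreme_points_finite:
  fixes V :: "'a::real_vector set"
  assumes "finite V"
  shows "convex hull {x. x extreme_point_of (convex hull V)} = convex hull V"
proof -
  let ?G = "\<lambda>W. W \<subseteq> V \<and> convex hull W = convex hull V"
  obtain W where W: "?G W" and min: "\<And>W'. ?G W' \<Longrightarrow> card W \<le> card W'"
    using exists_least_iff[of "\<lambda>k. \<exists>W. ?G W \<and> card W = k"] by (metis leI subset_refl)
  have finW: "finite W" using W assms finite_subset by blast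
  have ext: "w extreme_point_of (convex hull V)" if w: "w \<in> W" for w
    unfolding extreme_point_of_def
  proof (intro conjI ballI notI)
    show "w \<in> convex hull V" using w W hull_inc by metis
    define Q where "Q = convex hull (W - {w})"
    have wQ: "w \<notin> Q"
    proof
      assume "w \<in> Q"
      then have "W \<subseteq> Q" using hull_subset[of "W - {w}" convex] unfolding Q_def by blast
      then have "convex hull W \<subseteq> Q" unfolding Q_def by (simp add: hull_minimal)
      moreover have "Q \<subseteq> convex hull W" unfolding Q_def by (rule hull_mono) blast
      ultimately have "?G (W - {w})" using W unfolding Q_def by blast
      then have "card W \<le> card (W - {w})" by (rule min)
      then show False using w finW card_Diff1_less[of W w] by simp
    qed
    fix a b assume a: "a \<in> convex hull V" and b: "b \<in> convex hull V" and seg: "w \<in> open_segment a b"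
    have hull: "convex hull V = (if W - {w} = {} then {w}
      else {(1 - u) *\<^sub>R w + u *\<^sub>R x |x u. 0 \<le> u \<and> u \<le> 1 \<and> x \<in> Q})"
      unfolding Q_def convex_hull_insert_alt[symmetric] using W w by (simp add: insert_absorb)
    have "a \<noteq> b" using seg by auto
    then have "W - {w} \<noteq> {}" using a b unfolding hull by (auto split: if_splits)
    then obtain s a' t b' where a': "a = (1 - s) *\<^sub>R w + s *\<^sub>R a'" "0 \<le> s" "s \<le> 1" "a' \<in> Q"
      and b': "b = (1 - t) *\<^sub>R w + t *\<^sub>R b'" "0 \<le> t" "t \<le> 1" "b' \<in> Q"
      using a b unfolding hull by auto
    obtain r where r: "0 < r" "r < 1" "w = (1 - r) *\<^sub>R a + r *\<^sub>R b"
      using seg by (auto simp: in_segment)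
    \<comment> \<open>The weights of \<open>a'\<close> and \<open>b'\<close> in \<open>w\<close>
      once the shares of \<open>w\<close> in both endpoints are moved to the left side. Their sum
      vanishes only if both endpoints equal \<open>w\<close>.\<close>
    define \<alpha> \<beta> where "\<alpha> = (1 - r) * s" and "\<beta> = r * t"
    have nn: "0 \<le> \<alpha>" "0 \<le> \<beta>" using r a' b' by (auto simp: \<alpha>_def \<beta>_def)
    have eq: "(\<alpha> + \<beta>) *\<^sub>R w = \<alpha> *\<^sub>R a' + \<beta> *\<^sub>R b'"
    proof -
      have "w = (1 - r) *\<^sub>R ((1 - s) *\<^sub>R w + s *\<^sub>R a') + r *\<^sub>R ((1 - t) *\<^sub>R w + t *\<^sub>R b')"
        using r(3) a'(1) b'(1) by simp
      also have "\<dots> = w - (\<alpha> + \<beta>) *\<^sub>R w + (\<alpha> *\<^sub>R a' + \<beta> *\<^sub>R b')"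
        by (simp add: \<alpha>_def \<beta>_def algebra_simps)
      finally show ?thesis by (simp add: algebra_simps)
    qed
    show False
    proof (cases "\<alpha> + \<beta> = 0")
      case True
      then have "s = 0" "t = 0" using nn r by (auto simp: \<alpha>_def \<beta>_def add_nonneg_eq_0_iff)
      then show False using a' b' \<open>a \<noteq> b\<close> by simp
    next
      case False
      have "w = (1 / (\<alpha> + \<beta>)) *\<^sub>R ((\<alpha> + \<beta>) *\<^sub>R w)" using False by simp
      also have "\<dots> = (\<alpha> / (\<alpha> + \<beta>)) *\<^sub>R a' + (\<beta> / (\<alpha> + \<beta>)) *\<^sub>R b'"
        unfolding eq by (simp add: scaleR_add_right)
      also have "\<dots> \<in> Q"
        using a' b' nn False unfolding Q_def
        by (intro convexD[OF convex_convex_hull]) (auto simp: add_divide_distrib[symmetric])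
      finally show False using wQ by blast
    qed
  qed
  show ?thesis
  proof
    show "convex hull {x. x extreme_point_of (convex hull V)} \<subseteq> convex hull V"
      by (intro hull_mono) (auto simp: extreme_point_of_convex_hull)
    show "convex hull V \<subseteq> convex hull {x. x extreme_point_of (convex hull V)}"
      using W hull_mono[of W "{x. x extreme_point_of (convex hull V)}" convex] ext by auto
  qed
qed

text \<open>If a point of the face is a convex combination of generators, each generator of positive
  weight lies in the face: the point is inside the segment from that generator to the weighted mean
  of the others.\<close>

lemma face_of_convex_hull_finite:
  fixes V :: "'a::real_vector set"
  assumes V: "finite V" and F: "F face_of (convex hull V)"
  shows "F = convex hull (V \<inter> F)"
proof
  show "convex hull (V \<inter> F) \<subseteq> F"
    using face_of_imp_convex[OF F] by (intro hull_minimal) auto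
  show "F \<subseteq> convex hull (V \<inter> F)"
  proof
    fix x assume x: "x \<in> F"
    then have "x \<in> convex hull V" using face_of_imp_subset[OF F] by blast
    then obtain c where c: "\<And>v. v \<in> V \<Longrightarrow> 0 \<le> c v" "sum c V = 1" "(\<Sum>v\<in>V. c v *\<^sub>R v) = x"
      unfolding convex_hull_finite[OF V] by auto
    have mem: "v \<in> F" if v: "v \<in> V" "c v > 0" for v
    proof (cases "c v = 1")
      case True
      then have "sum c (V - {v}) = 0" using c(2) V v by (simp add: sum_diff1)
      then have "\<forall>w\<in>V - {v}. c w = 0" using V c(1) by (subst (asm) sum_nonneg_eq_0_iff) auto
      then have "x = v" using c(3) V v True by (subst (asm) sum.remove[of V v]) auto
      then show ?thesis using x by simp
    next
      case False
      have rest: "sum c (V - {v}) = 1 - c v" using c(2) V v by (simp add: sum_diff1)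
      have "0 \<le> sum c (V - {v})" using c(1) by (intro sum_nonneg) auto
      then have lt: "c v < 1" using False rest by simp
      define w where "w = (\<Sum>u\<in>V - {v}. (c u / (1 - c v)) *\<^sub>R u)"
      have "w \<in> convex hull V"
        unfolding w_def
      proof (rule convex_sum)
        show "(\<Sum>u\<in>V - {v}. c u / (1 - c v)) = 1" using rest lt by (simp add: sum_divide_distrib[symmetric])
      qed (use V c(1) lt in \<open>auto simp: hull_inc\<close>)
      have xw: "x = c v *\<^sub>R v + (1 - c v) *\<^sub>R w"
      proof -
        have "(1 - c v) *\<^sub>R w = (\<Sum>u\<in>V - {v}. c u *\<^sub>R u)"
          unfolding w_def scaleR_sum_right using lt by (intro sum.cong) auto
        then show ?thesis using c(3) V v by (simp add: sum.remove[of V v])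
      qed
      show ?thesis
      proof (cases "v = w")
        case True
        then show ?thesis using xw x by (simp add: scaleR_add_left[symmetric])
      next
        case neq: False
        have "x \<in> open_segment v w"
          unfolding in_segment using neq xw v lt by (intro conjI exI[of _ "1 - c v"]) auto
        then show ?thesis
          using face_ofD[OF F] x \<open>w \<in> convex hull V\<close> v by (meson hull_inc)
      qed
    qed
    have "x = (\<Sum>v\<in>V \<inter> F. c v *\<^sub>R v)"
      unfolding c(3)[symmetric] using V mem c(1) by (intro sum.mono_neutral_right) (auto simp: less_le)
    moreover have "sum c (V \<inter> F) = 1"
      unfolding c(2)[symmetric] using V mem c(1) by (intro sum.mono_neutral_left) (auto simp: less_le)
    moreover have "(\<Sum>v\<in>V \<inter> F. c v *\<^sub>R v) \<in> convex hull (V \<inter> F)" if "sum c (V \<inter> F) = 1"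
      using that V c(1) by (intro convex_sum) (auto simp: hull_inc)
    ultimately show "x \<in> convex hull (V \<inter> F)" by metis
  qed
qed

section \<open>Orthogonal projection and separation\<close>

lemma span_subset_Rn: "B \<subseteq> Rn n \<Longrightarrow> span B \<subseteq> Rn n"
  by (simp add: span_minimal subspace_Rn)

text \<open>One Gram-Schmidt step per vector: either the residual \<open>w\<close> of
  \<open>v\<close> is zero and the old projection remains valid, or \<open>w\<close> is a new
  direction along which \<open>p\<close> is corrected.\<close>

lemma orthogonal_projection_span:
  assumes "finite B" "B \<subseteq> Rn n"
  shows "\<exists>p\<in>span B. \<forall>b\<in>B. inner_Rn n (z - p) b = 0"
  using assms
proof (induction B arbitrary: z rule: finite_induct)
  case empty
  then show ?case by (auto intro!: bexI[of _ 0] span_zero)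
next
  case (insert v B)
  obtain q where q: "q \<in> span B" "\<forall>b\<in>B. inner_Rn n (v - q) b = 0" using insert by blast
  obtain p where p: "p \<in> span B" "\<forall>b\<in>B. inner_Rn n (z - p) b = 0" using insert by blast
  define w where "w = v - q"
  have wR: "w \<in> Rn n" using insert.prems span_subset_Rn[of B n] q(1) by (auto simp: w_def)
  have sp: "span B \<subseteq> span (insert v B)" by (rule span_mono) auto
  have wspan: "w \<in> span (insert v B)" unfolding w_def using q(1) sp by (intro span_diff) (auto intro: span_base)
  have perp: "inner_Rn n x s = 0" if "\<forall>b\<in>B. inner_Rn n x b = 0" "s \<in> span B" for x s
  proof -
    have "subspace {s. inner_Rn n x s = 0}" by (rule subspaceI) auto
    then have "span B \<subseteq> {s. inner_Rn n x s = 0}" using that(1) by (intro span_minimal) auto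
    then show ?thesis using that(2) by blast
  qed
  show ?case
  proof (cases "w = 0")
    case True
    then have "v \<in> span B" using q by (simp add: w_def)
    then have "inner_Rn n (z - p) v = 0" using perp p(2) by blast
    then have "\<forall>b\<in>insert v B. inner_Rn n (z - p) b = 0" using p(2) by blast
    then show ?thesis using p(1) sp by blast
  next
    case False
    then have ww: "inner_Rn n w w > 0" using inner_Rn_pos wR by blast
    define c where "c = inner_Rn n (z - p) w / inner_Rn n w w"
    have orth: "inner_Rn n (z - (p + c *\<^sub>R w)) b = 0" if "b \<in> B" for b
    proof -
      have "inner_Rn n (z - p) b = 0" "inner_Rn n w b = 0" using p(2) q(2) that by (auto simp: w_def)
      then show ?thesis by simp
    qed
    have "inner_Rn n (z - (p + c *\<^sub>R w)) w = inner_Rn n (z - p) w - c * inner_Rn n w w" by simp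
    also have "\<dots> = 0" using ww by (simp add: c_def)
    finally have "inner_Rn n (z - (p + c *\<^sub>R w)) (w + q) = 0"
      using perp[of "z - (p + c *\<^sub>R w)" q] orth q(1) by simp
    then have "\<forall>b\<in>insert v B. inner_Rn n (z - (p + c *\<^sub>R w)) b = 0"
      using orth unfolding w_def by simp
    moreover have "p + c *\<^sub>R w \<in> span (insert v B)"
      using p(1) sp wspan by (intro span_add span_scale) auto
    ultimately show ?thesis by blast
  qed
qed

text \<open>The functional points from the nearest point \<open>p\<close> of \<open>P\<close>
  towards \<open>y\<close>. The box around 0 makes its value at \<open>p\<close> positive, so it can
  be scaled to have bound 1 on \<open>P\<close>.\<close>

lemma separating_functional:
  assumes P: "compact P" "convex P" "P \<subseteq> Rn n" and r: "r > 0" "box_Rn n r \<subseteq> P"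
    and y: "y \<in> Rn n" "y \<notin> P"
  obtains u where "u \<in> Rn n" "\<And>x. x \<in> P \<Longrightarrow> inner_Rn n u x \<le> 1" "inner_Rn n u y > 1"
proof -
  have "0 \<in> P" using r by (auto simp: box_Rn_iff subset_iff)
  have cont: "continuous_on P (\<lambda>x. inner_Rn n (y - x) (y - x))"
    unfolding inner_Rn_def
    by (auto intro!: continuous_intros continuous_on_product_then_coordinatewise[OF continuous_on_id])
  obtain p where p: "p \<in> P" "\<And>x. x \<in> P \<Longrightarrow> inner_Rn n (y - p) (y - p) \<le> inner_Rn n (y - x) (y - x)"
    using continuous_attains_inf[OF P(1) _ cont] \<open>0 \<in> P\<close> by blast
  define w where "w = y - p"
  have wR: "w \<in> Rn n" and "w \<noteq> 0" using p(1) P(3) y by (auto simp: w_def)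
  then have ww: "inner_Rn n w w > 0" by (rule inner_Rn_pos)
  have obt: "inner_Rn n w (x - p) \<le> 0" if x: "x \<in> P" for x
  proof (rule ccontr)
    assume "\<not> inner_Rn n w (x - p) \<le> 0"
    then have a: "inner_Rn n w (x - p) > 0" (is "?a > 0") by simp
    let ?b = "inner_Rn n (x - p) (x - p)"
    have "?b \<ge> 0" by (rule inner_Rn_nonneg)
    \<comment> \<open>A step of this length from \<open>p\<close> towards \<open>x\<close> would
      reach a point of \<open>P\<close> closer to \<open>y\<close>.\<close>
    define t where "t = min 1 (?a / (1 + ?b))"
    have t: "0 < t" "t \<le> 1" "t * (1 + ?b) \<le> ?a"
    proof -
      have "0 < min 1 (a / (1 + b)) \<and> min 1 (a / (1 + b)) \<le> 1 \<and> min 1 (a / (1 + b)) * (1 + b) \<le> a"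
        if "0 < a" "0 \<le> b" for a b :: real
      proof -
        have "min 1 (a / (1 + b)) * (1 + b) \<le> a / (1 + b) * (1 + b)"
          using that by (intro mult_right_mono) auto
        then show ?thesis using that by simp
      qed
      from this[OF a \<open>?b \<ge> 0\<close>] show "0 < t" "t \<le> 1" "t * (1 + ?b) \<le> ?a" unfolding t_def by blast+
    qed
    have "(1 - t) *\<^sub>R p + t *\<^sub>R x \<in> P" using t by (intro convexD[OF P(2) p(1) x]) auto
    from p(2)[OF this] have "inner_Rn n w w \<le> inner_Rn n (w - t *\<^sub>R (x - p)) (w - t *\<^sub>R (x - p))"
      by (simp add: w_def algebra_simps)
    also have "\<dots> = inner_Rn n w w - 2 * t * ?a + t * t * ?b"
      using inner_Rn_commute[of n p w] inner_Rn_commute[of n x w] by (simp add: algebra_simps)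
    finally have "2 * ?a \<le> t * ?b" using t(1) by (simp add: mult.assoc)
    then show False using t a by (simp add: algebra_simps)
  qed
  define c where "c = inner_Rn n w p"
  \<comment> \<open>\<open>c\<close> is the maximum of the functional on \<open>P\<close>; it is
    positive because \<open>P\<close> contains a small positive multiple of
    \<open>w\<close>.\<close>
  obtain s where s: "s > 0" "s *\<^sub>R w \<in> box_Rn n r" by (rule small_multiple_in_box[OF wR r(1)])
  have "s * inner_Rn n w w \<le> c" using obt[of "s *\<^sub>R w"] s r by (auto simp: c_def)
  then have c: "c > 0" using mult_pos_pos[OF s(1) ww] by linarith
  show thesis
  proof (rule that[of "(1 / c) *\<^sub>R w"])
    show "inner_Rn n ((1 / c) *\<^sub>R w) x \<le> 1" if "x \<in> P" for x
      using obt[OF that] c by (simp add: c_def divide_le_eq)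
    have "inner_Rn n w y = c + inner_Rn n w w" by (simp add: c_def w_def)
    then show "1 < inner_Rn n ((1 / c) *\<^sub>R w) y" using c ww by (simp add: less_divide_eq)
  qed (use wR in auto)
qed

section \<open>Bases of \<open>Rn n\<close> and boxes inside the polytope\<close>

lemma independent_unit_Rn: "independent (unit_Rn ` {..<n})"
proof (rule independent_if_scalars_zero)
  fix f :: "(nat \<Rightarrow> real) \<Rightarrow> real" and x
  assume sum: "(\<Sum>x\<in>unit_Rn ` {..<n}. f x *\<^sub>R x) = 0" and x: "x \<in> unit_Rn ` {..<n}"
  have inj: "inj_on unit_Rn {..<n}" by (auto simp: inj_on_def unit_Rn_def fun_eq_iff split: if_splits)
  obtain i where i: "i < n" "x = unit_Rn i" using x by auto
  have "0 = (\<Sum>j<n. f (unit_Rn j) *\<^sub>R unit_Rn j) i"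
    using sum unfolding sum.reindex[OF inj] o_def by simp
  also have "\<dots> = f x" using i by (simp add: sum_fun_apply unit_Rn_def if_distrib cong: if_cong)
  finally show "f x = 0" by simp
qed simp

lemma card_unit_Rn: "card (unit_Rn ` {..<n}) = n"
  by (subst card_image) (auto simp: inj_on_def unit_Rn_def fun_eq_iff split: if_splits)

lemma Rn_subset_span_unit: "Rn n \<subseteq> span (unit_Rn ` {..<n})"
proof
  fix x assume "x \<in> Rn n"
  then have "x = (\<Sum>i<n. x i *\<^sub>R unit_Rn i)" by (rule Rn_eq_sum)
  also have "\<dots> \<in> span (unit_Rn ` {..<n})" by (intro span_sum span_scale span_base) auto
  finally show "x \<in> span (unit_Rn ` {..<n})" .
qed

lemma card_basis_Rn:
  assumes "independent B" "B \<subseteq> Rn n" "Rn n \<subseteq> span B"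
  shows "finite B" "card B = n"
proof -
  have "B \<subseteq> span (unit_Rn ` {..<n})" using assms(2) Rn_subset_span_unit by (rule subset_trans)
  then have 1: "finite B \<and> card B \<le> n"
    using independent_span_bound[of "unit_Rn ` {..<n}" B] assms(1) by (simp add: card_unit_Rn)
  then show "finite B" by blast
  have "unit_Rn ` {..<n} \<subseteq> Rn n" by (rule image_subsetI) simp
  then have "unit_Rn ` {..<n} \<subseteq> span B" using assms(3) by (rule subset_trans)
  then have "n \<le> card B"
    using independent_span_bound[of B "unit_Rn ` {..<n}"] independent_unit_Rn 1 by (simp add: card_unit_Rn)
  then show "card B = n" using 1 by simp
qed

lemma open_contains_product_box: fixes x :: "nat \<Rightarrow> real" assumes "openin (powertop_real UNIV) W" "x \<in> W"
  shows "\<exists>X. x \<in> Pi\<^sub>E UNIV X \<and> (\<forall>i. openin euclideanreal (X i)) \<and> Pi\<^sub>E UNIV X \<subseteq> W"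
  apply (insert product_topology_open_contains_basis[OF assms])
  apply (erule exE)
  apply (rule exI)
  apply (erule conjE)+
  apply (intro conjI; assumption)
  done

text \<open>The radius may depend on the coordinate. Later only the first \<open>n\<close>
  coordinates move, so a minimum of finitely many radii is enough.\<close>

lemma open_contains_coordinate_box:
  fixes x :: "nat \<Rightarrow> real"
  assumes W: "openin (powertop_real UNIV) W" "x \<in> W"
  shows "\<exists>e. (\<forall>i. e i > 0) \<and> (\<forall>z. (\<forall>i. \<bar>z i - x i\<bar> < e i) \<longrightarrow> z \<in> W)"
proof -
  from open_contains_product_box[OF W] have "\<exists>X. x \<in> Pi\<^sub>E UNIV X \<and> (\<forall>i. openin euclideanreal (X i)) \<and> Pi\<^sub>E UNIV X \<subseteq> W" .
  then obtain X where X: "x \<in> Pi\<^sub>E UNIV X \<and> (\<forall>i. openin euclideanreal (X i)) \<and> Pi\<^sub>E UNIV X \<subseteq> W" ..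
  have xX: "x i \<in> X i" for i using X by (meson PiE_mem UNIV_I)
  have "open (X i)" for i using X by (meson open_openin)
  then have "\<exists>e. e > 0 \<and> (\<forall>y. dist y (x i) < e \<longrightarrow> y \<in> X i)" for i
    using xX[of i] unfolding open_dist by metis
  then obtain e where e: "\<And>i. e i > 0" "\<And>i y. dist y (x i) < e i \<Longrightarrow> y \<in> X i" by metis
  show ?thesis
  proof (intro exI[of _ e] conjI allI impI)
    fix z assume "\<forall>i. \<bar>z i - x i\<bar> < e i"
    then have "z i \<in> X i" for i using e(2) unfolding dist_real_def by blast
    then have "z \<in> Pi\<^sub>E UNIV X" by (simp add: PiE_iff)
    then show "z \<in> W" using X by blast
  qed (rule e(1))
qed

text \<open>The box around an interior point \<open>x\<close> and its mirror image around
  \<open>- x\<close> average to a box around 0.\<close>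

lemma symmetric_polytope_contains_box:
  assumes "symmetric_polytope n P"
  obtains r where "r > 0" "box_Rn n r \<subseteq> P"
proof -
  have P: "polytope P" "P \<subseteq> Rn n" "P = uminus ` P" "Euclidean_space n interior_of P \<noteq> {}"
    using assms by (auto simp: symmetric_polytope_def)
  have conv: "convex P" using P(1) by (auto simp: polytope_def)
  obtain x where "x \<in> Euclidean_space n interior_of P" using P(4) by (meson ex_in_conv)
  then have "\<exists>U. openin (Euclidean_space n) U \<and> x \<in> U \<and> U \<subseteq> P"
    unfolding interior_of_def by (rule CollectD)
  then obtain U where U: "openin (Euclidean_space n) U \<and> x \<in> U \<and> U \<subseteq> P" ..
  have "\<exists>W. openin (powertop_real UNIV) W \<and> U = W \<inter> {x. \<forall>i\<ge>n. x i = 0}"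
    using U[THEN conjunct1] unfolding Euclidean_space_def openin_subtopology .
  then obtain W where W: "openin (powertop_real UNIV) W \<and> U = W \<inter> {x. \<forall>i\<ge>n. x i = 0}" ..
  have UW: "U = W \<inter> Rn n" unfolding topspace_Euclidean_space by (rule W[THEN conjunct2])
  have xU: "x \<in> U" and UP: "U \<subseteq> P" using U by blast+
  have "x \<in> W" by (rule IntD1[OF xU[unfolded UW]])
  with W have "\<exists>e. (\<forall>i. e i > 0) \<and> (\<forall>z. (\<forall>i. \<bar>z i - x i\<bar> < e i) \<longrightarrow> z \<in> W)"
    by (intro open_contains_coordinate_box) blast+
  then obtain e where e: "\<forall>i. e i > 0" "\<forall>z. (\<forall>i. \<bar>z i - x i\<bar> < e i) \<longrightarrow> z \<in> W" by blast
  \<comment> \<open>Halving the minimum yields the strict inequalities \<open>r < e i\<close>; the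
    inserted 1 keeps the set nonempty.\<close>
  define r where "r = Min (insert 1 (e ` {..<n})) / 2"
  have r: "r > 0" using e(1) by (simp add: r_def)
  have re: "r < e i" if "i < n" for i
  proof -
    have "Min (insert 1 (e ` {..<n})) \<le> e i" using that by (intro Min_le) auto
    then show ?thesis using r unfolding r_def by linarith
  qed
  have xR: "x \<in> Rn n" using xU UP P(2) by blast
  have near: "x + z \<in> P" if z: "z \<in> box_Rn n r" for z
  proof -
    have "\<bar>(x + z) i - x i\<bar> < e i" for i
    proof (cases "i < n")
      case True
      then have "\<bar>z i\<bar> \<le> r" using z by (simp add: box_Rn_iff)
      then show ?thesis using re[OF True] by simp
    next
      case False
      then show ?thesis using z e(1) by (simp add: box_Rn_iff)
    qed
    then have "x + z \<in> W" using e(2) by blast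
    moreover have "x + z \<in> Rn n" using z xR by (auto simp: box_Rn_def)
    ultimately show ?thesis using UW UP by blast
  qed
  show thesis
  proof (rule that[OF r], rule subsetI)
    fix z assume z: "z \<in> box_Rn n r"
    have "- z \<in> box_Rn n r" using z by (auto simp: box_Rn_iff)
    then have "- (x + - z) \<in> P" using near P(3) by blast
    then have "(1 / 2) *\<^sub>R (x + z) + (1 / 2) *\<^sub>R (- (x + - z)) \<in> P"
      by (intro convexD[OF conv near[OF z]]) auto
    moreover have "(1 / 2) *\<^sub>R (x + z) + (1 / 2) *\<^sub>R (- (x + - z)) = z"
      by (auto simp: fun_eq_iff field_simps)
    ultimately show "z \<in> P" by simp
  qed
qed

text \<open>A separating functional with the largest number of tight vertices has a spanning set of tight
  vertices: otherwise it could be moved orthogonally to them until another vertex becomes tight.\<close>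

lemma facet_separation:
  assumes V: "finite V" and P: "P = convex hull V" "P \<subseteq> Rn n" and r: "r > 0" "box_Rn n r \<subseteq> P"
    and y: "y \<in> Rn n" "y \<notin> P"
  obtains u where "u \<in> Rn n" "\<forall>x\<in>P. inner_Rn n u x \<le> 1" "inner_Rn n u y > 1"
    "Rn n \<subseteq> span {v\<in>V. inner_Rn n u v = 1}"
proof -
  define G where "G u \<longleftrightarrow> u \<in> Rn n \<and> (\<forall>v\<in>V. inner_Rn n u v \<le> 1) \<and> inner_Rn n u y > 1" for u
  define B where "B u = {v\<in>V. inner_Rn n u v = 1}" for u
  have VP: "V \<subseteq> P" by (simp add: P(1) hull_subset)
  have le_hull: "inner_Rn n u x \<le> c" if "\<forall>v\<in>V. inner_Rn n u v \<le> c" "x \<in> P" for u x c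
  proof -
    have "convex {x. inner_Rn n u x \<le> c}"
    proof (rule convexI)
      fix x y :: "nat \<Rightarrow> real" and a b :: real
      assume xy: "x \<in> {x. inner_Rn n u x \<le> c}" "y \<in> {x. inner_Rn n u x \<le> c}" and ab: "0 \<le> a" "0 \<le> b" "a + b = 1"
      have "a * inner_Rn n u x + b * inner_Rn n u y \<le> a * c + b * c"
        using xy ab by (intro add_mono mult_left_mono) auto
      also have "\<dots> = c" using ab by (simp add: distrib_right[symmetric])
      finally show "a *\<^sub>R x + b *\<^sub>R y \<in> {x. inner_Rn n u x \<le> c}" by simp
    qed
    then have "P \<subseteq> {x. inner_Rn n u x \<le> c}" unfolding P(1) using that(1) by (intro hull_minimal) auto
    then show ?thesis using that(2) by auto
  qed
  have "compact P" "convex P" unfolding P(1) by (simp_all add: compact_convex_hull_finite V)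
  then obtain u0 where "u0 \<in> Rn n" "\<And>x. x \<in> P \<Longrightarrow> inner_Rn n u0 x \<le> 1" "inner_Rn n u0 y > 1"
    using separating_functional[OF _ _ P(2) r y] by metis
  then have "G u0" using VP unfolding G_def by blast
  moreover have "card (B u) \<le> card V" for u unfolding B_def by (intro card_mono V) auto
  ultimately obtain u where u: "G u" and max: "\<And>u'. G u' \<Longrightarrow> card (B u') \<le> card (B u)"
    using ex_has_greatest_nat[of G u0 "\<lambda>u. card (B u)" "Suc (card V)"] by (metis less_Suc_eq_le)
  have "Rn n \<subseteq> span (B u)"
  proof (rule ccontr)
    assume "\<not> Rn n \<subseteq> span (B u)"
    then obtain z where z: "z \<in> Rn n" "z \<notin> span (B u)" by blast
    have BR: "finite (B u)" "B u \<subseteq> Rn n" using V VP P(2) by (auto simp: B_def)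
    obtain p where p: "p \<in> span (B u)" "\<forall>b\<in>B u. inner_Rn n (z - p) b = 0"
      using orthogonal_projection_span[OF BR] by blast
    \<comment> \<open>The sign is chosen so that the value at \<open>y\<close> does not drop when
      \<open>u\<close> moves along \<open>w\<close>.\<close>
    define w where "w = (if inner_Rn n (z - p) y \<ge> 0 then z - p else - (z - p))"
    have zp: "z - p \<noteq> 0" "z - p \<in> Rn n" using z p span_subset_Rn[OF BR(2)] by auto
    have w: "w \<in> Rn n" "w \<noteq> 0" "inner_Rn n w y \<ge> 0" "\<And>b. b \<in> B u \<Longrightarrow> inner_Rn n w b = 0"
    proof -
      show "w \<in> Rn n" using zp(2) Rn_uminus[OF zp(2)] by (simp only: w_def split: if_split) blast
      show "w \<noteq> 0" using zp(1) unfolding w_def by (metis neg_equal_0_iff_equal)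
      show "inner_Rn n w y \<ge> 0" unfolding w_def by (auto simp del: inner_Rn_simps(3,4) minus_diff_eq)
      show "inner_Rn n w b = 0" if "b \<in> B u" for b
        using p(2) that unfolding w_def by (auto simp del: inner_Rn_simps(3,4) minus_diff_eq)
    qed
    define S where "S = {v\<in>V. inner_Rn n w v > 0}"
    \<comment> \<open>Otherwise \<open>w\<close> would be nonpositive on all of \<open>P\<close>,
      and so at a small positive multiple of \<open>w\<close> itself.\<close>
    have "S \<noteq> {}"
    proof
      assume "S = {}"
      then have "\<forall>v\<in>V. inner_Rn n w v \<le> 0" by (auto simp: S_def not_less)
      moreover obtain c where "c > 0" "c *\<^sub>R w \<in> box_Rn n r" by (rule small_multiple_in_box[OF w(1) r(1)])
      ultimately have "inner_Rn n w (c *\<^sub>R w) \<le> 0" using le_hull r(2) by blast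
      then show False using \<open>c > 0\<close> inner_Rn_pos[OF w(1,2)] by (simp add: mult_le_0_iff)
    qed
    have finS: "finite S" using V by (simp add: S_def)
    \<comment> \<open>The first time at which a generator in \<open>S\<close> becomes tight; up to
      this time all constraints persist.\<close>
    define t where "t = Min ((\<lambda>v. (1 - inner_Rn n u v) / inner_Rn n w v) ` S)"
    have t_le: "t \<le> (1 - inner_Rn n u v) / inner_Rn n w v" if "v \<in> S" for v
      unfolding t_def using finS that by (intro Min_le) auto
    have "t \<in> (\<lambda>v. (1 - inner_Rn n u v) / inner_Rn n w v) ` S"
      unfolding t_def using finS \<open>S \<noteq> {}\<close> by (intro Min_in) simp_all
    then obtain v0 where v0: "v0 \<in> S" "t = (1 - inner_Rn n u v0) / inner_Rn n w v0"
      by blast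
    have t0: "t \<ge> 0" unfolding v0(2) using v0(1) u by (auto simp: S_def G_def)
    define u' where "u' = u + t *\<^sub>R w"
    have u'_inner: "inner_Rn n u' x = inner_Rn n u x + t * inner_Rn n w x" for x by (simp add: u'_def)
    have "inner_Rn n u' v \<le> 1" if v: "v \<in> V" for v
    proof (cases "v \<in> S")
      case True
      then show ?thesis using t_le[OF True] by (simp add: u'_inner S_def le_divide_eq)
    next
      case False
      then have "t * inner_Rn n w v \<le> 0" using v t0 by (intro mult_nonneg_nonpos) (auto simp: S_def)
      moreover have "inner_Rn n u v \<le> 1" using u v by (auto simp: G_def)
      ultimately show ?thesis unfolding u'_inner by linarith
    qed
    moreover have "inner_Rn n u' y > 1"
      using u t0 w(3) unfolding u'_inner G_def by (meson add_increasing2 less_le_trans mult_nonneg_nonneg order_refl)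
    moreover have "u' \<in> Rn n" using u w(1) by (auto simp: u'_def G_def)
    ultimately have "G u'" by (simp add: G_def)
    have "inner_Rn n u' v0 = 1" using v0 by (simp add: u'_inner S_def)
    then have "insert v0 (B u) \<subseteq> B u'" using v0(1) w(4) by (auto simp: B_def S_def u'_inner)
    moreover have "finite (B u')" using V by (simp add: B_def)
    ultimately have "card (insert v0 (B u)) \<le> card (B u')" by (intro card_mono)
    moreover have "v0 \<notin> B u" using v0(1) w(4)[of v0] by (auto simp: S_def)
    ultimately have "card (B u) < card (B u')" using BR(1) by simp
    then show False using max[OF \<open>G u'\<close>] by simp
  qed
  moreover have "\<forall>x\<in>P. inner_Rn n u x \<le> 1"
    using le_hull u unfolding G_def by blast
  ultimately show thesis using u that[of u] unfolding G_def B_def by simp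
qed

lemma inner_Rn_eq_on_span:
  assumes "\<And>b. b \<in> B \<Longrightarrow> inner_Rn n u b = inner_Rn n v b" "x \<in> span B"
  shows "inner_Rn n u x = inner_Rn n v x"
proof -
  have "subspace {s. inner_Rn n u s = inner_Rn n v s}" by (rule subspaceI) auto
  then have "span B \<subseteq> {s. inner_Rn n u s = inner_Rn n v s}" using assms(1) by (intro span_minimal) auto
  then show ?thesis using assms(2) by blast
qed

text \<open>A basis chosen among the tight generators has \<open>n\<close> elements, and expanding a
  point of functional value 1 in it gives coefficients of sum 1. So these \<open>n\<close> points
  affinely span the tight face.\<close>

lemma tight_face_is_facet:
  assumes n: "n \<ge> 1" and VP: "V \<subseteq> P" and P: "convex P" "P \<subseteq> Rn n"
    and u: "\<And>x. x \<in> P \<Longrightarrow> inner_Rn n u x \<le> 1"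
    and sp: "Rn n \<subseteq> span {v\<in>V. inner_Rn n u v = 1}"
  shows "{x\<in>P. inner_Rn n u x = 1} \<in> facets n P"
proof -
  let ?F = "{x\<in>P. inner_Rn n u x = 1}" and ?V = "{v\<in>V. inner_Rn n u v = 1}"
  have face: "?F face_of P"
    unfolding face_of_def
  proof (intro conjI ballI impI)
    show "convex ?F"
    proof (rule convexI)
      fix x y and a b :: real
      assume "x \<in> ?F" "y \<in> ?F" "0 \<le> a" "0 \<le> b" "a + b = 1"
      then show "a *\<^sub>R x + b *\<^sub>R y \<in> ?F" using convexD[OF P(1), of x y a b] by simp
    qed
    fix a b x assume ab: "a \<in> P" "b \<in> P" "x \<in> ?F" "x \<in> open_segment a b"
    obtain t where t: "0 < t" "t < 1" "x = (1 - t) *\<^sub>R a + t *\<^sub>R b" using ab(4) by (auto simp: in_segment)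
    have eq: "(1 - t) * inner_Rn n u a + t * inner_Rn n u b = 1" using ab(3) unfolding t(3) by simp
    have "(1 - t) * inner_Rn n u a \<le> 1 - t" "t * inner_Rn n u b \<le> t"
      using u[OF ab(1)] u[OF ab(2)] t by (auto simp: mult_left_le)
    then have "(1 - t) * inner_Rn n u a = 1 - t" "t * inner_Rn n u b = t" using eq by linarith+
    then show "a \<in> ?F" "b \<in> ?F" using t ab(1,2) by auto
  qed auto
  obtain B where B: "B \<subseteq> ?V" "independent B" "?V \<subseteq> span B"
    using maximal_independent_subset by blast
  have spB: "Rn n \<subseteq> span B" using sp span_minimal[OF B(3)] by auto
  have BR: "B \<subseteq> Rn n" using B(1) VP P(2) by blast
  note card = card_basis_Rn[OF B(2) BR spB]
  have "B \<subseteq> ?F" using B(1) VP by blast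
  moreover have "?F \<subseteq> affine hull B"
  proof
    fix x assume x: "x \<in> ?F"
    then have "x \<in> span B" using P(2) spB by blast
    then obtain c where c: "x = (\<Sum>b\<in>B. c b *\<^sub>R b)" unfolding span_finite[OF card(1)] by auto
    have "1 = inner_Rn n u x" using x by simp
    also have "\<dots> = (\<Sum>b\<in>B. c b * inner_Rn n u b)" unfolding c by (simp add: inner_Rn_sum)
    also have "\<dots> = sum c B" using B(1) by (intro sum.cong) auto
    finally show "x \<in> affine hull B" unfolding affine_hull_finite[OF card(1)] using c by auto
  qed
  ultimately have "affine hull B = affine hull ?F"
    by (meson hull_minimal hull_mono affine_affine_hull subset_antisym)
  moreover have "\<not> affine_dependent B" using B(2) affine_dependent_imp_dependent by blast
  ultimately have "has_aff_dim ?F (int n - 1)" unfolding has_aff_dim_def using card by auto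
  moreover have "B \<noteq> {}" using card n by auto
  then have "?F \<noteq> {}" using \<open>B \<subseteq> ?F\<close> by blast
  ultimately show ?thesis using face by (simp add: facets_def)
qed

text \<open>A face is the hull of the generators that it contains. Finiteness matters because
  \<open>card\<close> of an infinite set is 0.\<close>

lemma finite_facets:
  assumes "finite V" "P = convex hull V"
  shows "finite (facets n P)"
proof (rule finite_subset)
  show "facets n P \<subseteq> (\<lambda>S. convex hull S) ` Pow V"
  proof
    fix F assume "F \<in> facets n P"
    then have "F = convex hull (V \<inter> F)"
      using face_of_convex_hull_finite[OF assms(1)] assms(2) by (simp add: facets_def)
    then show "F \<in> (\<lambda>S. convex hull S) ` Pow V" by (rule image_eqI) auto
  qed
qed (use assms in simp)

text \<open>\<open>U\<close> collects the valid functionals whose tight generators span. Distinct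
  ones have distinct tight faces, all of them facets, which bounds their number; separation shows
  that they cut out \<open>P\<close>.\<close>

lemma symmetric_polytope_facet_description:
  assumes n: "n \<ge> 1" and P: "symmetric_polytope n P"
  obtains U where "finite U" "U \<noteq> {}" "card U \<le> card (facets n P)" "U \<subseteq> Rn n"
    "P = {x\<in>Rn n. \<forall>u\<in>U. inner_Rn n u x \<le> 1}"
proof -
  obtain V where V: "finite V" "P = convex hull V" and PR: "P \<subseteq> Rn n"
    using P by (auto simp: symmetric_polytope_def polytope_def)
  have VP: "V \<subseteq> P" by (simp add: V(2) hull_subset)
  have conv: "convex P" by (simp add: V(2))
  obtain r where r: "r > 0" "box_Rn n r \<subseteq> P" by (rule symmetric_polytope_contains_box[OF P])
  obtain D where D: "D > 0" "convex hull V \<subseteq> box_Rn n D"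
    using convex_hull_finite_bounded[OF V(1)] VP PR by blast
  define U where "U = {u\<in>Rn n. (\<forall>x\<in>P. inner_Rn n u x \<le> 1) \<and> Rn n \<subseteq> span {v\<in>V. inner_Rn n u v = 1}}"
  define F where "F u = {x\<in>P. inner_Rn n u x = 1}" for u
  have F: "F ` U \<subseteq> facets n P"
    unfolding F_def U_def using tight_face_is_facet[OF n VP conv PR] by blast
  have inj: "inj_on F U"
  proof (rule inj_onI)
    fix u v assume uv: "u \<in> U" "v \<in> U" "F u = F v"
    have "inner_Rn n u x = inner_Rn n v x" if "x \<in> Rn n" for x
    proof (rule inner_Rn_eq_on_span)
      show "x \<in> span {v\<in>V. inner_Rn n u v = 1}" using that uv(1) by (auto simp: U_def)
      fix b assume b: "b \<in> {v\<in>V. inner_Rn n u v = 1}"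
      then have "b \<in> F u" using VP by (auto simp: F_def)
      then have "b \<in> F v" using uv(3) by simp
      then show "inner_Rn n u b = inner_Rn n v b" using b by (auto simp: F_def)
    qed
    \<comment> \<open>Both functionals equal 1 on the same spanning set, hence agree on
      \<open>Rn n\<close>, in particular at their difference.\<close>
    then have "inner_Rn n u (u - v) = inner_Rn n v (u - v)" using uv by (auto simp: U_def)
    then have "inner_Rn n (u - v) (u - v) = 0" by (simp del: inner_Rn_simps(4))
    moreover have "u - v \<in> Rn n" using uv by (auto simp: U_def)
    ultimately have "u - v = 0" using inner_Rn_eq_0 by blast
    then show "u = v" by simp
  qed
  have fin: "finite (facets n P)" using finite_facets[OF V] .
  have sep: "\<exists>u\<in>U. inner_Rn n u y > 1" if y: "y \<in> Rn n" "y \<notin> P" for y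
  proof -
    obtain u where "u \<in> Rn n" "\<forall>x\<in>P. inner_Rn n u x \<le> 1" "inner_Rn n u y > 1"
      "Rn n \<subseteq> span {v\<in>V. inner_Rn n u v = 1}"
      by (rule facet_separation[OF V PR r y])
    then have "u \<in> U" unfolding U_def by simp
    then show ?thesis using \<open>inner_Rn n u y > 1\<close> by blast
  qed
  show thesis
  proof (rule that)
    show "finite U" using finite_imageD[OF finite_subset[OF F fin] inj] .
    show "card U \<le> card (facets n P)" by (rule card_inj_on_le[OF inj F fin])
    show "U \<subseteq> Rn n" by (auto simp: U_def)
    show "P = {x\<in>Rn n. \<forall>u\<in>U. inner_Rn n u x \<le> 1}"
    proof (intro equalityI subsetI)
      fix x assume x: "x \<in> {x\<in>Rn n. \<forall>u\<in>U. inner_Rn n u x \<le> 1}"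
      show "x \<in> P"
      proof (rule ccontr)
        assume "x \<notin> P"
        with sep x obtain u where "u \<in> U" "inner_Rn n u x > 1" by blast
        then show False using x by force
      qed
    qed (use PR in \<open>auto simp: U_def\<close>)
    \<comment> \<open>A point beyond the bounding box is outside \<open>P\<close>; some functional
      must exclude it, so \<open>U\<close> is nonempty.\<close>
    have "(D + 1) *\<^sub>R unit_Rn 0 \<notin> P"
    proof
      assume "(D + 1) *\<^sub>R unit_Rn 0 \<in> P"
      then have "(D + 1) *\<^sub>R unit_Rn 0 \<in> box_Rn n D" using D(2) V(2) by blast
      then have "\<bar>((D + 1) *\<^sub>R unit_Rn 0) 0\<bar> \<le> D" using n by (simp only: box_Rn_iff)
      then show False using D(1) by (simp add: unit_Rn_def)
    qed
    moreover have "(D + 1) *\<^sub>R unit_Rn 0 \<in> Rn n" using n by (intro Rn_scaleR unit_Rn_in) simp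
    ultimately show "U \<noteq> {}" using sep by blast
  qed
qed

section \<open>Isotropic position\<close>

text \<open>Valued in \<open>ennreal\<close>, so that changes of variable require no
  integrability.\<close>

abbreviation nn_moment :: "nat \<Rightarrow> (nat \<Rightarrow> real) set \<Rightarrow> (nat \<Rightarrow> real) \<Rightarrow> ennreal" where
  "nn_moment n K \<theta> \<equiv> \<integral>\<^sup>+x\<in>K. ennreal ((inner_Rn n x \<theta>)\<^sup>2) \<partial>lborel_Rn n"

text \<open>Change of variables with a number \<open>d\<close> in the place of
  \<open>\<bar>det T\<bar>\<close>. That images are Borel is established by compactness for
  polytopes and directly for the ball.\<close>

abbreviation scales_volume :: "nat \<Rightarrow> ((nat \<Rightarrow> real) \<Rightarrow> nat \<Rightarrow> real) \<Rightarrow> real \<Rightarrow> bool" where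
  "scales_volume n T d \<equiv> \<forall>A f. A \<in> sets borel \<longrightarrow> T ` A \<in> sets borel \<longrightarrow> A \<subseteq> Rn n \<longrightarrow> f \<in> borel_measurable borel \<longrightarrow>
    (\<integral>\<^sup>+x\<in>T ` A. f x \<partial>lborel_Rn n) = ennreal d * (\<integral>\<^sup>+x\<in>A. f (T x) \<partial>lborel_Rn n)"

lemma nn_integral_linear_image:
  fixes T :: "(nat \<Rightarrow> real) \<Rightarrow> nat \<Rightarrow> real"
  assumes T: "linear T" and bij: "bij_betw T (Rn n) (Rn n)"
  shows "\<exists>d>0. scales_volume n T d"
proof -
  obtain c where c: "c > 0" "\<And>f. f \<in> borel_measurable borel \<Longrightarrow>
      (\<integral>\<^sup>+x. f (T (proj_Rn n x)) \<partial>lborel_Rn n) = ennreal c * (\<integral>\<^sup>+x. f x \<partial>lborel_Rn n)"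
    using nn_integral_linear_Rn[OF T bij] by metis
  show ?thesis
  proof (intro exI[of _ "1 / c"] conjI allI impI)
    show "1 / c > 0" using c(1) by simp
    fix A and f :: "(nat \<Rightarrow> real) \<Rightarrow> ennreal"
    assume [measurable]: "A \<in> sets borel" "T ` A \<in> sets borel" and A: "A \<subseteq> Rn n" and [measurable]: "f \<in> borel_measurable borel"
    have "(\<integral>\<^sup>+x\<in>A. f (T x) \<partial>lborel_Rn n)
      = (\<integral>\<^sup>+x. f (T (proj_Rn n x)) * indicator (T ` A) (T (proj_Rn n x)) \<partial>lborel_Rn n)"
    proof (rule nn_integral_lborel_Rn_cong)
      fix x assume x: "x \<in> Rn n"
      have "T x \<in> T ` A \<longleftrightarrow> x \<in> A"
        using bij_betw_imp_inj_on[OF bij] A x by (auto dest: inj_onD)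
      then show "f (T x) * indicator A x = f (T (proj_Rn n x)) * indicator (T ` A) (T (proj_Rn n x))"
        using x by (simp add: proj_Rn_id indicator_def)
    qed
    also have "\<dots> = ennreal c * (\<integral>\<^sup>+x\<in>T ` A. f x \<partial>lborel_Rn n)"
      by (rule c(2)) measurable
    finally have eq: "(\<integral>\<^sup>+x\<in>A. f (T x) \<partial>lborel_Rn n) = ennreal c * (\<integral>\<^sup>+x\<in>T ` A. f x \<partial>lborel_Rn n)" .
    have "ennreal (1 / c) * ennreal c = 1" using c(1) by (simp add: ennreal_mult[symmetric])
    then show "(\<integral>\<^sup>+x\<in>T ` A. f x \<partial>lborel_Rn n) = ennreal (1 / c) * (\<integral>\<^sup>+x\<in>A. f (T x) \<partial>lborel_Rn n)"
      unfolding eq mult.assoc[symmetric] by simp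
  qed
qed

lemma abs_inner_Rn_le_box:
  assumes "x \<in> box_Rn n D"
  shows "\<bar>inner_Rn n x \<theta>\<bar> \<le> (\<Sum>i<n. D * \<bar>\<theta> i\<bar>)"
  unfolding inner_Rn_def
  using assms by (intro order_trans[OF sum_abs] sum_mono) (auto simp: abs_mult box_Rn_iff intro: mult_right_mono)

lemma emeasure_subset_box_finite:
  assumes "K \<subseteq> box_Rn n D"
  shows "emeasure (lborel_Rn n) K < \<infinity>"
proof -
  have "K \<subseteq> box_Rn n (\<bar>D\<bar>)" using assms by (force simp: box_Rn_iff)
  then have "emeasure (lborel_Rn n) K \<le> emeasure (lborel_Rn n) (box_Rn n \<bar>D\<bar>)"
    by (rule emeasure_mono) simp
  also have "\<dots> < \<infinity>" by (simp add: emeasure_box_Rn)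
  finally show ?thesis .
qed

lemma set_nn_integral_inner_sq_finite:
  assumes [measurable]: "K \<in> sets borel" and K: "K \<subseteq> box_Rn n D"
  shows "nn_moment n K \<theta> < \<infinity>"
proof -
  let ?B = "\<Sum>i<n. D * \<bar>\<theta> i\<bar>"
  have "nn_moment n K \<theta> \<le> (\<integral>\<^sup>+x. ennreal (?B\<^sup>2) * indicator K x \<partial>lborel_Rn n)"
  proof (rule nn_integral_mono)
    fix x
    have "(inner_Rn n x \<theta>)\<^sup>2 \<le> ?B\<^sup>2" if "x \<in> K"
      using abs_inner_Rn_le_box[of x n D \<theta>] K that by (auto simp: abs_le_square_iff[symmetric])
    then show "ennreal ((inner_Rn n x \<theta>)\<^sup>2) * indicator K x \<le> ennreal (?B\<^sup>2) * indicator K x"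
      by (auto simp: indicator_def intro: ennreal_leI)
  qed
  also have "\<dots> = ennreal (?B\<^sup>2) * emeasure (lborel_Rn n) K" by (simp add: nn_integral_cmult)
  also have "\<dots> < \<infinity>" using emeasure_subset_box_finite[OF K] by (simp add: ennreal_mult_less_top)
  finally show ?thesis .
qed

text \<open>Boundedness of \<open>K\<close> excludes an infinite moment, for which the Bochner
  integral would be 0 by convention.\<close>

lemma second_moment_eq:
  assumes K[measurable]: "K \<in> sets borel" and box: "K \<subseteq> box_Rn n D"
  shows "nn_moment n K \<theta> = ennreal (second_moment n K \<theta>)"
proof -
  have "second_moment n K \<theta> = enn2real (\<integral>\<^sup>+x. ennreal (indicator K x *\<^sub>R (inner_Rn n x \<theta>)\<^sup>2) \<partial>lborel_Rn n)"
    unfolding second_moment_def set_lebesgue_integral_def by (rule integral_eq_nn_integral) auto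
  also have "(\<integral>\<^sup>+x. ennreal (indicator K x *\<^sub>R (inner_Rn n x \<theta>)\<^sup>2) \<partial>lborel_Rn n)
    = nn_moment n K \<theta>"
    by (intro nn_integral_cong) (auto simp: indicator_def)
  finally show ?thesis using set_nn_integral_inner_sq_finite[OF K box, of \<theta>] by simp
qed

text \<open>Homogeneity of degree two passes from the sphere to all directions. The form on
  \<open>Rn n\<close> suits linear changes of variable, which do not preserve the sphere.\<close>

lemma second_moment_const_iff:
  assumes K: "K \<in> sets borel" "K \<subseteq> box_Rn n D"
  shows "(\<forall>\<theta>\<in>sphere_Rn n. second_moment n K \<theta> = L\<^sup>2) \<longleftrightarrow>
    (\<forall>\<theta>\<in>Rn n. nn_moment n K \<theta> = ennreal (L\<^sup>2 * inner_Rn n \<theta> \<theta>))"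
proof (intro iffI ballI)
  fix \<theta> assume all: "\<forall>\<theta>\<in>sphere_Rn n. second_moment n K \<theta> = L\<^sup>2" and \<theta>: "\<theta> \<in> Rn n"
  show "nn_moment n K \<theta> = ennreal (L\<^sup>2 * inner_Rn n \<theta> \<theta>)"
  proof (cases "\<theta> = 0")
    case False
    define s where "s = sqrt (inner_Rn n \<theta> \<theta>)"
    have s: "s > 0" "s * s = inner_Rn n \<theta> \<theta>" using inner_Rn_pos[OF \<theta> False] by (auto simp: s_def)
    have sph: "(1 / s) *\<^sub>R \<theta> \<in> sphere_Rn n"
      using \<theta> s by (auto simp: sphere_Rn_def field_simps)
    have "nn_moment n K \<theta>
      = (\<integral>\<^sup>+x. ennreal (s * s) * (ennreal ((inner_Rn n x ((1 / s) *\<^sub>R \<theta>))\<^sup>2) * indicator K x) \<partial>lborel_Rn n)"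
    proof (intro nn_integral_cong)
      fix x
      have "(inner_Rn n x \<theta>)\<^sup>2 = (s * s) * (inner_Rn n x ((1 / s) *\<^sub>R \<theta>))\<^sup>2"
        using s(1) by (simp add: power2_eq_square)
      then show "ennreal ((inner_Rn n x \<theta>)\<^sup>2) * indicator K x
        = ennreal (s * s) * (ennreal ((inner_Rn n x ((1 / s) *\<^sub>R \<theta>))\<^sup>2) * indicator K x)"
        unfolding mult.assoc[symmetric, of "ennreal (s * s)"] ennreal_mult''[OF zero_le_power2, symmetric]
        by (simp only:)
    qed
    also have "\<dots> = ennreal (s * s) * ennreal (second_moment n K ((1 / s) *\<^sub>R \<theta>))"
      using K by (subst nn_integral_cmult) (simp_all add: second_moment_eq[OF K] del: inner_Rn_simps)
    also have "\<dots> = ennreal (L\<^sup>2 * inner_Rn n \<theta> \<theta>)"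
      using all sph s by (simp add: ennreal_mult[symmetric] mult.commute)
    finally show ?thesis .
  qed simp
next
  fix \<theta> assume all: "\<forall>\<theta>\<in>Rn n. nn_moment n K \<theta> = ennreal (L\<^sup>2 * inner_Rn n \<theta> \<theta>)"
    and \<theta>: "\<theta> \<in> sphere_Rn n"
  have "ennreal (second_moment n K \<theta>) = ennreal (L\<^sup>2)"
    using all \<theta> by (simp add: second_moment_eq[OF K, symmetric] sphere_Rn_def)
  moreover have "second_moment n K \<theta> \<ge> 0"
    unfolding second_moment_def set_lebesgue_integral_def by (rule Bochner_Integration.integral_nonneg) simp
  ultimately show "second_moment n K \<theta> = L\<^sup>2" by (simp add: ennreal_inj)
qed

text \<open>The functional may vanish somewhere in \<open>K\<close>, but its values at
  \<open>x\<close> and at the translate \<open>a + x\<close> differ by a fixed nonzero amount and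
  cannot both be small. Integration over a box for which both points stay in \<open>K\<close> gives
  a positive lower bound.\<close>

lemma set_nn_integral_inner_sq_pos:
  assumes [measurable]: "K \<in> sets borel" and r: "r > 0" "box_Rn n r \<subseteq> K" and \<phi>: "\<phi> \<in> Rn n" "\<phi> \<noteq> 0"
  shows "nn_moment n K \<phi> > 0"
proof -
  obtain i where i: "i < n" "\<phi> i \<noteq> 0" using \<phi> by (auto simp: Rn_iff fun_eq_iff) (meson not_less)
  let ?M = "lborel_Rn n"
  define A where "A = nn_moment n K \<phi>"
  define a where "a = (r / 2) *\<^sub>R unit_Rn i"
  have aR: "a \<in> Rn n" using i by (auto simp: a_def)
  have a_in: "inner_Rn n (a + x) \<phi> = inner_Rn n x \<phi> + r / 2 * \<phi> i" for x using i by (simp add: a_def)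
  have K1: "x \<in> K" "a + x \<in> K" if "x \<in> box_Rn n (r / 2)" for x
  proof -
    have "\<bar>a j\<bar> \<le> r / 2" for j using r by (simp add: a_def unit_Rn_def)
    then have "\<bar>a j + x j\<bar> \<le> r" if "j < n" for j
      using \<open>x \<in> box_Rn n (r / 2)\<close> that abs_triangle_ineq[of "a j" "x j"] unfolding box_Rn_iff
      by (smt (verit) field_sum_of_halves)
    then have "a + x \<in> box_Rn n r" using that aR by (auto simp: box_Rn_iff Rn_iff)
    moreover have "x \<in> box_Rn n r" using that r by (force simp: box_Rn_iff)
    ultimately show "x \<in> K" "a + x \<in> K" using r by auto
  qed
  have m: "(\<lambda>x. a + x) \<in> borel \<rightarrow>\<^sub>M borel"
    by (rule measurable_coordinatewise_then_product) simp
  define B where "B = box_Rn n (r / 2)"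
  have [measurable]: "B \<in> sets borel" by (simp add: B_def)
  have "ennreal ((r / 2 * \<phi> i)\<^sup>2 / 2) * emeasure ?M B = (\<integral>\<^sup>+x. ennreal ((r / 2 * \<phi> i)\<^sup>2 / 2) * indicator B x \<partial>?M)"
    by (simp add: nn_integral_cmult)
  also have "\<dots> \<le> (\<integral>\<^sup>+x. ennreal ((inner_Rn n x \<phi>)\<^sup>2) * indicator K x
      + ennreal ((inner_Rn n (a + 1 *\<^sub>R x) \<phi>)\<^sup>2) * indicator K (a + 1 *\<^sub>R x) \<partial>?M)"
  proof (rule nn_integral_mono)
    fix x
    have "c\<^sup>2 / 2 \<le> y\<^sup>2 + (y + c)\<^sup>2" for y c :: real
    proof -
      have "y\<^sup>2 + (y + c)\<^sup>2 - c\<^sup>2 / 2 = 2 * (y + c / 2)\<^sup>2" by (simp add: power2_eq_square field_simps)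
      then show ?thesis using zero_le_power2[of "y + c / 2"] by linarith
    qed
    then have "ennreal ((r / 2 * \<phi> i)\<^sup>2 / 2) \<le> ennreal ((inner_Rn n x \<phi>)\<^sup>2 + (inner_Rn n x \<phi> + r / 2 * \<phi> i)\<^sup>2)"
      by (rule ennreal_leI)
    then show "ennreal ((r / 2 * \<phi> i)\<^sup>2 / 2) * indicator B x \<le> ennreal ((inner_Rn n x \<phi>)\<^sup>2) * indicator K x
      + ennreal ((inner_Rn n (a + 1 *\<^sub>R x) \<phi>)\<^sup>2) * indicator K (a + 1 *\<^sub>R x)"
      using K1[of x] unfolding scaleR_one a_in by (auto simp: B_def[symmetric] indicator_def)
  qed
  also have "\<dots> = A + (\<integral>\<^sup>+x. ennreal ((inner_Rn n (a + 1 *\<^sub>R x) \<phi>)\<^sup>2) * indicator K (a + 1 *\<^sub>R x) \<partial>?M)"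
    unfolding A_def using m by (intro nn_integral_add) (simp_all add: measurable_compose[OF m])
  also have "(\<integral>\<^sup>+x. ennreal ((inner_Rn n (a + 1 *\<^sub>R x) \<phi>)\<^sup>2) * indicator K (a + 1 *\<^sub>R x) \<partial>?M) = A"
    unfolding A_def by (subst nn_integral_lborel_Rn_affine[of _ 1 a]) (use aR in simp_all)
  finally have le: "ennreal ((r / 2 * \<phi> i)\<^sup>2 / 2) * emeasure ?M B \<le> A + A" .
  have "ennreal ((r / 2 * \<phi> i)\<^sup>2 / 2) * emeasure ?M B > 0"
    using r i by (simp add: B_def emeasure_box_Rn ennreal_zero_less_mult_iff)
  then have "A \<noteq> 0" using le by auto
  then show ?thesis unfolding A_def by (simp add: less_le)
qed

text \<open>Orthonormalising the unit vectors in their natural order gives triangular vectors with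
  nonzero diagonal; invertibility of the resulting map is then forward substitution, without
  determinants.\<close>

lemma gram_schmidt_triangular:
  fixes a :: "(nat \<Rightarrow> real) \<Rightarrow> (nat \<Rightarrow> real) \<Rightarrow> real"
  assumes add: "\<And>x y z. a (x + y) z = a x z + a y z" and scale: "\<And>c x z. a (c *\<^sub>R x) z = c * a x z"
    and comm: "\<And>x y. a x y = a y x" and pos: "\<And>x. x \<in> Rn n \<Longrightarrow> x \<noteq> 0 \<Longrightarrow> a x x > 0"
    and "m \<le> n"
  shows "\<exists>b. \<forall>k<m. b k k \<noteq> 0 \<and> (\<forall>i>k. b k i = 0) \<and> (\<forall>j<m. a (b j) (b k) = (if j = k then 1 else 0))"
  using \<open>m \<le> n\<close>
proof (induction m)
  case (Suc m)
  then obtain b where b: "\<And>k. k < m \<Longrightarrow> b k k \<noteq> 0" "\<And>k i. k < m \<Longrightarrow> i > k \<Longrightarrow> b k i = 0"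
    "\<And>j k. j < m \<Longrightarrow> k < m \<Longrightarrow> a (b j) (b k) = (if j = k then 1 else 0)"
    by (metis Suc_leD)
  have diff: "a (x - y) z = a x z - a y z" for x y z
    using add[of "x - y" y z] by simp
  have zero: "a 0 z = 0" for z using scale[of 0 0 z] by simp
  have sum: "a (\<Sum>k\<in>S. f k) z = (\<Sum>k\<in>S. a (f k) z)" for S z and f :: "nat \<Rightarrow> nat \<Rightarrow> real"
  proof (induction S rule: infinite_finite_induct)
    case (insert k S)
    then show ?case by (simp only: sum.insert[OF insert(1,2)] add)
  qed (simp_all only: sum.infinite sum.empty zero not_False_eq_True)
  \<comment> \<open>The subtracted projections only involve coordinates below \<open>m\<close>, so
    coordinate \<open>m\<close> stays 1 and \<open>v\<close> is nonzero.\<close>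
  define v where "v = unit_Rn m - (\<Sum>k<m. a (unit_Rn m) (b k) *\<^sub>R b k)"
  have v_out: "v i = 0" if "i > m" for i
    using that b(2) by (simp add: v_def sum_fun_apply unit_Rn_def)
  have v_m: "v m = 1" using b(2) by (simp add: v_def sum_fun_apply unit_Rn_def)
  have vR: "v \<in> Rn n" using v_out Suc.prems by (auto simp: Rn_iff)
  have "v \<noteq> 0" using v_m by (metis zero_fun_apply zero_neq_one)
  with pos vR have vv: "a v v > 0" by blast
  have v_orth: "a v (b j) = 0" if "j < m" for j
  proof -
    have "a v (b j) = a (unit_Rn m) (b j) - (\<Sum>k<m. a (unit_Rn m) (b k) * a (b k) (b j))"
      by (simp add: v_def diff sum scale)
    also have "(\<Sum>k<m. a (unit_Rn m) (b k) * a (b k) (b j)) = (\<Sum>k<m. if k = j then a (unit_Rn m) (b j) else 0)"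
      using that by (intro sum.cong) (auto simp: b(3))
    finally show ?thesis using that by simp
  qed
  define w where "w = (1 / sqrt (a v v)) *\<^sub>R v"
  have w_orth: "a w (b j) = 0" "a (b j) w = 0" if "j < m" for j
    using v_orth[OF that] comm[of "b j" w] by (simp_all add: w_def scale)
  have ww: "a w w = 1"
  proof -
    have "a w w = (1 / sqrt (a v v)) * ((1 / sqrt (a v v)) * a v v)"
      unfolding w_def by (metis comm scale)
    then show ?thesis using vv by (simp add: field_simps)
  qed
  show ?case
  proof (intro exI[of _ "b(m := w)"] allI impI conjI)
    fix k assume k: "k < Suc m"
    show "(b(m := w)) k k \<noteq> 0" using k b(1) v_m vv by (auto simp: w_def less_Suc_eq)
    show "(b(m := w)) k i = 0" if "k < i" for i using k that b(2) v_out by (auto simp: w_def less_Suc_eq)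
    show "a ((b(m := w)) j) ((b(m := w)) k) = (if j = k then 1 else 0)" if "j < Suc m" for j
      using k that b(3) w_orth ww by (auto simp: less_Suc_eq)
  qed
qed simp

lemma set_integrable_bounded:
  fixes f :: "(nat \<Rightarrow> real) \<Rightarrow> real"
  assumes K[measurable]: "K \<in> sets borel" and box: "K \<subseteq> box_Rn n D"
    and [measurable]: "f \<in> borel_measurable borel" and B: "\<And>x. x \<in> K \<Longrightarrow> \<bar>f x\<bar> \<le> B"
  shows "set_integrable (lborel_Rn n) K f"
  unfolding set_integrable_def
proof (rule Bochner_Integration.integrable_bound)
  show "integrable (lborel_Rn n) (\<lambda>x. indicator K x *\<^sub>R B)"
    using emeasure_subset_box_finite[OF box] by (intro integrable_scaleR_left integrable_real_indicator) simp_all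
qed (use B in \<open>auto simp: indicator_def intro: order_trans[OF _ abs_ge_self]\<close>)

lemma set_integrable_inner_mult:
  assumes K: "K \<in> sets borel" "K \<subseteq> box_Rn n D"
  shows "set_integrable (lborel_Rn n) K (\<lambda>x. inner_Rn n x \<theta> * inner_Rn n x \<phi>)"
proof (rule set_integrable_bounded[OF K])
  show "\<bar>inner_Rn n x \<theta> * inner_Rn n x \<phi>\<bar> \<le> (\<Sum>i<n. D * \<bar>\<theta> i\<bar>) * (\<Sum>i<n. D * \<bar>\<phi> i\<bar>)" if "x \<in> K" for x
    unfolding abs_mult using that K(2)
    by (intro mult_mono abs_inner_Rn_le_box) (auto intro: order_trans[OF abs_ge_zero abs_inner_Rn_le_box])
qed measurable

lemma symmetric_polytope_measurable:
  assumes "symmetric_polytope n P"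
  obtains D where "D > 0" "P \<subseteq> box_Rn n D" "P \<subseteq> Rn n" "compact P" "P \<in> sets borel" "convex P"
proof -
  obtain V where V: "finite V" "P = convex hull V" and PR: "P \<subseteq> Rn n"
    using assms by (auto simp: symmetric_polytope_def polytope_def)
  have VP: "V \<subseteq> P" by (simp add: V(2) hull_subset)
  obtain D where D: "D > 0" "convex hull V \<subseteq> box_Rn n D"
    using convex_hull_finite_bounded[OF V(1)] VP PR by blast
  have "compact P" unfolding V(2) by (rule compact_convex_hull_finite[OF V(1)])
  moreover from this have "P \<in> sets borel" by (intro borel_closed compact_imp_closed)
  moreover have "convex P" by (simp add: V(2))
  ultimately show thesis using that D V(2) PR by blast
qed

lemma compact_linear_image_Rn:
  fixes T :: "(nat \<Rightarrow> real) \<Rightarrow> nat \<Rightarrow> real"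
  assumes T: "linear T" and P: "compact P" "P \<subseteq> Rn n"
  shows "compact (T ` P)"
proof -
  have "T ` P = (\<lambda>x. T (proj_Rn n x)) ` P" using P(2) by (intro image_cong) (auto simp: proj_Rn_id)
  then show ?thesis using compact_continuous_image[OF continuous_on_linear_proj_Rn[OF T] P(1)] by simp
qed

lemma linear_image_symmetric_polytope:
  fixes T :: "(nat \<Rightarrow> real) \<Rightarrow> nat \<Rightarrow> real"
  assumes P: "symmetric_polytope n P" and T: "linear T" and bij: "bij_betw T (Rn n) (Rn n)"
  obtains D where "D > 0" "T ` P \<subseteq> box_Rn n D" "T ` P \<in> sets borel"
proof -
  obtain D where D: "D > 0" "P \<subseteq> box_Rn n D" "P \<subseteq> Rn n" "compact P"
    using symmetric_polytope_measurable[OF P] by metis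
  have TR: "T x \<in> Rn n" if "x \<in> Rn n" for x
    using bij that bij_betw_apply by fastforce
  obtain C where C: "C > 0" "\<And>r x. x \<in> box_Rn n r \<Longrightarrow> T x \<in> box_Rn n (C * r)"
    using linear_box_Rn[OF T TR] by metis
  have "T ` P \<subseteq> box_Rn n (C * D)" using C(2) D(2) by blast
  moreover have "T ` P \<in> sets borel"
    using compact_linear_image_Rn[OF T D(4,3)] by (intro borel_closed compact_imp_closed)
  moreover have "C * D > 0" using C(1) D(1) by simp
  ultimately show thesis using that by blast
qed

text \<open>With \<open>b\<close> orthonormal for the covariance form \<open>a\<close> of
  \<open>P\<close>, the map whose coordinates are the inner products with the \<open>b i\<close>
  makes the covariance the identity. The integral is still over \<open>P\<close>; Jacobian and
  volume are treated afterwards.\<close>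

lemma exists_isotropizing_map:
  assumes P: "symmetric_polytope n P"
  obtains T where "linear T" "bij_betw T (Rn n) (Rn n)"
    "\<forall>\<theta>\<in>Rn n. (\<integral>\<^sup>+x\<in>P. ennreal ((inner_Rn n (T x) \<theta>)\<^sup>2) \<partial>lborel_Rn n) = ennreal (inner_Rn n \<theta> \<theta>)"
proof -
  obtain D where D: "D > 0" "P \<subseteq> box_Rn n D" "P \<subseteq> Rn n" "P \<in> sets borel"
    using symmetric_polytope_measurable[OF P] by metis
  obtain r where r: "r > 0" "box_Rn n r \<subseteq> P" by (rule symmetric_polytope_contains_box[OF P])
  define a where "a \<theta> \<phi> = (LINT x:P|lborel_Rn n. inner_Rn n x \<theta> * inner_Rn n x \<phi>)" for \<theta> \<phi>
  note int = set_integrable_inner_mult[OF D(4,2)]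
  have a_sq: "nn_moment n P \<theta> = ennreal (a \<theta> \<theta>)" for \<theta>
    unfolding second_moment_eq[OF D(4,2)] by (simp add: second_moment_def a_def power2_eq_square)
  have add: "a (x + y) z = a x z + a y z" for x y z
    unfolding a_def using set_integral_add(2)[OF int[of x z] int[of y z]] by (simp add: distrib_right)
  have scale: "a (c *\<^sub>R x) z = c * a x z" for c x z
    unfolding a_def inner_Rn_simps mult.assoc by (rule set_integral_mult_right)
  have comm: "a x y = a y x" for x y unfolding a_def by (simp add: mult.commute)
  have pos: "a x x > 0" if "x \<in> Rn n" "x \<noteq> 0" for x
    using set_nn_integral_inner_sq_pos[OF D(4) r that] unfolding a_sq by simp
  have "\<exists>b. \<forall>k<n. b k k \<noteq> 0 \<and> (\<forall>i>k. b k i = 0) \<and> (\<forall>j<n. a (b j) (b k) = (if j = k then 1 else 0))"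
    using gram_schmidt_triangular[where a=a and n=n and m=n, OF add scale comm pos order_refl] .
  then obtain b where b: "\<And>k. k < n \<Longrightarrow> b k k \<noteq> 0" "\<And>k i. k < n \<Longrightarrow> i > k \<Longrightarrow> b k i = 0"
    "\<And>j k. j < n \<Longrightarrow> k < n \<Longrightarrow> a (b j) (b k) = (if j = k then 1 else 0)"
    by metis
  have bR: "b k \<in> Rn n" if "k < n" for k using b(2)[OF that] that by (auto simp: Rn_iff)
  have zero: "a 0 z = 0" for z using scale[of 0 0 z] by simp
  have sum: "a (\<Sum>k\<in>S. f k) z = (\<Sum>k\<in>S. a (f k) z)" for S z and f :: "nat \<Rightarrow> nat \<Rightarrow> real"
  proof (induction S rule: infinite_finite_induct)
    case (insert k S)
    then show ?case by (simp only: sum.insert[OF insert(1,2)] add)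
  qed (simp_all only: sum.infinite sum.empty zero not_False_eq_True)
  have sumr: "a z (\<Sum>k\<in>S. f k) = (\<Sum>k\<in>S. a z (f k))" for S z and f :: "nat \<Rightarrow> nat \<Rightarrow> real"
    by (subst (1 2) comm) (rule sum)
  have scaler: "a z (c *\<^sub>R x) = c * a z x" for c x z by (subst (1 2) comm) (rule scale)
  define T where "T x = (\<lambda>i. if i < n then inner_Rn n x (b i) else 0)" for x
  have lin: "linear T" by (rule linearI) (auto simp: T_def fun_eq_iff)
  have TR: "T x \<in> Rn n" for x by (simp add: T_def Rn_iff)
  have inj: "inj_on T (Rn n)"
  proof (rule inj_onI)
    fix x y assume xy: "x \<in> Rn n" "y \<in> Rn n" "T x = T y"
    define z where "z = x - y"
    have zR: "z \<in> Rn n" using xy by (auto simp: z_def)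
    have zb: "inner_Rn n z (b i) = 0" if "i < n" for i
      using fun_cong[OF xy(3), of i] that by (simp add: T_def z_def)
    \<comment> \<open>Forward substitution: \<open>b i\<close> has no coordinates beyond
      \<open>i\<close> and a nonzero one at \<open>i\<close>.\<close>
    have "i < n \<longrightarrow> z i = 0" for i
    proof (induction i rule: less_induct)
      case (less i)
      show ?case
      proof
        assume i: "i < n"
        have "inner_Rn n z (b i) = (\<Sum>j\<in>{i}. z j * b i j)"
          unfolding inner_Rn_def
        proof (rule sum.mono_neutral_right)
          show "\<forall>j\<in>{..<n} - {i}. z j * b i j = 0"
            using less i b(2)[OF i] by (metis DiffE insertI1 lessThan_iff linorder_neqE_nat mult_eq_0_iff)
        qed (use i in auto)
        then show "z i = 0" using zb[OF i] b(1)[OF i] by simp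
      qed
    qed
    then have "z = 0" using zR by (auto simp: Rn_iff fun_eq_iff not_less[symmetric])
    then show "x = y" by (simp add: z_def)
  qed
  have surj: "y \<in> T ` Rn n" if y: "y \<in> Rn n" for y
  proof (rule image_eqI)
    \<comment> \<open>The preimage \<open>?x\<close> represents the functional sending
      \<open>\<phi>\<close> to \<open>a \<phi> z\<close>; orthonormality makes its value at
      \<open>b i\<close> equal to \<open>y i\<close>.\<close>
    define z where "z = (\<Sum>j<n. y j *\<^sub>R b j)"
    let ?x = "\<lambda>i. if i < n then a (unit_Rn i) z else 0"
    show "?x \<in> Rn n" by (simp add: Rn_iff)
    have "inner_Rn n ?x \<phi> = a \<phi> z" if "\<phi> \<in> Rn n" for \<phi>
    proof -
      have "a \<phi> z = a (\<Sum>i<n. \<phi> i *\<^sub>R unit_Rn i) z" using Rn_eq_sum[OF that] by simp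
      also have "\<dots> = inner_Rn n ?x \<phi>" by (simp add: sum scale inner_Rn_def mult.commute)
      finally show ?thesis ..
    qed
    then have "T ?x i = y i" if "i < n" for i
    proof -
      have "T ?x i = a (b i) z" using that \<open>\<And>\<phi>. \<phi> \<in> Rn n \<Longrightarrow> inner_Rn n ?x \<phi> = a \<phi> z\<close> bR[OF that] by (simp add: T_def)
      also have "\<dots> = (\<Sum>j<n. y j * (if i = j then 1 else 0))"
        unfolding z_def sumr scaler using that by (intro sum.cong) (auto simp: b(3))
      also have "\<dots> = y i" using that by (simp add: if_distrib[where f="\<lambda>t. _ * t"] cong: if_cong)
      finally show ?thesis .
    qed
    then show "y = T ?x" using y by (auto simp: fun_eq_iff T_def Rn_iff)
  qed
  have bij: "bij_betw T (Rn n) (Rn n)"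
    using inj surj TR by (auto simp: bij_betw_def)
  have moment: "(\<integral>\<^sup>+x\<in>P. ennreal ((inner_Rn n (T x) \<theta>)\<^sup>2) \<partial>lborel_Rn n) = ennreal (inner_Rn n \<theta> \<theta>)" for \<theta>
  proof -
    define w where "w = (\<Sum>i<n. \<theta> i *\<^sub>R b i)"
    have "inner_Rn n (T x) \<theta> = inner_Rn n x w" for x
    proof -
      have "inner_Rn n (T x) \<theta> = (\<Sum>i<n. \<theta> i * inner_Rn n x (b i))"
        unfolding inner_Rn_def[of n "T x"] by (simp add: T_def mult.commute)
      then show ?thesis by (simp add: w_def inner_Rn_sum)
    qed
    then have "(\<integral>\<^sup>+x\<in>P. ennreal ((inner_Rn n (T x) \<theta>)\<^sup>2) \<partial>lborel_Rn n) = ennreal (a w w)"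
      using a_sq[of w] by simp
    also have "a w w = (\<Sum>i<n. \<theta> i * (\<Sum>j<n. \<theta> j * (if i = j then 1 else 0)))"
      unfolding w_def sum sumr scale scaler by (intro sum.cong arg_cong2[where f="(*)"] refl) (auto simp: b(3))
    also have "\<dots> = inner_Rn n \<theta> \<theta>"
      by (simp add: inner_Rn_def if_distrib[where f="\<lambda>t. _ * t"] cong: if_cong)
    finally show ?thesis .
  qed
  show thesis using that[OF lin bij] moment by blast
qed

text \<open>A dilation after the isotropizing map brings the volume to 1 and multiplies the moments
  in all directions by the same factor.\<close>

lemma symmetric_polytope_isotropic_exists:
  assumes n: "n \<ge> 1" and P: "symmetric_polytope n P"
  obtains T L where "linear T" "bij_betw T (Rn n) (Rn n)" "emeasure (lborel_Rn n) (T ` P) = 1" "L \<ge> 0"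
    "\<forall>\<theta>\<in>Rn n. nn_moment n (T ` P) \<theta> = ennreal (L\<^sup>2 * inner_Rn n \<theta> \<theta>)"
proof -
  let ?M = "lborel_Rn n"
  obtain T where T: "linear T" "bij_betw T (Rn n) (Rn n)"
    "\<forall>\<theta>\<in>Rn n. (\<integral>\<^sup>+x\<in>P. ennreal ((inner_Rn n (T x) \<theta>)\<^sup>2) \<partial>?M) = ennreal (inner_Rn n \<theta> \<theta>)"
    by (rule exists_isotropizing_map[OF P])
  obtain D where D: "P \<subseteq> box_Rn n D" "P \<subseteq> Rn n" "P \<in> sets borel"
    using symmetric_polytope_measurable[OF P] by metis
  obtain r where r: "r > 0" "box_Rn n r \<subseteq> P" by (rule symmetric_polytope_contains_box[OF P])
  have "emeasure ?M (box_Rn n r) \<le> emeasure ?M P" using D(3) by (intro emeasure_mono r) simp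
  then have "emeasure ?M P > 0" using r by (auto simp: emeasure_box_Rn intro: less_le_trans[rotated])
  moreover have "emeasure ?M P < \<infinity>" by (rule emeasure_subset_box_finite[OF D(1)])
  ultimately obtain p where p: "p > 0" "emeasure ?M P = ennreal p"
    by (cases "emeasure ?M P") auto
  obtain d where d: "d > 0" "scales_volume n T d"
    using nn_integral_linear_image[OF T(1,2)] by blast
  obtain D1 where TP[measurable]: "T ` P \<in> sets borel" using linear_image_symmetric_polytope[OF P T(1,2)] by metis
  have vol: "emeasure ?M (T ` P) = ennreal (d * p)"
  proof -
    have "emeasure ?M (T ` P) = (\<integral>\<^sup>+x\<in>T ` P. (\<lambda>_. 1) x \<partial>?M)" by simp
    also have "\<dots> = ennreal d * (\<integral>\<^sup>+x\<in>P. 1 \<partial>?M)" using d(2) TP D by (simp only: borel_measurable_const)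
    finally show ?thesis using D(3) p d(1) by (simp add: ennreal_mult)
  qed
  \<comment> \<open>\<open>d * p\<close> is the volume of the image of \<open>P\<close> under
    \<open>T\<close>, and the dilation multiplies it by \<open>s ^ n\<close>.\<close>
  define s where "s = root n (1 / (d * p))"
  have s: "s > 0" "s ^ n = 1 / (d * p)" using n d(1) p(1) by (auto simp: s_def)
  define S where "S x = s *\<^sub>R T x" for x
  have S: "linear S" unfolding S_def[abs_def] by (intro linear_compose_scale_right T)
  have Sbij: "bij_betw S (Rn n) (Rn n)"
  proof -
    have "bij_betw (\<lambda>x::nat \<Rightarrow> real. s *\<^sub>R x) (Rn n) (Rn n)"
      using s(1) by (intro bij_betw_byWitness[where f'="\<lambda>x. (1 / s) *\<^sub>R x"]) auto
    from bij_betw_trans[OF T(2) this] show ?thesis by (simp add: o_def S_def[abs_def])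
  qed
  obtain D2 where SP[measurable]: "S ` P \<in> sets borel" using linear_image_symmetric_polytope[OF P S Sbij] by metis
  have Svol: "emeasure ?M (S ` P) = 1"
  proof -
    have "emeasure ?M (S ` P) = (\<integral>\<^sup>+x. indicator (S ` P) x \<partial>?M)" by simp
    also have "\<dots> = ennreal (\<bar>s\<bar> ^ n) * (\<integral>\<^sup>+x. indicator (S ` P) (0 + s *\<^sub>R x) \<partial>?M)"
      by (rule nn_integral_lborel_Rn_affine) (use s in auto)
    also have "(\<integral>\<^sup>+x. indicator (S ` P) (0 + s *\<^sub>R x) \<partial>?M) = (\<integral>\<^sup>+x. indicator (T ` P) x \<partial>?M)"
    proof (intro nn_integral_cong)
      fix x
      have "s *\<^sub>R x \<in> S ` P \<longleftrightarrow> x \<in> T ` P" using s(1) by (auto simp: S_def)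
      then show "(indicator (S ` P) (0 + s *\<^sub>R x) :: ennreal) = indicator (T ` P) x"
        by (simp add: indicator_def)
    qed
    also have "ennreal (\<bar>s\<bar> ^ n) * (\<integral>\<^sup>+x. indicator (T ` P) x \<partial>?M) = ennreal (s ^ n * (d * p))"
      using s(1) d(1) p(1) by (simp add: vol ennreal_mult)
    also have "\<dots> = 1" using s d(1) p(1) by simp
    finally show ?thesis .
  qed
  obtain d' where d': "d' > 0" "scales_volume n S d'"
    using nn_integral_linear_image[OF S Sbij] by blast
  show thesis
  proof (rule that[OF S Sbij Svol])
    \<comment> \<open>\<open>L\<^sup>2\<close> collects the Jacobian of \<open>S\<close> and the
      square of the dilation factor.\<close>
    show "sqrt (d' * s\<^sup>2) \<ge> 0" using d' by simp
    show "\<forall>\<theta>\<in>Rn n. nn_moment n (S ` P) \<theta> = ennreal ((sqrt (d' * s\<^sup>2))\<^sup>2 * inner_Rn n \<theta> \<theta>)"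
    proof
      fix \<theta> assume \<theta>: "\<theta> \<in> Rn n"
      have "(\<lambda>x. ennreal ((inner_Rn n x \<theta>)\<^sup>2)) \<in> borel_measurable borel" by measurable
      with d'(2) SP D have "nn_moment n (S ` P) \<theta>
        = ennreal d' * (\<integral>\<^sup>+x\<in>P. ennreal ((inner_Rn n (S x) \<theta>)\<^sup>2) \<partial>?M)" by blast
      also have "(\<integral>\<^sup>+x\<in>P. ennreal ((inner_Rn n (S x) \<theta>)\<^sup>2) \<partial>?M)
        = (\<integral>\<^sup>+x\<in>P. ennreal ((inner_Rn n (T x) (s *\<^sub>R \<theta>))\<^sup>2) \<partial>?M)"
        by (simp add: S_def)
      also have "\<dots> = ennreal (s\<^sup>2 * inner_Rn n \<theta> \<theta>)"
        using T(3) \<theta> by (subst bspec[OF T(3)]) (auto simp: power2_eq_square mult.assoc)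
      also have "ennreal d' * ennreal (s\<^sup>2 * inner_Rn n \<theta> \<theta>) = ennreal ((sqrt (d' * s\<^sup>2))\<^sup>2 * inner_Rn n \<theta> \<theta>)"
        using d'(1) by (simp add: ennreal_mult[symmetric] mult.assoc)
      finally show "nn_moment n (S ` P) \<theta>
        = ennreal ((sqrt (d' * s\<^sup>2))\<^sup>2 * inner_Rn n \<theta> \<theta>)" .
    qed
  qed
qed

section \<open>Uniqueness of the isotropic constant\<close>

definition ball_Rn :: "nat \<Rightarrow> real \<Rightarrow> (nat \<Rightarrow> real) set" where
  "ball_Rn n r = {x \<in> Rn n. inner_Rn n x x \<le> r\<^sup>2}"

lemma inner_Rn_Cauchy_Schwarz: "(inner_Rn n x y)\<^sup>2 \<le> inner_Rn n x x * inner_Rn n y y"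
  using Cauchy_Schwarz_ineq_sum[of x y "{..<n}"] by (simp add: inner_Rn_def power2_eq_square)

lemma ball_Rn_borel [measurable]: "ball_Rn n r \<in> sets borel"
proof -
  have [measurable]: "(\<lambda>x. inner_Rn n x x) \<in> borel_measurable borel"
    unfolding inner_Rn_def by measurable
  have "ball_Rn n r = {x \<in> space borel. x \<in> Rn n \<and> inner_Rn n x x \<le> r\<^sup>2}"
    by (auto simp: ball_Rn_def)
  also have "\<dots> \<in> sets borel" by measurable
  finally show ?thesis .
qed

lemma emeasure_ball_Rn:
  assumes "r > 0"
  shows "emeasure (lborel_Rn n) (ball_Rn n r) = ennreal (r ^ n) * emeasure (lborel_Rn n) (ball_Rn n 1)"
proof -
  have "emeasure (lborel_Rn n) (ball_Rn n r) = (\<integral>\<^sup>+x. indicator (ball_Rn n r) x \<partial>lborel_Rn n)" by simp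
  also have "\<dots> = ennreal (\<bar>r\<bar> ^ n) * (\<integral>\<^sup>+x. indicator (ball_Rn n r) (0 + r *\<^sub>R x) \<partial>lborel_Rn n)"
    by (rule nn_integral_lborel_Rn_affine) (use assms in auto)
  also have "(\<integral>\<^sup>+x. indicator (ball_Rn n r) (0 + r *\<^sub>R x) \<partial>lborel_Rn n) = (\<integral>\<^sup>+x. indicator (ball_Rn n 1) x \<partial>lborel_Rn n)"
  proof (intro nn_integral_cong)
    fix x
    have "r *\<^sub>R x \<in> Rn n \<longleftrightarrow> x \<in> Rn n" using assms by (auto simp: Rn_iff)
    moreover have "r * (r * inner_Rn n x x) \<le> r * (r * 1) \<longleftrightarrow> inner_Rn n x x \<le> 1"
      using assms by simp
    ultimately have "r *\<^sub>R x \<in> ball_Rn n r \<longleftrightarrow> x \<in> ball_Rn n 1"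
      by (simp add: ball_Rn_def power2_eq_square)
    then show "(indicator (ball_Rn n r) (0 + r *\<^sub>R x) :: ennreal) = indicator (ball_Rn n 1) x"
      by (simp add: indicator_def)
  qed
  finally show ?thesis using assms by simp
qed

lemma emeasure_unit_ball_Rn:
  obtains \<beta> where "\<beta> > 0" "emeasure (lborel_Rn n) (ball_Rn n 1) = ennreal \<beta>"
proof -
  have "ball_Rn n 1 \<subseteq> box_Rn n 1"
  proof
    fix x assume x: "x \<in> ball_Rn n 1"
    have "\<bar>x i\<bar> \<le> 1" if "i < n" for i
    proof -
      have "x i * x i \<le> inner_Rn n x x" unfolding inner_Rn_def
        by (rule member_le_sum[of i "{..<n}" "\<lambda>i. x i * x i"]) (use that in auto)
      then have "(x i)\<^sup>2 \<le> 1" using x by (simp add: ball_Rn_def power2_eq_square)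
      then show ?thesis by (simp add: abs_square_le_1)
    qed
    then show "x \<in> box_Rn n 1" using x by (simp add: ball_Rn_def box_Rn_def)
  qed
  then have fin: "emeasure (lborel_Rn n) (ball_Rn n 1) < \<infinity>" by (rule emeasure_subset_box_finite)
  let ?r = "1 / (1 + real n)"
  have "box_Rn n ?r \<subseteq> ball_Rn n 1"
  proof
    fix x assume x: "x \<in> box_Rn n ?r"
    have "x i * x i \<le> ?r" if "i < n" for i
    proof -
      have "\<bar>x i\<bar> \<le> ?r" using x that by (simp add: box_Rn_iff)
      then have "\<bar>x i\<bar> * \<bar>x i\<bar> \<le> ?r * 1" by (intro mult_mono) (auto intro: order_trans)
      then show ?thesis by (simp add: abs_mult_self_eq)
    qed
    then have "inner_Rn n x x \<le> (\<Sum>i<n. ?r)" unfolding inner_Rn_def by (intro sum_mono) auto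
    also have "\<dots> \<le> 1" by simp
    finally show "x \<in> ball_Rn n 1" using x by (simp add: ball_Rn_def box_Rn_def)
  qed
  then have "emeasure (lborel_Rn n) (box_Rn n ?r) \<le> emeasure (lborel_Rn n) (ball_Rn n 1)"
    by (rule emeasure_mono) simp
  moreover have "emeasure (lborel_Rn n) (box_Rn n ?r) > 0"
    by (subst emeasure_box_Rn) (simp_all add: ennreal_zero_less_divide)
  ultimately have "emeasure (lborel_Rn n) (ball_Rn n 1) > 0" by (rule less_le_trans[rotated])
  with fin show thesis using that by (cases "emeasure (lborel_Rn n) (ball_Rn n 1)") auto
qed

lemma ball_Rn_radius_unique:
  assumes n: "n \<ge> 1" and r: "r > 0" "s > 0"
    and eq: "emeasure (lborel_Rn n) (ball_Rn n r) = emeasure (lborel_Rn n) (ball_Rn n s)"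
  shows "r = s"
proof -
  obtain \<beta> where \<beta>: "\<beta> > 0" "emeasure (lborel_Rn n) (ball_Rn n 1) = ennreal \<beta>"
    by (rule emeasure_unit_ball_Rn)
  have "ennreal (r ^ n * \<beta>) = ennreal (s ^ n * \<beta>)"
    using eq r \<beta>(1) unfolding emeasure_ball_Rn[OF r(1)] emeasure_ball_Rn[OF r(2)] \<beta>(2)
    by (simp add: ennreal_mult)
  then have "r ^ n * \<beta> = s ^ n * \<beta>"
    by (subst (asm) ennreal_inj) (use r \<beta>(1) in auto)
  then have "r ^ n = s ^ n" using \<beta>(1) by simp
  then show ?thesis using power_eq_imp_eq_base[of r n s] n r by simp
qed

text \<open>The Legendre ellipsoid \<open>Z\<close> of \<open>P\<close> is defined by \<open>P\<close> alone; an isotropizing map sends it to the ball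
  of radius \<open>L\<close>, so the volume of this ball is determined by \<open>P\<close>.\<close>

lemma isotropic_ball_volume:
  assumes n: "n \<ge> 1" and P: "symmetric_polytope n P" and T: "linear T" "bij_betw T (Rn n) (Rn n)"
    and vol: "emeasure (lborel_Rn n) (T ` P) = 1" and L: "L \<ge> 0"
    and iso: "\<forall>\<theta>\<in>Rn n. nn_moment n (T ` P) \<theta> = ennreal (L\<^sup>2 * inner_Rn n \<theta> \<theta>)"
    and p: "p = measure (lborel_Rn n) P"
    and Z: "Z = {z\<in>Rn n. \<forall>\<phi>\<in>Rn n. (inner_Rn n z \<phi>)\<^sup>2 \<le> 1 / p * second_moment n P \<phi>}"
  shows "L > 0" "emeasure (lborel_Rn n) (ball_Rn n L) = ennreal (1 / p) * emeasure (lborel_Rn n) Z"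
proof -
  let ?M = "lborel_Rn n"
  obtain D where D: "P \<subseteq> box_Rn n D" "P \<subseteq> Rn n" "P \<in> sets borel"
    using symmetric_polytope_measurable[OF P] by metis
  obtain r where r: "r > 0" "box_Rn n r \<subseteq> P" by (rule symmetric_polytope_contains_box[OF P])
  obtain D1 where TP: "T ` P \<in> sets borel" using linear_image_symmetric_polytope[OF P T] by metis
  obtain d where d: "d > 0" "scales_volume n T d"
    using nn_integral_linear_image[OF T] by blast
  have em: "emeasure ?M (T ` A) = ennreal d * emeasure ?M A" if "A \<in> sets borel" "T ` A \<in> sets borel" "A \<subseteq> Rn n" for A
  proof -
    have "(\<integral>\<^sup>+x\<in>T ` A. (\<lambda>_. 1) x \<partial>?M) = ennreal d * (\<integral>\<^sup>+x\<in>A. (\<lambda>_. 1) (T x) \<partial>?M)"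
      using d(2) that by (simp only: borel_measurable_const)
    then show ?thesis using that by simp
  qed
  have "emeasure ?M P < \<infinity>" by (rule emeasure_subset_box_finite[OF D(1)])
  then have pe: "emeasure ?M P = ennreal p" unfolding p by (simp add: emeasure_eq_ennreal_measure less_top)
  have "1 = ennreal (d * p)" using em[OF D(3) TP D(2)] vol pe d(1) p by (simp add: ennreal_mult)
  then have dp: "d * p = 1" by (metis ennreal_eq_1)
  then have dq: "d = 1 / p" by (metis eq_divide_eq mult_zero_right zero_neq_one)
  \<comment> \<open>The moment of the image in direction \<open>\<theta>\<close> is, up to the
    Jacobian, the moment of \<open>P\<close> in the direction \<open>\<phi>\<close> obtained from
    \<open>\<theta>\<close> by the adjoint of \<open>T\<close>.\<close>
  have rel: "L\<^sup>2 * inner_Rn n \<theta> \<theta> = d * second_moment n P \<phi>"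
    if "\<theta> \<in> Rn n" "\<forall>y\<in>Rn n. inner_Rn n (T y) \<theta> = inner_Rn n y \<phi>" for \<theta> \<phi>
  proof -
    have sm0: "second_moment n P \<phi> \<ge> 0"
      unfolding second_moment_def set_lebesgue_integral_def by (rule Bochner_Integration.integral_nonneg) simp
    have "(\<lambda>x. ennreal ((inner_Rn n x \<theta>)\<^sup>2)) \<in> borel_measurable borel" by measurable
    with d(2) TP D have "nn_moment n (T ` P) \<theta>
      = ennreal d * (\<integral>\<^sup>+x\<in>P. ennreal ((inner_Rn n (T x) \<theta>)\<^sup>2) \<partial>?M)" by blast
    also have "(\<integral>\<^sup>+x\<in>P. ennreal ((inner_Rn n (T x) \<theta>)\<^sup>2) \<partial>?M) = nn_moment n P \<phi>"
      using that(2) by (intro nn_integral_lborel_Rn_cong) simp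
    also have "\<dots> = ennreal (second_moment n P \<phi>)" by (rule second_moment_eq[OF D(3,1)])
    finally have "ennreal (L\<^sup>2 * inner_Rn n \<theta> \<theta>) = ennreal (d * second_moment n P \<phi>)"
      using iso that(1) d(1) sm0 by (simp add: ennreal_mult)
    then show ?thesis using d(1) sm0 by (subst (asm) ennreal_inj) auto
  qed
  have TR: "T x \<in> Rn n" if "x \<in> Rn n" for x
    using T(2) that bij_betw_apply by fastforce
  obtain S where S: "linear S" "\<And>x. x \<in> Rn n \<Longrightarrow> S x \<in> Rn n" "\<And>x. x \<in> Rn n \<Longrightarrow> S (T x) = x"
    using linear_inverse_Rn[OF T] by metis
  have adj: "\<exists>\<theta>\<in>Rn n. \<forall>y\<in>Rn n. inner_Rn n (T y) \<theta> = inner_Rn n y \<phi>" for \<phi>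
  proof -
    obtain \<theta> where \<theta>: "\<theta> \<in> Rn n" "\<And>y. y \<in> Rn n \<Longrightarrow> inner_Rn n (S y) \<phi> = inner_Rn n y \<theta>"
      using linear_adjoint_Rn[OF S(1)] by metis
    then have "inner_Rn n (T y) \<theta> = inner_Rn n y \<phi>" if "y \<in> Rn n" for y
      using TR[OF that] S(3)[OF that] by metis
    then show ?thesis using \<theta>(1) by blast
  qed
  \<comment> \<open>Tested in the direction obtained from \<open>T z\<close> by the adjoint,
    membership in \<open>Z\<close> says that the squared norm q of \<open>T z\<close> satisfies
    \<open>q\<^sup>2 \<le> L\<^sup>2 * q\<close>. Conversely each direction comes from some
    \<open>\<theta>\<close> by the adjoint, and Cauchy-Schwarz gives the inequality.\<close>
  have Z_iff: "z \<in> Z \<longleftrightarrow> T z \<in> ball_Rn n L" if z: "z \<in> Rn n" for z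
  proof
    assume "z \<in> Z"
    obtain \<phi> where \<phi>: "\<phi> \<in> Rn n" "\<And>y. y \<in> Rn n \<Longrightarrow> inner_Rn n (T y) (T z) = inner_Rn n y \<phi>"
      using linear_adjoint_Rn[OF T(1)] by metis
    have "(inner_Rn n (T z) (T z))\<^sup>2 = (inner_Rn n z \<phi>)\<^sup>2" using \<phi>(2)[OF z] by simp
    also have "\<dots> \<le> d * second_moment n P \<phi>" using \<open>z \<in> Z\<close> \<phi>(1) unfolding Z dq by blast
    also have "\<dots> = L\<^sup>2 * inner_Rn n (T z) (T z)" using rel[of "T z" \<phi>] TR[OF z] \<phi>(2) by simp
    finally have le: "inner_Rn n (T z) (T z) * inner_Rn n (T z) (T z) \<le> L\<^sup>2 * inner_Rn n (T z) (T z)"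
      by (simp add: power2_eq_square)
    have "inner_Rn n (T z) (T z) \<le> L\<^sup>2"
    proof (cases "inner_Rn n (T z) (T z) = 0")
      case False
      then have "inner_Rn n (T z) (T z) > 0" using inner_Rn_nonneg[of n "T z"] by linarith
      then show ?thesis using le by (simp add: mult_le_cancel_right)
    qed simp
    then show "T z \<in> ball_Rn n L" using TR[OF z] by (simp add: ball_Rn_def)
  next
    assume b: "T z \<in> ball_Rn n L"
    have "(inner_Rn n z \<phi>)\<^sup>2 \<le> 1 / p * second_moment n P \<phi>" if "\<phi> \<in> Rn n" for \<phi>
    proof -
      obtain \<theta> where \<theta>: "\<theta> \<in> Rn n" "\<forall>y\<in>Rn n. inner_Rn n (T y) \<theta> = inner_Rn n y \<phi>" using adj by blast
      have "(inner_Rn n z \<phi>)\<^sup>2 = (inner_Rn n (T z) \<theta>)\<^sup>2" using \<theta>(2) z by simp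
      also have "\<dots> \<le> inner_Rn n (T z) (T z) * inner_Rn n \<theta> \<theta>" by (rule inner_Rn_Cauchy_Schwarz)
      also have "\<dots> \<le> L\<^sup>2 * inner_Rn n \<theta> \<theta>" using b by (intro mult_right_mono) (auto simp: ball_Rn_def)
      also have "\<dots> = 1 / p * second_moment n P \<phi>" using rel[OF \<theta>] dq by simp
      finally show ?thesis .
    qed
    then show "z \<in> Z" using z unfolding Z by blast
  qed
  have Z_sub: "Z \<subseteq> Rn n" unfolding Z by blast
  have TZ: "T ` Z = ball_Rn n L"
  proof
    show "T ` Z \<subseteq> ball_Rn n L" using Z_iff Z_sub by blast
    show "ball_Rn n L \<subseteq> T ` Z"
    proof
      fix x assume x: "x \<in> ball_Rn n L"
      then have "x \<in> T ` Rn n" using bij_betw_imp_surj_on[OF T(2)] by (simp add: ball_Rn_def)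
      then obtain z where "z \<in> Rn n" "x = T z" by blast
      then show "x \<in> T ` Z" using Z_iff x by blast
    qed
  qed
  have "Z = (\<lambda>x. T (proj_Rn n x)) -` ball_Rn n L \<inter> Rn n"
    using Z_iff Z_sub by (auto simp: proj_Rn_id)
  also have "\<dots> \<in> sets borel"
    using measurable_sets[OF borel_measurable_linear_proj_Rn[OF T(1)] ball_Rn_borel] by auto
  finally have "Z \<in> sets borel" .
  then show "emeasure ?M (ball_Rn n L) = ennreal (1 / p) * emeasure ?M Z"
    using em[of Z] Z_sub by (simp add: TZ dq)
  have u: "unit_Rn 0 \<in> Rn n" "unit_Rn 0 \<noteq> (0 :: nat \<Rightarrow> real)"
    using n by (auto simp: unit_Rn_def fun_eq_iff Rn_iff)
  obtain \<theta> where \<theta>: "\<theta> \<in> Rn n" "\<forall>y\<in>Rn n. inner_Rn n (T y) \<theta> = inner_Rn n y (unit_Rn 0)" using adj by blast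
  have "second_moment n P (unit_Rn 0) > 0"
    using set_nn_integral_inner_sq_pos[OF D(3) r u] unfolding second_moment_eq[OF D(3,1)] by simp
  then have "L\<^sup>2 * inner_Rn n \<theta> \<theta> > 0" using rel[OF \<theta>] d(1) by simp
  then show "L > 0" using L by (cases "L = 0") auto
qed

text \<open>This justifies the definite description: every admissible \<open>l\<close> belongs to a
  ball whose volume is fixed by \<open>P\<close>, and for \<open>n \<ge> 1\<close> the volume
  determines the radius.\<close>

lemma isotropic_constant_witness:
  assumes n: "n \<ge> 1" and P: "symmetric_polytope n P"
  obtains T L where "linear T" "bij_betw T (Rn n) (Rn n)" "emeasure (lborel_Rn n) (T ` P) = 1"
    "L > 0" "isotropic_constant n P = L"
    "\<forall>\<theta>\<in>Rn n. nn_moment n (T ` P) \<theta> = ennreal (L\<^sup>2 * inner_Rn n \<theta> \<theta>)"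
proof -
  let ?M = "lborel_Rn n"
  let ?iso = "\<lambda>K L. \<forall>\<theta>\<in>Rn n. nn_moment n K \<theta> = ennreal (L\<^sup>2 * inner_Rn n \<theta> \<theta>)"
  obtain T L where T: "linear T" "bij_betw T (Rn n) (Rn n)" and vol: "emeasure ?M (T ` P) = 1" and L: "L \<ge> 0"
    and iso: "?iso (T ` P) L"
    by (rule symmetric_polytope_isotropic_exists[OF n P])
  have L0: "L > 0" by (rule isotropic_ball_volume(1)[OF n P T vol L iso refl refl])
  have moments: "(\<forall>\<theta>\<in>sphere_Rn n. second_moment n (S ` P) \<theta> = l\<^sup>2) \<longleftrightarrow> ?iso (S ` P) l"
    if S: "linear S" "bij_betw S (Rn n) (Rn n)" for S l
  proof -
    obtain D where "D > 0" "S ` P \<subseteq> box_Rn n D" "S ` P \<in> sets borel"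
      by (rule linear_image_symmetric_polytope[OF P S])
    then show ?thesis by (intro second_moment_const_iff)
  qed
  have "isotropic_constant n P = L"
    unfolding isotropic_constant_def
  proof (rule the_equality)
    have "isotropic_image n P (T ` P)"
      unfolding isotropic_image_def isotropic_position_def
      using T vol moments[OF T, of L] iso by (auto simp: measure_def)
    then show "0 \<le> L \<and> (\<exists>K'. isotropic_image n P K' \<and> (\<forall>\<theta>\<in>sphere_Rn n. second_moment n K' \<theta> = L\<^sup>2))"
      using L moments[OF T, of L] iso by blast
  next
    fix l assume l: "0 \<le> l \<and> (\<exists>K'. isotropic_image n P K' \<and> (\<forall>\<theta>\<in>sphere_Rn n. second_moment n K' \<theta> = l\<^sup>2))"
    then obtain S where S: "linear S" "bij_betw S (Rn n) (Rn n)" and mv: "measure ?M (S ` P) = 1"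
      and sm: "\<forall>\<theta>\<in>sphere_Rn n. second_moment n (S ` P) \<theta> = l\<^sup>2"
      unfolding isotropic_image_def by blast
    \<comment> \<open>\<open>measure\<close> is 0 where \<open>emeasure\<close> is infinite, so the
      value 1 transfers to \<open>emeasure\<close>.\<close>
    have "emeasure ?M (S ` P) = 1"
      using mv by (metis emeasure_eq_ennreal_measure ennreal_1 measure_def enn2real_top zero_neq_one)
    moreover have iso': "?iso (S ` P) l" using moments[OF S, of l] sm by blast
    ultimately have "l > 0" "emeasure ?M (ball_Rn n l) = emeasure ?M (ball_Rn n L)"
      using isotropic_ball_volume[OF n P S _ _ iso' refl refl] isotropic_ball_volume[OF n P T vol L iso refl refl] l
      by simp_all
    then show "l = L" using ball_Rn_radius_unique[OF n _ L0] by blast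
  qed
  then show thesis using that[OF T vol L0] iso by blast
qed

section \<open>Few facets\<close>

text \<open>\<open>w\<close> is the inverse transpose of \<open>T\<close> applied to
  \<open>u\<close>; it turns the slabs of \<open>P\<close> into slabs of the image.\<close>

lemma linear_pullback_functional:
  fixes T :: "(nat \<Rightarrow> real) \<Rightarrow> nat \<Rightarrow> real"
  assumes T: "linear T" "bij_betw T (Rn n) (Rn n)"
  shows "\<exists>w\<in>Rn n. \<forall>y\<in>Rn n. inner_Rn n w (T y) = inner_Rn n u y"
proof -
  have TR: "T x \<in> Rn n" if "x \<in> Rn n" for x
    using T(2) that bij_betw_apply by fastforce
  obtain S where S: "linear S" "\<And>x. x \<in> Rn n \<Longrightarrow> S (T x) = x"
    using linear_inverse_Rn[OF T] by metis
  obtain w where w: "w \<in> Rn n" "\<And>y. y \<in> Rn n \<Longrightarrow> inner_Rn n (S y) u = inner_Rn n y w"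
    using linear_adjoint_Rn[OF S(1)] by metis
  have "inner_Rn n w (T y) = inner_Rn n u y" if "y \<in> Rn n" for y
    using w(2)[OF TR[OF that]] S(2)[OF that] by (simp add: inner_Rn_commute)
  then show ?thesis using w(1) by blast
qed

lemma isotropic_constant_facets:
  assumes n: "n \<ge> 1" and P: "symmetric_polytope n P" and m: "card (facets n P) = 2 * m"
  shows "isotropic_constant n P \<le> 3 * sqrt (ln (1 + real m))"
proof -
  let ?M = "lborel_Rn n"
  obtain T L where T: "linear T" "bij_betw T (Rn n) (Rn n)" and vol: "emeasure ?M (T ` P) = 1"
    and L: "L > 0" "isotropic_constant n P = L"
    and iso: "\<forall>\<theta>\<in>Rn n. nn_moment n (T ` P) \<theta> = ennreal (L\<^sup>2 * inner_Rn n \<theta> \<theta>)"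
    by (rule isotropic_constant_witness[OF n P])
  obtain U where U: "finite U" "U \<noteq> {}" "card U \<le> card (facets n P)" "U \<subseteq> Rn n"
    "P = {x\<in>Rn n. \<forall>u\<in>U. inner_Rn n u x \<le> 1}"
    by (rule symmetric_polytope_facet_description[OF n P])
  have PR: "P \<subseteq> Rn n" and sym: "P = uminus ` P" using P by (auto simp: symmetric_polytope_def)
  have TP[measurable]: "T ` P \<in> sets borel" using linear_image_symmetric_polytope[OF P T] by metis
  have "\<forall>u\<in>U. \<exists>w. w \<in> Rn n \<and> (\<forall>y\<in>Rn n. inner_Rn n w (T y) = inner_Rn n u y)"
    using linear_pullback_functional[OF T] by blast
  then have "\<exists>w. \<forall>u\<in>U. w u \<in> Rn n \<and> (\<forall>y\<in>Rn n. inner_Rn n (w u) (T y) = inner_Rn n u y)"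
    by (rule bchoice)
  then obtain w where w: "\<forall>u\<in>U. w u \<in> Rn n \<and> (\<forall>y\<in>Rn n. inner_Rn n (w u) (T y) = inner_Rn n u y)" ..
  have m1: "m \<ge> 1"
  proof -
    have "card U > 0" using U(1,2) by (simp add: card_gt_0_iff)
    then show ?thesis using U(3) m by linarith
  qed
  \<comment> \<open>Symmetry bounds the functional by 1 in absolute value on a body of volume 1, and
    isotropy evaluates its mean square.\<close>
  have w_small: "L\<^sup>2 * inner_Rn n (w u) (w u) \<le> 1" if u: "u \<in> U" for u
  proof -
    have "(inner_Rn n x (w u))\<^sup>2 \<le> 1" if "x \<in> T ` P" for x
    proof -
      obtain y where y: "y \<in> P" "x = T y" using \<open>x \<in> T ` P\<close> by blast
      have "- y \<in> P" using y(1) sym by blast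
      then have "inner_Rn n u (- y) \<le> 1" "inner_Rn n u y \<le> 1" using y(1) U(5) u by blast+
      moreover have "inner_Rn n x (w u) = inner_Rn n u y"
        using w u y PR by (metis inner_Rn_commute subsetD)
      ultimately have "\<bar>inner_Rn n x (w u)\<bar> \<le> 1" by simp
      then show ?thesis by (simp add: abs_square_le_1)
    qed
    then have "nn_moment n (T ` P) (w u) \<le> (\<integral>\<^sup>+x\<in>T ` P. 1 \<partial>?M)"
      by (intro nn_integral_mono) (auto simp: indicator_def)
    also have "\<dots> = 1" using vol by simp
    finally have "ennreal (L\<^sup>2 * inner_Rn n (w u) (w u)) \<le> 1" using iso w u by simp
    then show ?thesis by simp
  qed
  \<comment> \<open>Each functional will contribute at most
    \<open>exp (- (t / 2)) = 1 / (4 * real m)\<close>; there are at most \<open>2 * m\<close> of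
    them, for a total of 1/2.\<close>
  define t where "t = 2 * ln (4 * real m)"
  have t: "t > 0" using m1 by (simp add: t_def)
  define \<sigma> where "\<sigma> = L / sqrt t"
  have \<sigma>: "\<sigma> > 0" using L t by (simp add: \<sigma>_def)
  \<comment> \<open>Chernoff weights: outside the image some functional exceeds 1 and its term is at
    least 1. For the largest admissible norm of \<open>w u\<close>, the tilt \<open>t\<close>
    minimises the Gaussian integral.\<close>
  define \<Phi> where "\<Phi> x = (\<Sum>u\<in>U. ennreal (exp (inner_Rn n (t *\<^sub>R w u) x - t)))" for x
  have "\<sigma> \<le> 1"
  proof (rule gauss_sigma_le_1[OF \<sigma> n TP])
    show "emeasure ?M (T ` P) \<le> 1" using vol by simp
    show "\<Phi> \<in> borel_measurable borel" unfolding \<Phi>_def[abs_def] by measurable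
    show "1 \<le> \<Phi> x" if x: "x \<in> Rn n" "x \<notin> T ` P" for x
    proof -
      obtain y where y: "y \<in> Rn n" "x = T y"
        using x(1) bij_betw_imp_surj_on[OF T(2)] by (metis imageE)
      then have "y \<notin> P" using x(2) by blast
      then obtain u where u: "u \<in> U" "inner_Rn n u y > 1" using U(5) y(1) by force
      then have "inner_Rn n (w u) x > 1" using w y by simp
      then have "t * 1 \<le> t * inner_Rn n (w u) x" using t by (intro mult_left_mono) auto
      then have "ennreal 1 \<le> ennreal (exp (inner_Rn n (t *\<^sub>R w u) x - t))"
        by (intro ennreal_leI) simp
      also have "\<dots> \<le> \<Phi> x" unfolding \<Phi>_def by (rule member_le_sum[OF u(1) _ U(1)]) simp
      finally show ?thesis by simp
    qed
    have one: "(\<integral>\<^sup>+x. ennreal (exp (inner_Rn n (t *\<^sub>R w u) x - t)) * ennreal (gauss_Rn n \<sigma> x) \<partial>?M) \<le> ennreal (1 / (4 * real m))"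
      if u: "u \<in> U" for u
    proof -
      have "(\<integral>\<^sup>+x. ennreal (exp (inner_Rn n (t *\<^sub>R w u) x - t)) * ennreal (gauss_Rn n \<sigma> x) \<partial>?M)
        = (\<integral>\<^sup>+x. ennreal (exp (- t)) * ennreal (exp (inner_Rn n (t *\<^sub>R w u) x) * gauss_Rn n \<sigma> x) \<partial>?M)"
        by (intro nn_integral_cong) (simp add: ennreal_mult[symmetric] exp_diff exp_minus field_simps del: inner_Rn_simps)
      also have "\<dots> = ennreal (exp (- t)) * ennreal (exp (\<sigma>\<^sup>2 * inner_Rn n (t *\<^sub>R w u) (t *\<^sub>R w u) / 2))"
        by (subst nn_integral_cmult) (simp_all add: nn_integral_gauss_exp[OF \<sigma>] del: inner_Rn_simps)
      also have "\<dots> = ennreal (exp (- t + \<sigma>\<^sup>2 * inner_Rn n (t *\<^sub>R w u) (t *\<^sub>R w u) / 2))"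
        by (simp only: exp_add ennreal_mult''[OF exp_ge_zero])
      also have "\<dots> \<le> ennreal (exp (- (t / 2)))"
      proof -
        have "\<sigma>\<^sup>2 * t = L\<^sup>2" using t by (simp add: \<sigma>_def power_divide)
        then have "\<sigma>\<^sup>2 * inner_Rn n (t *\<^sub>R w u) (t *\<^sub>R w u) = t * (L\<^sup>2 * inner_Rn n (w u) (w u))"
          by (simp add: algebra_simps)
        also have "\<dots> \<le> t" using w_small[OF u] t by (simp add: mult_left_le)
        finally show ?thesis by (intro ennreal_leI) simp
      qed
      also have "exp (- (t / 2)) = 1 / (4 * real m)"
        using m1 by (simp add: t_def exp_minus inverse_eq_divide)
      finally show ?thesis .
    qed
    have "(\<integral>\<^sup>+x. \<Phi> x * ennreal (gauss_Rn n \<sigma> x) \<partial>?M)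
      = (\<Sum>u\<in>U. \<integral>\<^sup>+x. ennreal (exp (inner_Rn n (t *\<^sub>R w u) x - t)) * ennreal (gauss_Rn n \<sigma> x) \<partial>?M)"
      unfolding \<Phi>_def sum_distrib_right by (rule nn_integral_sum) measurable
    also have "\<dots> \<le> (\<Sum>u\<in>U. ennreal (1 / (4 * real m)))" by (intro sum_mono one)
    also have "\<dots> = ennreal (real (card U) * (1 / (4 * real m)))"
      unfolding sum_constant ennreal_of_nat_eq_real_of_nat by (rule ennreal_mult[symmetric]) auto
    also have "\<dots> \<le> ennreal (1 / 2)"
    proof (rule ennreal_leI)
      have "real (card U) * (1 / (4 * real m)) \<le> (2 * real m) * (1 / (4 * real m))"
        using U(3) m by (intro mult_right_mono) auto
      then show "real (card U) * (1 / (4 * real m)) \<le> 1 / 2" using m1 by simp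
    qed
    finally show "(\<integral>\<^sup>+x. \<Phi> x * ennreal (gauss_Rn n \<sigma> x) \<partial>?M) \<le> ennreal (1 / 2)" .
  qed
  then have "L \<le> sqrt t" using t by (simp add: \<sigma>_def divide_le_eq)
  also have "\<dots> \<le> sqrt (9 * ln (1 + real m))"
  proof (rule real_sqrt_le_mono)
    \<comment> \<open>The cube gives \<open>t \<le> 6 * ln (1 + real m)\<close>, and 9 is taken in
      place of 6 to have an integer square root.\<close>
    have "4 * real m \<le> (1 + real m) ^ 2"
      using zero_le_power2[of "1 - real m"] by (simp add: power2_eq_square algebra_simps)
    also have "\<dots> \<le> (1 + real m) ^ 3" by (rule power_increasing) auto
    finally have "ln (4 * real m) \<le> ln ((1 + real m) ^ 3)" using m1 by (subst ln_le_cancel_iff) auto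
    also have "\<dots> = 3 * ln (1 + real m)" by (subst ln_realpow) auto
    finally show "t \<le> 9 * ln (1 + real m)" using ln_ge_zero[of "1 + real m"] unfolding t_def by linarith
  qed
  also have "\<dots> = 3 * sqrt (ln (1 + real m))" by (simp add: real_sqrt_mult)
  finally show ?thesis using L(2) by simp
qed

section \<open>Few vertices\<close>

text \<open>Signs are absorbed by the symmetry of \<open>K\<close>, and the missing weight is given
  to 0.\<close>

lemma absolutely_convex_combination:
  fixes K :: "'a::real_vector set"
  assumes W: "finite W" "W \<subseteq> K" and K: "convex K" "\<And>x. x \<in> K \<Longrightarrow> - x \<in> K" "0 \<in> K"
    and c: "(\<Sum>v\<in>W. \<bar>c v\<bar>) \<le> 1"
  shows "(\<Sum>v\<in>W. c v *\<^sub>R v) \<in> K"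
proof (cases "(\<Sum>v\<in>W. \<bar>c v\<bar>) = 0")
  case True
  then have "\<forall>v\<in>W. c v = 0" using W(1) by (simp add: sum_nonneg_eq_0_iff)
  then show ?thesis using K(3) by simp
next
  case False
  define s where "s = (\<Sum>v\<in>W. \<bar>c v\<bar>)"
  have s: "s > 0" using False sum_nonneg[of W "\<lambda>v. \<bar>c v\<bar>"] unfolding s_def by linarith
  have "(\<Sum>v\<in>W. (\<bar>c v\<bar> / s) *\<^sub>R (sgn (c v) *\<^sub>R v)) \<in> K"
  proof (rule convex_sum[OF W(1) K(1)])
    show "(\<Sum>v\<in>W. \<bar>c v\<bar> / s) = 1" using s by (simp add: s_def sum_divide_distrib[symmetric])
    show "0 \<le> \<bar>c v\<bar> / s" for v using s by simp
    show "sgn (c v) *\<^sub>R v \<in> K" if "v \<in> W" for v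
      using that W(2) K by (cases "c v" "0::real" rule: linorder_cases) auto
  qed
  then have "s *\<^sub>R (\<Sum>v\<in>W. (\<bar>c v\<bar> / s) *\<^sub>R (sgn (c v) *\<^sub>R v)) + (1 - s) *\<^sub>R 0 \<in> K"
    using s c K(3) by (intro convexD[OF K(1)]) (auto simp: s_def)
  moreover have "s *\<^sub>R (\<Sum>v\<in>W. (\<bar>c v\<bar> / s) *\<^sub>R (sgn (c v) *\<^sub>R v)) = (\<Sum>v\<in>W. c v *\<^sub>R v)"
    unfolding scaleR_sum_right using s by (intro sum.cong) (auto simp: abs_mult_sgn)
  ultimately show ?thesis by simp
qed

text \<open>Barycentric coordinates need not be measurable, but approximate ones can be chosen constant on
  the cells of a fine grid.\<close>

lemma measurable_approximate_barycentric:
  assumes W: "finite W" and \<delta>: "\<delta> > 0"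
  shows "\<exists>\<kappa> :: (nat \<Rightarrow> real) \<Rightarrow> (nat \<Rightarrow> real) \<Rightarrow> real. (\<forall>v. \<kappa> v \<in> borel_measurable borel) \<and>
    (\<forall>x\<in>convex hull W. (\<forall>v\<in>W. 0 \<le> \<kappa> v x) \<and> (\<Sum>v\<in>W. \<kappa> v x) = 1 \<and>
      (\<forall>j<n. \<bar>x j - (\<Sum>v\<in>W. \<kappa> v x * v j)\<bar> \<le> \<delta>))"
proof -
  define cell where "cell x = map (\<lambda>j. \<lfloor>x j / \<delta>\<rfloor>) [0..<n]" for x :: "nat \<Rightarrow> real"
  define good where "good c \<mu> \<longleftrightarrow> (\<forall>v\<in>W. 0 \<le> \<mu> v) \<and> sum \<mu> W = 1 \<and> cell (\<Sum>v\<in>W. \<mu> v *\<^sub>R v) = c"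
    for c and \<mu> :: "(nat \<Rightarrow> real) \<Rightarrow> real"
  \<comment> \<open>One choice per cell: there are countably many cells, so any choice composed with
    \<open>cell\<close> is measurable. The chosen combination lies in the same cell of side
    \<open>\<delta>\<close> as the point, which bounds the error.\<close>
  define \<mu> where "\<mu> c = (SOME \<mu>. good c \<mu>)" for c
  have good: "good (cell x) (\<mu> (cell x))" if "x \<in> convex hull W" for x
  proof -
    have "\<exists>\<nu>. good (cell x) \<nu>" using that unfolding convex_hull_finite[OF W] good_def by blast
    then show ?thesis unfolding \<mu>_def by (rule someI_ex)
  qed
  have cell_iff: "cell x = c \<longleftrightarrow>
      length c = n \<and> (\<forall>j. j < n \<longrightarrow> real_of_int (c ! j) \<le> x j / \<delta> \<and> x j / \<delta> < real_of_int (c ! j) + 1)" for x c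
    unfolding cell_def list_eq_iff_nth_eq floor_eq_iff[symmetric] by (rule iffI) simp_all
  have cell_m: "cell \<in> borel \<rightarrow>\<^sub>M count_space UNIV"
  proof (subst measurable_count_space_eq_countable)
    have "cell -` {c} \<inter> space borel \<in> sets borel" for c
    proof -
      have "cell -` {c} \<inter> space borel = {x \<in> space borel. length c = n \<and>
          (\<forall>j. j < n \<longrightarrow> real_of_int (c ! j) \<le> x j / \<delta> \<and> x j / \<delta> < real_of_int (c ! j) + 1)}"
        using cell_iff by blast
      also have "\<dots> \<in> sets borel" by measurable
      finally show ?thesis .
    qed
    then show "cell \<in> space borel \<rightarrow> UNIV \<and> (\<forall>c\<in>UNIV. cell -` {c} \<inter> space borel \<in> sets borel)" by blast
  qed simp
  define \<Lambda> where "\<Lambda> v x = \<mu> (cell x) v" for v x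
  show ?thesis
  proof (intro exI[of _ \<Lambda>] conjI allI ballI impI)
    show "\<Lambda> v \<in> borel_measurable borel" for v
      unfolding \<Lambda>_def[abs_def] by (rule measurable_compose[OF cell_m]) simp
    fix x assume x: "x \<in> convex hull W"
    note g = good[OF x, unfolded good_def]
    show "0 \<le> \<Lambda> v x" if "v \<in> W" for v using g that by (simp add: \<Lambda>_def)
    show "(\<Sum>v\<in>W. \<Lambda> v x) = 1" using g by (simp add: \<Lambda>_def)
    fix j assume j: "j < n"
    define y where "y = (\<Sum>v\<in>W. \<mu> (cell x) v *\<^sub>R v) j"
    have "cell (\<Sum>v\<in>W. \<mu> (cell x) v *\<^sub>R v) ! j = cell x ! j" using g by simp
    then have "\<lfloor>y / \<delta>\<rfloor> = \<lfloor>x j / \<delta>\<rfloor>" using j unfolding y_def by (simp add: cell_def)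
    then have "\<bar>x j / \<delta> - y / \<delta>\<bar> \<le> 1" by linarith
    then have "\<bar>x j - y\<bar> \<le> \<delta>" using \<delta> by (simp add: diff_divide_distrib[symmetric] divide_le_eq)
    then show "\<bar>x j - (\<Sum>v\<in>W. \<Lambda> v x * v j)\<bar> \<le> \<delta>" by (simp add: y_def \<Lambda>_def sum_fun_apply)
  qed
qed

text \<open>The identity is written as \<open>x = L\<^sup>-\<^sup>2 \<Sum> \<langle>u v, x\<rangle> v\<close> up to a small error, with
  \<open>u v = \<integral>\<^bsub>K\<^esub> \<Lambda> v y \<cdot> y dy\<close>. The exponential moments bound \<open>\<Sum> |u v|\<close>, and a Gaussian vector \<open>x\<close> with
  small enough variance then lies in \<open>K\<close> with probability at least \<open>1/2\<close>.\<close>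

lemma isotropic_convex_hull_bound:
  assumes n: "n \<ge> 1" and W: "finite W" "W \<noteq> {}" "real (card W) \<le> N" and K_def: "K = convex hull W"
    and K[measurable]: "K \<in> sets borel" and box: "K \<subseteq> box_Rn n D" "D > 0" "r > 0" "box_Rn n r \<subseteq> K"
    and sym: "\<And>x. x \<in> K \<Longrightarrow> - x \<in> K" and vol: "emeasure (lborel_Rn n) K = 1" and L: "L > 0"
    and iso: "\<forall>\<theta>\<in>Rn n. nn_moment n K \<theta> = ennreal (L\<^sup>2 * inner_Rn n \<theta> \<theta>)"
  shows "L \<le> 192 * (ln N + 4)"
proof -
  let ?M = "lborel_Rn n"
  have conv: "convex K" by (simp add: K_def)
  have WK: "W \<subseteq> K" by (simp add: K_def hull_subset)
  have KR: "K \<subseteq> Rn n" using box(1) by (auto simp: box_Rn_def)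
  have K0: "0 \<in> K" using box by (auto simp: box_Rn_iff subset_iff)
  have N1: "N \<ge> 1"
  proof -
    have "card W \<ge> 1" using W(1,2) by (simp add: Suc_le_eq card_gt_0_iff)
    then show ?thesis using W(3) by linarith
  qed
  \<comment> \<open>Makes the bound
    \<open>2 / L\<^sup>2 * (4 * \<sigma> * (6 * L * (ln N + 4)))\<close> for the expectation of
    \<open>A\<close> below equal to 1/4.\<close>
  define \<sigma> where "\<sigma> = L\<^sup>2 / (32 * (6 * L * (ln N + 4)))"
  have lnN: "ln N \<ge> 0" using N1 by simp
  then have pos: "6 * L * (ln N + 4) > 0" using L by simp
  have \<sigma>: "\<sigma> > 0" unfolding \<sigma>_def using pos L by simp
  \<comment> \<open>The grid is so fine that the bound for the expectation of the error term
    \<open>B\<close> also equals 1/4.\<close>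
  define \<delta> where "\<delta> = r * L\<^sup>2 / (32 * D * \<sigma> * real n)"
  have \<delta>: "\<delta> > 0" using box L \<sigma> n by (simp add: \<delta>_def)
  obtain \<Lambda> where \<Lambda>_m: "\<forall>v. \<Lambda> v \<in> borel_measurable borel"
    and \<Lambda>: "\<forall>x\<in>K. (\<forall>v\<in>W. 0 \<le> \<Lambda> v x) \<and> (\<Sum>v\<in>W. \<Lambda> v x) = 1 \<and> (\<forall>j<n. \<bar>x j - (\<Sum>v\<in>W. \<Lambda> v x * v j)\<bar> \<le> \<delta>)"
    using measurable_approximate_barycentric[OF W(1) \<delta>, of n] unfolding K_def by blast
  have [measurable]: "\<Lambda> v \<in> borel_measurable borel" for v using \<Lambda>_m by blast
  have \<Lambda>1: "0 \<le> \<Lambda> v x" "\<Lambda> v x \<le> 1" if "x \<in> K" "v \<in> W" for v x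
    using \<Lambda> that member_le_sum[of v W "\<lambda>v. \<Lambda> v x"] W(1) by auto
  define Q where "Q = restrict_space ?M K"
  have space_Q: "space Q = K" by (simp add: Q_def space_restrict_space)
  have Q_m: "f \<in> borel_measurable Q" if "f \<in> borel_measurable borel" for f :: "(nat \<Rightarrow> real) \<Rightarrow> real"
    unfolding Q_def using that by (intro measurable_restrict_space1) simp
  have nn_Q: "(\<integral>\<^sup>+x. f x \<partial>Q) = (\<integral>\<^sup>+x\<in>K. f x \<partial>?M)" for f
    unfolding Q_def by (rule nn_integral_restrict_space) simp
  interpret Q: prob_space Q
    by (rule prob_spaceI) (simp add: space_Q, simp add: Q_def emeasure_restrict_space vol)
  have bd: "integrable Q f" if "f \<in> borel_measurable borel" "\<And>x. x \<in> K \<Longrightarrow> \<bar>f x\<bar> \<le> B" for f and B :: real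
    using that by (intro Q.integrable_const_bound[of _ B] Q_m) (auto intro!: AE_I2 simp: space_Q)
  let ?E = "integral\<^sup>L Q"
  have int_in: "integrable Q (\<lambda>x. inner_Rn n x \<theta> * inner_Rn n x \<phi>)" for \<theta> \<phi>
  proof (rule bd)
    show "\<bar>inner_Rn n x \<theta> * inner_Rn n x \<phi>\<bar> \<le> (\<Sum>i<n. D * \<bar>\<theta> i\<bar>) * (\<Sum>i<n. D * \<bar>\<phi> i\<bar>)" if "x \<in> K" for x
      unfolding abs_mult using that box(1)
      by (intro mult_mono abs_inner_Rn_le_box) (auto intro: order_trans[OF abs_ge_zero abs_inner_Rn_le_box])
  qed measurable
  have int_lam: "integrable Q (\<lambda>x. \<Lambda> v x * inner_Rn n x \<theta>)" if "v \<in> W" for v \<theta>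
  proof (rule bd)
    show "\<bar>\<Lambda> v x * inner_Rn n x \<theta>\<bar> \<le> 1 * (\<Sum>i<n. D * \<bar>\<theta> i\<bar>)" if "x \<in> K" for x
      unfolding abs_mult using that box(1) \<Lambda>1[OF that \<open>v \<in> W\<close>]
      by (intro mult_mono abs_inner_Rn_le_box) auto
  qed measurable
  have E_sq: "?E (\<lambda>x. (inner_Rn n x \<theta>)\<^sup>2) = L\<^sup>2 * inner_Rn n \<theta> \<theta>" if "\<theta> \<in> Rn n" for \<theta>
  proof -
    have "ennreal (?E (\<lambda>x. (inner_Rn n x \<theta>)\<^sup>2)) = (\<integral>\<^sup>+x. ennreal ((inner_Rn n x \<theta>)\<^sup>2) \<partial>Q)"
      using int_in[of \<theta> \<theta>] by (intro nn_integral_eq_integral[symmetric]) (simp_all add: power2_eq_square)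
    also have "\<dots> = ennreal (L\<^sup>2 * inner_Rn n \<theta> \<theta>)" unfolding nn_Q using iso that by blast
    finally show ?thesis by (subst (asm) ennreal_inj) simp_all
  qed
  \<comment> \<open>Polarisation, by expanding the moment in direction
    \<open>\<theta> + \<phi>\<close>. With a unit vector in one slot this is the formula that
    reproduces the coordinates of a vector.\<close>
  have E_pol: "?E (\<lambda>x. inner_Rn n x \<theta> * inner_Rn n x \<phi>) = L\<^sup>2 * inner_Rn n \<theta> \<phi>" if "\<theta> \<in> Rn n" "\<phi> \<in> Rn n" for \<theta> \<phi>
  proof -
    have "?E (\<lambda>x. (inner_Rn n x (\<theta> + \<phi>))\<^sup>2) = ?E (\<lambda>x. inner_Rn n x \<theta> * inner_Rn n x \<theta>
        + (2 * (inner_Rn n x \<theta> * inner_Rn n x \<phi>) + inner_Rn n x \<phi> * inner_Rn n x \<phi>))"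
      by (intro Bochner_Integration.integral_cong refl) (simp add: power2_eq_square algebra_simps)
    also have "\<dots> = L\<^sup>2 * inner_Rn n \<theta> \<theta> + (2 * ?E (\<lambda>x. inner_Rn n x \<theta> * inner_Rn n x \<phi>) + L\<^sup>2 * inner_Rn n \<phi> \<phi>)"
      using int_in E_sq[OF that(1)] E_sq[OF that(2)] by (simp add: power2_eq_square)
    finally have "L\<^sup>2 * inner_Rn n (\<theta> + \<phi>) (\<theta> + \<phi>)
      = L\<^sup>2 * inner_Rn n \<theta> \<theta> + (2 * ?E (\<lambda>x. inner_Rn n x \<theta> * inner_Rn n x \<phi>) + L\<^sup>2 * inner_Rn n \<phi> \<phi>)"
      using E_sq[of "\<theta> + \<phi>"] Rn_add[OF that] by simp
    moreover have "inner_Rn n \<phi> \<theta> = inner_Rn n \<theta> \<phi>" by (rule inner_Rn_commute)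
    ultimately show ?thesis by (simp add: algebra_simps)
  qed
  define u where "u v = (\<lambda>j. if j < n then ?E (\<lambda>x. \<Lambda> v x * x j) else 0)" for v
  have uR: "u v \<in> Rn n" for v by (simp add: u_def Rn_iff)
  have u_in: "inner_Rn n (u v) z = ?E (\<lambda>x. \<Lambda> v x * inner_Rn n x z)" if "v \<in> W" for v z
  proof -
    have "integrable Q (\<lambda>x. \<Lambda> v x * x j)" if "j < n" for j
      using int_lam[OF \<open>v \<in> W\<close>, of "unit_Rn j"] that by simp
    then have "(\<Sum>j<n. ?E (\<lambda>x. \<Lambda> v x * x j * z j)) = ?E (\<lambda>x. \<Sum>j<n. \<Lambda> v x * x j * z j)"
      by (intro Bochner_Integration.integral_sum[symmetric]) simp
    also have "\<dots> = ?E (\<lambda>x. \<Lambda> v x * inner_Rn n x z)"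
      by (intro Bochner_Integration.integral_cong refl) (simp add: inner_Rn_def sum_distrib_left mult.assoc)
    also have "(\<Sum>j<n. ?E (\<lambda>x. \<Lambda> v x * x j * z j)) = inner_Rn n (u v) z"
      by (simp add: inner_Rn_def u_def)
    finally show ?thesis .
  qed
  have exp_mom: "?E (\<lambda>x. exp (inner_Rn n x \<theta> / (6 * L))) \<le> 4" "integrable Q (\<lambda>x. exp (inner_Rn n x \<theta> / (6 * L)))"
    if \<theta>: "\<theta> \<in> Rn n" "inner_Rn n \<theta> \<theta> = 1" for \<theta>
  proof -
    have flip: "(\<lambda>x. inner_Rn n \<theta> x) = (\<lambda>x. inner_Rn n x \<theta>)"
      by (rule ext) (rule inner_Rn_commute)
    have "(\<integral>\<^sup>+x\<in>K. ennreal ((inner_Rn n \<theta> x)\<^sup>2) \<partial>?M) = ennreal (L\<^sup>2 * inner_Rn n \<theta> \<theta>)"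
    proof -
      have "(\<integral>\<^sup>+x\<in>K. ennreal ((inner_Rn n \<theta> x)\<^sup>2) \<partial>?M) = nn_moment n K \<theta>"
        by (rule nn_integral_cong) (subst fun_cong[OF flip], rule refl)
      then show ?thesis using iso \<theta>(1) by (metis (no_types))
    qed
    then have "(\<integral>\<^sup>+x\<in>K. ennreal ((inner_Rn n \<theta> x)\<^sup>2) \<partial>?M) \<le> ennreal (L\<^sup>2)"
      using \<theta>(2) by simp
    note var = this
    have mom: "(\<integral>\<^sup>+x\<in>K. ennreal (exp (inner_Rn n \<theta> x / (6 * L))) \<partial>?M) \<le> 4"
      by (rule symmetric_convex_exp_moment[OF K conv _ vol L var]) (rule sym)
    have "(\<integral>\<^sup>+x\<in>K. ennreal (exp (inner_Rn n \<theta> x / (6 * L))) \<partial>?M)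
      = (\<integral>\<^sup>+x\<in>K. ennreal (exp (inner_Rn n x \<theta> / (6 * L))) \<partial>?M)"
      by (rule nn_integral_cong) (subst fun_cong[OF flip], rule refl)
    then have le: "(\<integral>\<^sup>+x. ennreal (exp (inner_Rn n x \<theta> / (6 * L))) \<partial>Q) \<le> ennreal 4"
      unfolding nn_Q using mom by simp
    show int: "integrable Q (\<lambda>x. exp (inner_Rn n x \<theta> / (6 * L)))"
    proof (rule bd)
      show "\<bar>exp (inner_Rn n x \<theta> / (6 * L))\<bar> \<le> exp ((\<Sum>i<n. D * \<bar>\<theta> i\<bar>) / (6 * L))" if "x \<in> K" for x
        using abs_inner_Rn_le_box[of x n D \<theta>] that box(1) L by (auto simp: divide_right_mono)
    qed measurable
    have "ennreal (?E (\<lambda>x. exp (inner_Rn n x \<theta> / (6 * L)))) \<le> ennreal 4"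
      using le by (subst nn_integral_eq_integral[symmetric]) (use int in auto)
    then show "?E (\<lambda>x. exp (inner_Rn n x \<theta> / (6 * L))) \<le> 4" by (subst (asm) ennreal_le_iff) simp_all
  qed
  have int_L: "integrable Q (\<Lambda> v)" if "v \<in> W" for v
    by (rule bd[of _ 1]) (use \<Lambda>1 that in auto)
  let ?a = "6 * L"
  \<comment> \<open>\<open>u v\<close> is tested against its own direction. From
    \<open>1 + s \<le> exp s\<close> at \<open>s = y / ?a - ln N\<close> follows
    \<open>y \<le> ?a * ln N + ?a / N * exp (y / ?a)\<close>; the first term keeps the weight
    \<open>\<Lambda> v\<close>, in the second it is bounded by 1 and the exponential moment by
    4.\<close>
  have u_norm: "sqrt (inner_Rn n (u v) (u v)) \<le> ?a * ln N * ?E (\<Lambda> v) + 4 * ?a / N" if v: "v \<in> W" for v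
  proof (cases "u v = 0")
    case True
    have "?E (\<Lambda> v) \<ge> 0" using \<Lambda>1 v by (intro Bochner_Integration.integral_nonneg) (simp add: space_Q)
    then have "0 \<le> ?a * ln N * ?E (\<Lambda> v) + 4 * ?a / N" using L lnN N1 by (intro add_nonneg_nonneg mult_nonneg_nonneg) auto
    then show ?thesis using True by simp
  next
    case False
    define s where "s = sqrt (inner_Rn n (u v) (u v))"
    have s: "s > 0" "s * s = inner_Rn n (u v) (u v)" using inner_Rn_pos[OF uR False] by (auto simp: s_def)
    define \<theta> where "\<theta> = (1 / s) *\<^sub>R u v"
    have \<theta>: "\<theta> \<in> Rn n" "inner_Rn n \<theta> \<theta> = 1" using uR s by (auto simp: \<theta>_def field_simps)
    have "s = inner_Rn n (u v) \<theta>" using s by (simp add: \<theta>_def field_simps)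
    also have "\<dots> = ?E (\<lambda>x. \<Lambda> v x * inner_Rn n x \<theta>)" by (rule u_in[OF v])
    also have "\<dots> \<le> ?E (\<lambda>x. ?a * ln N * \<Lambda> v x + ?a / N * exp (inner_Rn n x \<theta> / ?a))"
    proof (rule integral_mono)
      show "integrable Q (\<lambda>x. \<Lambda> v x * inner_Rn n x \<theta>)" by (rule int_lam[OF v])
      show "integrable Q (\<lambda>x. ?a * ln N * \<Lambda> v x + ?a / N * exp (inner_Rn n x \<theta> / ?a))"
        by (intro Bochner_Integration.integrable_add integrable_mult_right int_L v exp_mom(2) \<theta>)
      fix x assume "x \<in> space Q"
      then have x: "x \<in> K" by (simp add: space_Q)
      define y where "y = inner_Rn n x \<theta>"
      have "exp (y / ?a - ln N) = exp (y / ?a) / N" using N1 by (simp add: exp_diff)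
      moreover have "1 + (y / ?a - ln N) \<le> exp (y / ?a - ln N)" by (rule exp_ge_add_one_self)
      ultimately have "y / ?a \<le> ln N + exp (y / ?a) / N" by linarith
      then have "?a * (y / ?a) \<le> ?a * (ln N + exp (y / ?a) / N)" using L by (intro mult_left_mono) auto
      then have y: "y \<le> ?a * ln N + ?a / N * exp (y / ?a)" using L by (simp add: distrib_left)
      have "\<Lambda> v x * y \<le> \<Lambda> v x * (?a * ln N + ?a / N * exp (y / ?a))" using y \<Lambda>1[OF x v] by (intro mult_left_mono)
      also have "\<dots> \<le> \<Lambda> v x * (?a * ln N) + 1 * (?a / N * exp (y / ?a))"
        unfolding distrib_left using \<Lambda>1[OF x v] L N1 by (intro add_left_mono mult_right_mono) auto
      finally show "\<Lambda> v x * inner_Rn n x \<theta> \<le> ?a * ln N * \<Lambda> v x + ?a / N * exp (inner_Rn n x \<theta> / ?a)"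
        by (simp add: y_def mult.commute)
    qed
    also have "\<dots> = ?a * ln N * ?E (\<Lambda> v) + ?a / N * ?E (\<lambda>x. exp (inner_Rn n x \<theta> / ?a))"
      using int_L[OF v] exp_mom(2)[OF \<theta>] by simp
    also have "\<dots> \<le> ?a * ln N * ?E (\<Lambda> v) + ?a / N * 4"
      using exp_mom(1)[OF \<theta>] L N1 by (intro add_left_mono mult_left_mono) auto
    finally show ?thesis by (simp add: s_def mult.commute)
  qed
  \<comment> \<open>The weights have total mass 1, so the main terms give \<open>?a * ln N\<close>;
    at most \<open>N\<close> remainders of size \<open>4 * ?a / N\<close> add
    \<open>4 * ?a\<close>.\<close>
  have u_sum: "(\<Sum>v\<in>W. sqrt (inner_Rn n (u v) (u v))) \<le> ?a * (ln N + 4)"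
  proof -
    have "(\<Sum>v\<in>W. sqrt (inner_Rn n (u v) (u v))) \<le> (\<Sum>v\<in>W. ?a * ln N * ?E (\<Lambda> v) + 4 * ?a / N)"
      by (intro sum_mono u_norm)
    also have "\<dots> = ?a * ln N * (\<Sum>v\<in>W. ?E (\<Lambda> v)) + real (card W) * (4 * ?a / N)"
      by (simp add: sum.distrib sum_distrib_left)
    also have "(\<Sum>v\<in>W. ?E (\<Lambda> v)) = ?E (\<lambda>x. \<Sum>v\<in>W. \<Lambda> v x)"
      by (intro Bochner_Integration.integral_sum[symmetric] int_L)
    also have "\<dots> = ?E (\<lambda>x. 1)"
      by (intro Bochner_Integration.integral_cong refl) (use \<Lambda> in \<open>simp add: space_Q\<close>)
    also have "\<dots> = 1" using Q.prob_space by simp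
    also have "real (card W) * (4 * ?a / N) \<le> N * (4 * ?a / N)" using W(3) L N1 by (intro mult_right_mono) auto
    finally show ?thesis using N1 by (simp add: algebra_simps)
  qed
  \<comment> \<open>The defect of the reproducing formula caused by inexact barycentric
    coordinates.\<close>
  define e where "e z j = ?E (\<lambda>x. (x j - (\<Sum>v\<in>W. \<Lambda> v x * v j)) * inner_Rn n x z)" for z j
  have e_eq: "L\<^sup>2 * z j = (\<Sum>v\<in>W. inner_Rn n (u v) z * v j) + e z j" if z: "z \<in> Rn n" and j: "j < n" for z j
  proof -
    have factor: "(\<Sum>v\<in>W. (\<Lambda> v x * inner_Rn n x z) * v j) = (\<Sum>v\<in>W. \<Lambda> v x * v j) * inner_Rn n x z" for x
      unfolding sum_distrib_right by (intro sum.cong refl) simp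
    have "L\<^sup>2 * z j = ?E (\<lambda>x. x j * inner_Rn n x z)"
      using E_pol[of "unit_Rn j" z] z j by simp
    also have "\<dots> = ?E (\<lambda>x. (\<Sum>v\<in>W. (\<Lambda> v x * inner_Rn n x z) * v j) + (x j - (\<Sum>v\<in>W. \<Lambda> v x * v j)) * inner_Rn n x z)"
      unfolding factor by (intro Bochner_Integration.integral_cong refl) (simp add: left_diff_distrib)
    also have "\<dots> = ?E (\<lambda>x. (\<Sum>v\<in>W. (\<Lambda> v x * inner_Rn n x z) * v j)) + e z j"
      unfolding e_def
    proof (rule Bochner_Integration.integral_add)
      show "integrable Q (\<lambda>x. \<Sum>v\<in>W. (\<Lambda> v x * inner_Rn n x z) * v j)"
        by (intro Bochner_Integration.integrable_sum integrable_mult_left int_lam)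
      have "integrable Q (\<lambda>x. x j * inner_Rn n x z)" using int_in[of "unit_Rn j" z] j by simp
      moreover have "integrable Q (\<lambda>x. \<Sum>v\<in>W. (\<Lambda> v x * inner_Rn n x z) * v j)" by fact
      ultimately have "integrable Q (\<lambda>x. x j * inner_Rn n x z - (\<Sum>v\<in>W. (\<Lambda> v x * inner_Rn n x z) * v j))"
        by (rule Bochner_Integration.integrable_diff)
      then show "integrable Q (\<lambda>x. (x j - (\<Sum>v\<in>W. \<Lambda> v x * v j)) * inner_Rn n x z)"
        unfolding factor left_diff_distrib .
    qed
    also have "?E (\<lambda>x. (\<Sum>v\<in>W. (\<Lambda> v x * inner_Rn n x z) * v j)) = (\<Sum>v\<in>W. ?E (\<lambda>x. \<Lambda> v x * inner_Rn n x z) * v j)"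
      by (subst Bochner_Integration.integral_sum) (auto intro!: integrable_mult_left int_lam)
    also have "\<dots> = (\<Sum>v\<in>W. inner_Rn n (u v) z * v j)" by (intro sum.cong) (simp_all add: u_in)
    finally show ?thesis .
  qed
  have e_le: "\<bar>e z j\<bar> \<le> \<delta> * (\<Sum>k<n. D * \<bar>z k\<bar>)" if j: "j < n" for z j
  proof -
    have pt: "\<bar>(x j - (\<Sum>v\<in>W. \<Lambda> v x * v j)) * inner_Rn n x z\<bar> \<le> \<delta> * (\<Sum>k<n. D * \<bar>z k\<bar>)" if x: "x \<in> K" for x
      unfolding abs_mult using \<Lambda> x j box(1) \<delta> by (intro mult_mono abs_inner_Rn_le_box) auto
    have "\<bar>e z j\<bar> \<le> ?E (\<lambda>x. \<bar>(x j - (\<Sum>v\<in>W. \<Lambda> v x * v j)) * inner_Rn n x z\<bar>)"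
      unfolding e_def by (rule integral_abs_bound)
    also have "\<dots> \<le> ?E (\<lambda>x. \<delta> * (\<Sum>k<n. D * \<bar>z k\<bar>))"
      by (rule integral_mono) (use pt in \<open>auto intro!: bd[of _ "\<delta> * (\<Sum>k<n. D * \<bar>z k\<bar>)"] simp: space_Q\<close>)
    also have "\<dots> = \<delta> * (\<Sum>k<n. D * \<bar>z k\<bar>)" using Q.prob_space by simp
    finally show ?thesis .
  qed
  \<comment> \<open>\<open>z\<close> is the midpoint of an absolutely convex combination
    \<open>p\<close> of the generators and a correction \<open>q\<close> in the small box. Taking
    the midpoint accounts for the factor 2 in both conditions.\<close>
  have in_K: "z \<in> K" if z: "z \<in> Rn n" and 1: "2 / L\<^sup>2 * (\<Sum>v\<in>W. \<bar>inner_Rn n (u v) z\<bar>) \<le> 1"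
    and 2: "2 * \<delta> * D / (r * L\<^sup>2) * (\<Sum>k<n. \<bar>z k\<bar>) \<le> 1" for z
  proof -
    define p where "p = (\<Sum>v\<in>W. (2 / L\<^sup>2 * inner_Rn n (u v) z) *\<^sub>R v)"
    have "p \<in> K" unfolding p_def
    proof (rule absolutely_convex_combination[OF W(1) WK conv sym K0])
      show "(\<Sum>v\<in>W. \<bar>2 / L\<^sup>2 * inner_Rn n (u v) z\<bar>) \<le> 1"
        using 1 by (simp add: abs_mult sum_distrib_left)
    qed
    define q where "q = (\<lambda>j. if j < n then 2 / L\<^sup>2 * e z j else 0)"
    have "\<bar>q j\<bar> \<le> r" if "j < n" for j
    proof -
      have "\<bar>q j\<bar> = 2 / L\<^sup>2 * \<bar>e z j\<bar>" using that by (simp add: q_def abs_mult)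
      also have "\<dots> \<le> 2 / L\<^sup>2 * (\<delta> * (\<Sum>k<n. D * \<bar>z k\<bar>))" by (intro mult_left_mono e_le that) auto
      also have "\<dots> = r * (2 * \<delta> * D / (r * L\<^sup>2) * (\<Sum>k<n. \<bar>z k\<bar>))"
        using box(3) by (simp add: sum_distrib_left[symmetric])
      also have "\<dots> \<le> r * 1" using 2 box(3) by (intro mult_left_mono) auto
      finally show ?thesis by simp
    qed
    then have "q \<in> box_Rn n r" by (simp add: box_Rn_iff q_def)
    then have "q \<in> K" using box(4) by blast
    have "(1 / 2) *\<^sub>R p + (1 / 2) *\<^sub>R q = z"
    proof
      fix j
      show "((1 / 2) *\<^sub>R p + (1 / 2) *\<^sub>R q) j = z j"
      proof (cases "j < n")
        case True
        have "((1 / 2) *\<^sub>R p + (1 / 2) *\<^sub>R q) j = 1 / L\<^sup>2 * ((\<Sum>v\<in>W. inner_Rn n (u v) z * v j) + e z j)"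
          using True by (simp add: p_def q_def sum_fun_apply sum_distrib_left distrib_left mult.assoc sum_divide_distrib)
        also have "\<dots> = z j" using e_eq[OF z True] L by (metis less_irrefl nonzero_mult_div_cancel_left power_not_zero times_divide_eq_left mult_1)
        finally show ?thesis .
      next
        case False
        then have "p j = 0" using \<open>p \<in> K\<close> KR by (auto simp: Rn_iff)
        then show ?thesis using False z by (simp add: q_def Rn_iff)
      qed
    qed
    moreover have "(1 / 2) *\<^sub>R p + (1 / 2) *\<^sub>R q \<in> K"
      using \<open>p \<in> K\<close> \<open>q \<in> K\<close> by (intro convexD[OF conv]) auto
    ultimately show ?thesis by simp
  qed
  \<comment> \<open>Markov's inequality: outside \<open>K\<close> one of \<open>A\<close> and
    \<open>B\<close> exceeds 1, so their sum dominates the indicator of the complement.\<close>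
  define A where "A z = 2 / L\<^sup>2 * (\<Sum>v\<in>W. \<bar>inner_Rn n (u v) z\<bar>)" for z
  define B where "B z = 2 * \<delta> * D / (r * L\<^sup>2) * (\<Sum>k<n. \<bar>z k\<bar>)" for z :: "nat \<Rightarrow> real"
  have A0: "A z \<ge> 0" and B0: "B z \<ge> 0" for z
    using box \<delta> by (auto simp: A_def B_def intro!: mult_nonneg_nonneg sum_nonneg divide_nonneg_nonneg)
  have gauss_abs_m: "(\<lambda>z. ennreal (\<bar>inner_Rn n w z\<bar> * gauss_Rn n \<sigma> z)) \<in> borel_measurable ?M" for w
    by measurable
  have A_int: "(\<integral>\<^sup>+z. ennreal (A z) * ennreal (gauss_Rn n \<sigma> z) \<partial>?M) \<le> ennreal (1 / 4)"
  proof -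
    have "(\<integral>\<^sup>+z. ennreal (A z) * ennreal (gauss_Rn n \<sigma> z) \<partial>?M)
      = (\<integral>\<^sup>+z. ennreal (2 / L\<^sup>2) * (\<Sum>v\<in>W. ennreal (\<bar>inner_Rn n (u v) z\<bar> * gauss_Rn n \<sigma> z)) \<partial>?M)"
      by (intro nn_integral_cong)
         (simp add: A_def sum_ennreal ennreal_mult[symmetric] sum_nonneg sum_distrib_right[symmetric] mult.assoc)
    also have "\<dots> = ennreal (2 / L\<^sup>2) * (\<Sum>v\<in>W. \<integral>\<^sup>+z. ennreal (\<bar>inner_Rn n (u v) z\<bar> * gauss_Rn n \<sigma> z) \<partial>?M)"
      by (simp add: nn_integral_cmult nn_integral_sum gauss_abs_m del: sum_ennreal)
    also have "\<dots> \<le> ennreal (2 / L\<^sup>2) * (\<Sum>v\<in>W. ennreal (4 * \<sigma> * sqrt (inner_Rn n (u v) (u v))))"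
      by (intro mult_left_mono sum_mono nn_integral_gauss_abs \<sigma>) auto
    also have "\<dots> = ennreal (2 / L\<^sup>2 * (4 * \<sigma> * (\<Sum>v\<in>W. sqrt (inner_Rn n (u v) (u v)))))"
      using \<sigma> by (simp add: sum_ennreal ennreal_mult[symmetric] sum_nonneg sum_distrib_left[symmetric])
    also have "\<dots> \<le> ennreal (2 / L\<^sup>2 * (4 * \<sigma> * (?a * (ln N + 4))))"
      using \<sigma> u_sum by (intro ennreal_leI mult_left_mono) auto
    also have "2 / L\<^sup>2 * (4 * \<sigma> * (?a * (ln N + 4))) = 1 / 4"
    proof -
      have "2 / l * (4 * (l / (32 * h)) * h) = 1 / 4" if "l > 0" "h > 0" for l h :: real
        using that by (simp add: divide_simps)
      then show ?thesis unfolding \<sigma>_def using pos L by (metis zero_less_power)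
    qed
    finally show ?thesis .
  qed
  have B_int: "(\<integral>\<^sup>+z. ennreal (B z) * ennreal (gauss_Rn n \<sigma> z) \<partial>?M) \<le> ennreal (1 / 4)"
  proof -
    let ?c = "2 * \<delta> * D / (r * L\<^sup>2)"
    have c: "?c \<ge> 0" using \<delta> box by simp
    have "(\<integral>\<^sup>+z. ennreal (B z) * ennreal (gauss_Rn n \<sigma> z) \<partial>?M)
      = (\<integral>\<^sup>+z. ennreal ?c * (\<Sum>k<n. ennreal (\<bar>inner_Rn n (unit_Rn k) z\<bar> * gauss_Rn n \<sigma> z)) \<partial>?M)"
    proof (intro nn_integral_cong)
      fix z
      have "B z * gauss_Rn n \<sigma> z = ?c * (\<Sum>k<n. \<bar>inner_Rn n (unit_Rn k) z\<bar> * gauss_Rn n \<sigma> z)"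
        by (simp add: B_def sum_distrib_right mult.assoc)
      then show "ennreal (B z) * ennreal (gauss_Rn n \<sigma> z)
        = ennreal ?c * (\<Sum>k<n. ennreal (\<bar>inner_Rn n (unit_Rn k) z\<bar> * gauss_Rn n \<sigma> z))"
        using c B0 by (subst sum_ennreal) (simp_all only: ennreal_mult[symmetric] gauss_Rn_nonneg sum_nonneg mult_nonneg_nonneg abs_ge_zero)
    qed
    also have "\<dots> = ennreal ?c * (\<Sum>k<n. \<integral>\<^sup>+z. ennreal (\<bar>inner_Rn n (unit_Rn k) z\<bar> * gauss_Rn n \<sigma> z) \<partial>?M)"
      by (simp add: nn_integral_cmult nn_integral_sum gauss_abs_m del: sum_ennreal)
    also have "\<dots> \<le> ennreal ?c * (\<Sum>k<n. ennreal (4 * \<sigma> * sqrt (inner_Rn n (unit_Rn k) (unit_Rn k))))"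
      by (intro mult_left_mono sum_mono nn_integral_gauss_abs \<sigma>) auto
    also have "\<dots> = ennreal ?c * (\<Sum>k<n. ennreal (4 * \<sigma>))"
    proof -
      have "unit_Rn k k = 1" for k by (simp add: unit_Rn_def)
      then show ?thesis by simp
    qed
    also have "\<dots> = ennreal (?c * (real n * (4 * \<sigma>)))"
      using c \<sigma> by (subst sum_ennreal) (simp_all add: ennreal_mult[symmetric])
    also have "?c * (real n * (4 * \<sigma>)) = 1 / 4"
      using box L \<sigma> n unfolding \<delta>_def by (simp add: divide_simps)
    finally show ?thesis .
  qed
  have "\<sigma> \<le> 1"
  proof (rule gauss_sigma_le_1[OF \<sigma> n K])
    show "emeasure ?M K \<le> 1" using vol by simp
    have [measurable]: "A \<in> borel_measurable borel" "B \<in> borel_measurable borel"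
      unfolding A_def[abs_def] B_def[abs_def] by measurable
    show "(\<lambda>z. ennreal (A z) + ennreal (B z)) \<in> borel_measurable borel" by measurable
    show "1 \<le> ennreal (A z) + ennreal (B z)" if "z \<in> Rn n" "z \<notin> K" for z
    proof -
      have "\<not> (A z \<le> 1 \<and> B z \<le> 1)" using in_K[OF that(1)] that(2) unfolding A_def B_def by blast
      then have "1 \<le> A z + B z" using A0[of z] B0[of z] by linarith
      then show ?thesis using A0[of z] B0[of z] by (simp add: ennreal_plus[symmetric] ennreal_ge_1 del: ennreal_plus)
    qed
    have "(\<integral>\<^sup>+z. (ennreal (A z) + ennreal (B z)) * ennreal (gauss_Rn n \<sigma> z) \<partial>?M)
      = (\<integral>\<^sup>+z. ennreal (A z) * ennreal (gauss_Rn n \<sigma> z) \<partial>?M) + (\<integral>\<^sup>+z. ennreal (B z) * ennreal (gauss_Rn n \<sigma> z) \<partial>?M)"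
      unfolding distrib_right by (rule nn_integral_add) measurable
    also have "\<dots> \<le> ennreal (1 / 4) + ennreal (1 / 4)" by (intro add_mono A_int B_int)
    also have "\<dots> = ennreal (1 / 2)" by (subst ennreal_plus[symmetric]) auto
    finally show "(\<integral>\<^sup>+z. (ennreal (A z) + ennreal (B z)) * ennreal (gauss_Rn n \<sigma> z) \<partial>?M) \<le> ennreal (1 / 2)" .
  qed
  \<comment> \<open>One factor \<open>L\<close> cancels because the exponential scale
    \<open>6 * L\<close> is itself proportional to \<open>L\<close>; 192 is 32 times 6.\<close>
  then have "L\<^sup>2 \<le> 32 * (6 * L * (ln N + 4))" using pos by (simp add: \<sigma>_def divide_le_eq)
  then have "L * L \<le> L * (192 * (ln N + 4))" by (simp add: power2_eq_square algebra_simps)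
  then show ?thesis using L by (simp add: mult_le_cancel_left_pos)
qed

text \<open>The images of the vertices generate the image of \<open>P\<close>, so the bound for
  hulls applies with \<open>N = 2 * m\<close>; boundedness of the inverse map supplies the box
  inside the image.\<close>

lemma isotropic_constant_vertices:
  assumes n: "n \<ge> 1" and P: "symmetric_polytope n P" and m: "card (vertices P) = 2 * m"
  shows "isotropic_constant n P \<le> 2112 * ln (1 + real m)"
proof -
  let ?M = "lborel_Rn n"
  obtain T L where T: "linear T" "bij_betw T (Rn n) (Rn n)" and vol: "emeasure ?M (T ` P) = 1"
    and L: "L > 0" "isotropic_constant n P = L"
    and iso: "\<forall>\<theta>\<in>Rn n. nn_moment n (T ` P) \<theta> = ennreal (L\<^sup>2 * inner_Rn n \<theta> \<theta>)"
    by (rule isotropic_constant_witness[OF n P])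
  obtain V where V: "finite V" "P = convex hull V" and PR: "P \<subseteq> Rn n" and Psym: "P = uminus ` P"
    using P by (auto simp: symmetric_polytope_def polytope_def)
  have hull: "P = convex hull (vertices P)"
    using convex_hull_extreme_points_finite[OF V(1)] unfolding vertices_def V(2) by simp
  have fin: "finite (vertices P)"
    using V(1) extreme_points_of_convex_hull[of V] unfolding vertices_def V(2) by (rule finite_subset[rotated])
  obtain r0 where r0: "r0 > 0" "box_Rn n r0 \<subseteq> P" by (rule symmetric_polytope_contains_box[OF P])
  have "0 \<in> P" using r0 by (auto simp: box_Rn_iff subset_iff)
  then have ne: "vertices P \<noteq> {}" using hull by auto
  then have m1: "m \<ge> 1" using fin m by (metis card_0_eq less_one mult_0_right not_le)
  obtain D where D: "D > 0" "T ` P \<subseteq> box_Rn n D" and TP: "T ` P \<in> sets borel"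
    by (rule linear_image_symmetric_polytope[OF P T])
  obtain S where S: "linear S" "\<And>x. x \<in> Rn n \<Longrightarrow> S x \<in> Rn n" "\<And>x. x \<in> Rn n \<Longrightarrow> T (S x) = x"
    using linear_inverse_Rn[OF T] by metis
  obtain C where C: "C > 0" "\<And>r x. x \<in> box_Rn n r \<Longrightarrow> S x \<in> box_Rn n (C * r)"
    using linear_box_Rn[OF S(1,2)] by metis
  have inner_box: "box_Rn n (r0 / C) \<subseteq> T ` P"
  proof
    fix x assume x: "x \<in> box_Rn n (r0 / C)"
    then have "S x \<in> P" using C(2)[OF x] C(1) r0(2) by auto
    moreover have "x = T (S x)" using S(3)[of x] x by (simp add: box_Rn_def)
    ultimately show "x \<in> T ` P" by blast
  qed
  have "L \<le> 192 * (ln (2 * real m) + 4)"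
  proof (rule isotropic_convex_hull_bound[where D=D and r="r0 / C", OF n])
    show "finite (T ` vertices P)" "T ` vertices P \<noteq> {}" using fin ne by auto
    show "real (card (T ` vertices P)) \<le> 2 * real m" using card_image_le[OF fin, of T] m by simp
    show "T ` P = convex hull (T ` vertices P)"
      by (subst hull) (rule convex_hull_linear_image[OF T(1)])
    show "r0 / C > 0" using r0 C by simp
    show "- x \<in> T ` P" if x: "x \<in> T ` P" for x
    proof -
      obtain y where y: "y \<in> P" "x = T y" using x by blast
      then have "- y \<in> P" using Psym by blast
      moreover have "- x = T (- y)" using y linear_neg[OF T(1)] by simp
      ultimately show ?thesis by blast
    qed
  qed (use TP D inner_box vol L iso in auto)
  also have "ln (2 * real m) \<le> ln 2 + ln (1 + real m)"
    using m1 by (simp add: ln_mult)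
  \<comment> \<open>As \<open>ln 2 \<ge> 2 / 3\<close> and \<open>m \<ge> 1\<close>, the constant 4
    is at most \<open>6 * ln (1 + real m)\<close>, so 8 times 192 would already do; 2112 is 11 times
    192.\<close>
  also have "192 * (ln 2 + ln (1 + real m) + 4) \<le> 2112 * ln (1 + real m)"
  proof -
    have le: "192 * (x + l + 4) \<le> 2112 * l" if "2 / 3 \<le> x" "x \<le> l" for x l :: real
      using that by (simp add: distrib_left)
    show ?thesis by (rule le[OF ln2_ge_two_thirds]) (use m1 in simp)
  qed
  finally show ?thesis using L(2) by simp
qed

theorem mainTheorem7:
  shows "\<exists>C::real. C > 0 \<and>
    (\<forall>n\<ge>1. \<forall>P. symmetric_polytope n P \<longrightarrow>
      (\<forall>m::nat. card (facets n P) = 2 * m \<longrightarrow>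
         isotropic_constant n P \<le> C * sqrt (ln (1 + real m))) \<and>
      (\<forall>m::nat. card (vertices P) = 2 * m \<longrightarrow>
         isotropic_constant n P \<le> C * ln (1 + real m)))"
\<comment> \<open>The constant of the vertex bound also covers the facet bound, where 3 was
  obtained.\<close>
proof (intro exI[of _ 2112] conjI allI impI)
  fix n m :: nat and P
  assume *: "1 \<le> n" "symmetric_polytope n P"
  show "isotropic_constant n P \<le> 2112 * sqrt (ln (1 + real m))" if "card (facets n P) = 2 * m"
  proof -
    have "3 * sqrt (ln (1 + real m)) \<le> 2112 * sqrt (ln (1 + real m))"
      by (intro mult_right_mono) simp_all
    then show ?thesis using isotropic_constant_facets[OF * that] by linarith
  qed
  show "isotropic_constant n P \<le> 2112 * ln (1 + real m)" if "card (vertices P) = 2 * m"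
    using isotropic_constant_vertices[OF * that] .
qed simp

end
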